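(* Let $k$ be a field and let $\mathcal{H}$ be a properly-connected hypergraph. Let $d$ be the common cardinality of the edges of $\mathcal{H}$, and let $c$ be the maximal number of pairwise $(d+1)$-disjoint edges of $\mathcal{H}$. Then: (i) $\operatorname{reg}(\mathcal{I}(\mathcal{H}))\ge (d-1)c+1$. (ii) If $\mathcal{H}$ is also triangulated, then $\operatorname{reg}(\mathcal{I}(\mathcal{H}))=(d-1)c+1$.
   Context: A simple hypergraph $\mathcal{H}=(\mathcal{X},\mathcal{E})$ consists of a finite set $\mathcal{X}=\{x_1,\dots,x_n\}$ of vertices and a family $\mathcal{E}$ of distinct subsets (edges) with $|E|\ge 2$ for all edges and no edge contained in a different edge; all hypergraphs are simple. Let $R=k[x_1,\dots,x_n]$, $x^E=\prod_{x\in E}x$, and $\mathcal{I}(\mathcal{H})=(x^E: E\in\mathcal{E})\subseteq R$ (edge ideal). $\operatorname{reg}(I)=\max\{j-i : \beta_{i,j}(I)\ne 0\}$, with the convention $\operatorname{reg}(0)=1$. $\mathcal{H}$ is $d$-uniform if all edges have cardinality $d$. A chain of length $n$ is a sequence $(E_0,x_1,E_1,\dots,x_n,E_n)$ with $x_1,\dots,x_n$ distinct vertices, $E_0,\dots,E_n$ distinct edges, $x_1\in E_0$, $x_n\in E_n$, and $x_k,x_{k+1}\in E_k$ for $1\le k\le n-1$. In a $d$-uniform hypergraph it is proper if $|E_i\cap E_{i+1}|=d-1$ for all $i$, and a proper chain is irredundant if no proper subsequence is a proper chain from $E_0$ to $E_n$. $\operatorname{dist}_{\mathcal{H}}(E,E')$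 is the minimum length of a proper irredundant chain from $E$ to $E'$ ($\infty$ if none exists). A $d$-uniform hypergraph is properly-connected if $\operatorname{dist}_{\mathcal{H}}(E,E')=d-|E\cap E'|$ for all edges $E,E'$ with $E\cap E'\neq\emptyset$. Two edges $E,H$ are $t$-disjoint if $\operatorname{dist}_{\mathcal{H}}(E,H)\ge t$; a set of edges is pairwise $t$-disjoint if every two distinct edges in it are $t$-disjoint. For $\mathcal{Y}\subseteq\mathcal{X}$, the induced hypergraph $\mathcal{H}_{\mathcal{Y}}$ has vertex set $\mathcal{Y}$ and edges $\{E\in\mathcal{E}: E\subseteq\mathcal{Y}\}$. Two distinct vertices are neighbors if some edge contains both; $N(x)$ is the set of neighbors of $x$. The $d$-complete hypergraph of order $m$ has $m$ vertices and all $d$-subsets as edges ($m$ isolated vertices if $m<d$). A $d$-uniform properly-connected hypergraph is triangulated if for every nonempty $\mathcal{Y}\subseteq\mathcal{X}$ there is a vertex $x\in\mathcal{Y}$ such that the induced hypergraph of $\mathcal{H}_{\mathcal{Y}}$ on $N(x)\cup\{x\}$ (with $N(x)$ computed in $\mathcal{H}_{\mathcal{Y}}$) is the $d$-complete hypergraph of order $|N(x)|+1$. *)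

theory Defs
  imports
    "HOL-Library.Poly_Mapping"
    "HOL-Library.Sublist"
    "HOL-Library.Extended_Nat"
    "Jordan_Normal_Form.Matrix"
begin

section \<open>Hypergraphs\<close>

record 'v hypergraph =
  verts :: "'v set"
  edges :: "'v set set"

definition simple_hypergraph :: "'v hypergraph \<Rightarrow> bool" where
  "simple_hypergraph H \<longleftrightarrow>
     finite (verts H) \<and>
     (\<forall>E\<in>edges H. E \<subseteq> verts H \<and> card E \<ge> 2) \<and>
     (\<forall>E\<in>edges H. \<forall>F\<in>edges H. E \<subseteq> F \<longrightarrow> E = F)"

definition uniform_hypergraph :: "nat \<Rightarrow> 'v hypergraph \<Rightarrow> bool" where
  "uniform_hypergraph d H \<longleftrightarrow> (\<forall>E\<in>edges H. card E = d)"

text \<open>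
  A chain \<open>(E\<^sub>0, x\<^sub>1, E\<^sub>1, \<dots>, x\<^sub>n, E\<^sub>n)\<close> is given by its list of edges \<open>Es\<close> (of length \<open>n + 1\<close>)
  and its list of vertices \<open>xs\<close> (of length \<open>n\<close>), so that \<open>Es ! i\<close> is \<open>E\<^sub>i\<close> and \<open>xs ! i\<close> is
  \<open>x\<^sub>i\<^sub>+\<^sub>1\<close>. The incidences \<open>x\<^sub>1 \<in> E\<^sub>0\<close>, \<open>x\<^sub>n \<in> E\<^sub>n\<close> and \<open>x\<^sub>k, x\<^sub>k\<^sub>+\<^sub>1 \<in> E\<^sub>k\<close> for
  \<open>1 \<le> k \<le> n - 1\<close> together say that \<open>x\<^sub>i\<^sub>+\<^sub>1\<close> lies in \<open>E\<^sub>i\<close> and in \<open>E\<^sub>i\<^sub>+\<^sub>1\<close> for all \<open>i < n\<close>.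
  The case \<open>n = 0\<close>, a single edge, is allowed; it makes the distance of an edge to itself 0.
\<close>

definition chain :: "'v hypergraph \<Rightarrow> 'v set list \<Rightarrow> 'v list \<Rightarrow> bool" where
  "chain H Es xs \<longleftrightarrow>
     length Es = Suc (length xs) \<and>
     set Es \<subseteq> edges H \<and> set xs \<subseteq> verts H \<and> distinct Es \<and> distinct xs \<and>
     (\<forall>i<length xs. xs ! i \<in> Es ! i \<and> xs ! i \<in> Es ! Suc i)"

definition proper_chain ::
  "nat \<Rightarrow> 'v hypergraph \<Rightarrow> 'v set \<Rightarrow> 'v set \<Rightarrow> 'v set list \<Rightarrow> 'v list \<Rightarrow> bool" where
  "proper_chain d H E F Es xs \<longleftrightarrow>
     chain H Es xs \<and> hd Es = E \<and> last Es = F \<and>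
     (\<forall>i<length xs. card (Es ! i \<inter> Es ! Suc i) = d - 1)"

text \<open>The alternating sequence \<open>[E\<^sub>0, x\<^sub>1, E\<^sub>1, \<dots>, x\<^sub>n, E\<^sub>n]\<close> as one list.\<close>

definition chain_seq :: "'v set list \<Rightarrow> 'v list \<Rightarrow> ('v set + 'v) list" where
  "chain_seq Es xs = splice (map Inl Es) (map Inr xs)"

definition proper_irredundant_chain ::
  "nat \<Rightarrow> 'v hypergraph \<Rightarrow> 'v set \<Rightarrow> 'v set \<Rightarrow> 'v set list \<Rightarrow> 'v list \<Rightarrow> bool" where
  "proper_irredundant_chain d H E F Es xs \<longleftrightarrow>
     proper_chain d H E F Es xs \<and>
     (\<nexists>Es' xs'. proper_chain d H E F Es' xs' \<and>
        strict_subseq (chain_seq Es' xs') (chain_seq Es xs))"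

text \<open>\<open>Inf {} = \<infinity>\<close> in \<^typ>\<open>enat\<close>.\<close>

definition edge_dist :: "nat \<Rightarrow> 'v hypergraph \<Rightarrow> 'v set \<Rightarrow> 'v set \<Rightarrow> enat" where
  "edge_dist d H E F =
     Inf {enat (length xs) | Es xs. proper_irredundant_chain d H E F Es xs}"

definition properly_connected :: "nat \<Rightarrow> 'v hypergraph \<Rightarrow> bool" where
  "properly_connected d H \<longleftrightarrow>
     uniform_hypergraph d H \<and>
     (\<forall>E\<in>edges H. \<forall>F\<in>edges H. E \<inter> F \<noteq> {} \<longrightarrow>
        edge_dist d H E F = enat (d - card (E \<inter> F)))"

definition t_disjoint :: "nat \<Rightarrow> 'v hypergraph \<Rightarrow> nat \<Rightarrow> 'v set \<Rightarrow> 'v set \<Rightarrow> bool" where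
  "t_disjoint d H t E F \<longleftrightarrow> edge_dist d H E F \<ge> enat t"

definition max_disjoint :: "nat \<Rightarrow> 'v hypergraph \<Rightarrow> nat \<Rightarrow> nat" where
  "max_disjoint d H t = Max {card S | S. S \<subseteq> edges H \<and> pairwise (t_disjoint d H t) S}"

definition induced_hypergraph :: "'v hypergraph \<Rightarrow> 'v set \<Rightarrow> 'v hypergraph" where
  "induced_hypergraph H Y = \<lparr>verts = Y, edges = {E \<in> edges H. E \<subseteq> Y}\<rparr>"

definition neighbors :: "'v hypergraph \<Rightarrow> 'v \<Rightarrow> 'v set" where
  "neighbors H x = {y \<in> verts H. y \<noteq> x \<and> (\<exists>E\<in>edges H. x \<in> E \<and> y \<in> E)}"

definition complete_hypergraph :: "nat \<Rightarrow> nat \<Rightarrow> 'v hypergraph \<Rightarrow> bool" where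
  "complete_hypergraph d m H \<longleftrightarrow>
     finite (verts H) \<and> card (verts H) = m \<and>
     edges H = {E. E \<subseteq> verts H \<and> card E = d}"

definition triangulated :: "nat \<Rightarrow> 'v hypergraph \<Rightarrow> bool" where
  "triangulated d H \<longleftrightarrow>
     properly_connected d H \<and>
     (\<forall>Y\<subseteq>verts H. Y \<noteq> {} \<longrightarrow>
        (\<exists>x\<in>Y. let N = neighbors (induced_hypergraph H Y) x in
           complete_hypergraph d (card N + 1)
             (induced_hypergraph (induced_hypergraph H Y) (N \<union> {x}))))"


section \<open>Polynomials and edge ideals\<close>

text \<open>
  A monomial is a finitely supported exponent function and a polynomial a finitely supported
  function from monomials to coefficients, with the convolution product of \<open>Poly_Mapping\<close>.
  The polynomial ring over the variables in \<open>X\<close> is the subring \<open>polys X\<close>.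
\<close>

type_synonym ('v, 'k) mpoly = "('v \<Rightarrow>\<^sub>0 nat) \<Rightarrow>\<^sub>0 'k"

definition polys :: "'v set \<Rightarrow> ('v, 'k::zero) mpoly set" where
  "polys X = {p. \<forall>m\<in>Poly_Mapping.keys p. Poly_Mapping.keys m \<subseteq> X}"

definition variable :: "'v \<Rightarrow> ('v, 'k::zero_neq_one) mpoly" where
  "variable x = Poly_Mapping.single (Poly_Mapping.single x 1) 1"

definition mon_degree :: "('v \<Rightarrow>\<^sub>0 nat) \<Rightarrow> nat" where
  "mon_degree m = (\<Sum>x\<in>Poly_Mapping.keys m. Poly_Mapping.lookup m x)"

definition edge_ideal :: "'v hypergraph \<Rightarrow> ('v, 'k::field) mpoly set" where
  "edge_ideal H =
     {\<Sum>E\<in>edges H. f E * (\<Prod>x\<in>E. variable x) | f. \<forall>E\<in>edges H. f E \<in> polys (verts H)}"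


section \<open>Minimal graded free resolutions, Betti numbers and regularity\<close>

text \<open>
  The \<open>i\<close>-th free module of a resolution is \<open>F\<^sub>i = \<Oplus>\<^sub>a R(-s\<^sub>a)\<close>, where \<open>s\<close> is the list
  \<open>res_shifts F i\<close>. The augmentation \<open>F\<^sub>0 \<rightarrow> I\<close> maps the \<open>a\<close>-th basis element to
  \<open>res_aug F $ a\<close>, and \<open>res_map F i\<close> is the matrix of the differential \<open>F\<^sub>i\<^sub>+\<^sub>1 \<rightarrow> F\<^sub>i\<close>.
  Shifts may be taken in \<^typ>\<open>nat\<close>: the ideal \<open>I\<close> lives in degrees at least 0, and in a minimal
  resolution no basis element is mapped to 0.
\<close>

record (overloaded) ('v, 'k::zero) resolution =
  res_shifts :: "nat \<Rightarrow> nat list"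
  res_aug :: "('v, 'k) mpoly vec"
  res_map :: "nat \<Rightarrow> ('v, 'k) mpoly mat"

definition free_module :: "'v set \<Rightarrow> nat \<Rightarrow> ('v, 'k::zero) mpoly vec set" where
  "free_module X r = {v \<in> carrier_vec r. \<forall>a<r. v $ a \<in> polys X}"

abbreviation res_rank :: "('v, 'k::zero) resolution \<Rightarrow> nat \<Rightarrow> nat" where
  "res_rank F i \<equiv> length (res_shifts F i)"

text \<open>The maps are given by matrices over the polynomial ring and preserve degrees.\<close>

definition graded_maps :: "'v set \<Rightarrow> ('v, 'k::field) resolution \<Rightarrow> bool" where
  "graded_maps X F \<longleftrightarrow>
     res_aug F \<in> free_module X (res_rank F 0) \<and>
     (\<forall>a<res_rank F 0. \<forall>m\<in>Poly_Mapping.keys (res_aug F $ a).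
        mon_degree m = res_shifts F 0 ! a) \<and>
     (\<forall>i. res_map F i \<in> carrier_mat (res_rank F i) (res_rank F (Suc i)) \<and>
        (\<forall>a<res_rank F i. \<forall>b<res_rank F (Suc i).
           res_map F i $$ (a, b) \<in> polys X \<and>
           (\<forall>m\<in>Poly_Mapping.keys (res_map F i $$ (a, b)).
              mon_degree m + res_shifts F i ! a = res_shifts F (Suc i) ! b)))"

definition exact_resolution ::
  "'v set \<Rightarrow> ('v, 'k::field) mpoly set \<Rightarrow> ('v, 'k) resolution \<Rightarrow> bool" where
  "exact_resolution X I F \<longleftrightarrow>
     (\<lambda>v. res_aug F \<bullet> v) ` free_module X (res_rank F 0) = I \<and>
     (\<lambda>w. res_map F 0 *\<^sub>v w) ` free_module X (res_rank F 1) =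
       {v \<in> free_module X (res_rank F 0). res_aug F \<bullet> v = 0} \<and>
     (\<forall>i. (\<lambda>w. res_map F (Suc i) *\<^sub>v w) ` free_module X (res_rank F (Suc (Suc i))) =
        {v \<in> free_module X (res_rank F (Suc i)). res_map F i *\<^sub>v v = 0\<^sub>v (res_rank F i)})"

text \<open>
  Minimality means that each differential maps into \<open>\<mm> F\<^sub>i\<close>, where \<open>\<mm>\<close> is the ideal generated by
  the variables: the matrix entries have zero constant term.
\<close>

definition minimal_graded_free_resolution ::
  "'v set \<Rightarrow> ('v, 'k::field) mpoly set \<Rightarrow> ('v, 'k) resolution \<Rightarrow> bool" where
  "minimal_graded_free_resolution X I F \<longleftrightarrow>
     graded_maps X F \<and> exact_resolution X I F \<and>
     (\<forall>i. \<forall>a<res_rank F i. \<forall>b<res_rank F (Suc i).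
        Poly_Mapping.lookup (res_map F i $$ (a, b)) 0 = 0)"

text \<open>
  The number of summands \<open>R(-j)\<close> in the \<open>i\<close>-th module; it is the same for all minimal
  graded free resolutions of \<open>I\<close>.
\<close>

definition graded_betti :: "'v set \<Rightarrow> ('v, 'k::field) mpoly set \<Rightarrow> nat \<Rightarrow> nat \<Rightarrow> nat" where
  "graded_betti X I i j =
     count_list (res_shifts (SOME F. minimal_graded_free_resolution X I F) i) j"

definition regularity :: "'v set \<Rightarrow> ('v, 'k::field) mpoly set \<Rightarrow> int" where
  "regularity X I =
     (if I = {0} then 1 else Max {int j - int i | i j. graded_betti X I i j \<noteq> 0})"

end

theory Submission
  imports Defs "HOL-Library.Function_Algebras"
begin

text \<open>
  Let \<open>I\<close> be the edge ideal, \<open>R\<close> the polynomial ring over the vertices, and let \<open>H\<^sub>p(R/I)\<^sub>j\<close> be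
  the Koszul homology of \<open>R/I\<close> with respect to the variables, in homological degree \<open>p\<close> and
  internal degree \<open>j\<close>. A minimal graded free resolution of \<open>I\<close> has a summand \<open>R(-j)\<close> in step \<open>i\<close>
  if and only if \<open>H\<^sub>i\<^sub>+\<^sub>1(R/I)\<^sub>j \<noteq> 0\<close> (\<open>graded_betti_nonzero_iff\<close>). So the regularity is one more
  than the largest \<open>j - p\<close> with \<open>H\<^sub>p(R/I)\<^sub>j \<noteq> 0\<close> and \<open>p \<ge> 1\<close>, and everything can be decided in the Koszul
  complex, which for a monomial ideal splits into finite complexes of vector spaces, one for
  each multidegree.

  The comparison between resolution and Koszul complex is done by two zigzags through the double
  complex formed by both (\<open>zigzag_upward\<close>, \<open>zigzag_downward\<close>), using only that free modules have
  no Koszul homology in positive homological degree. The first zigzag also shows that a syzygy of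
  large degree in a minimal complex is a combination of syzygies of smaller degree with coefficients in the maximal
  ideal. This makes all syzygy modules finitely generated without any appeal to Noetherian rings,
  and minimal resolutions exist (\<open>minimal_graded_free_resolution_exists\<close>).

  The combinatorial input is an exchange property: in a properly-connected hypergraph two distinct
  edges \<open>E\<close>, \<open>G\<close> that meet are joined by a chain that loses a vertex of \<open>E\<close> and gains a vertex
  of \<open>G\<close> in every step, so \<open>E - e + g\<close> is an edge for some \<open>e \<in> E - G\<close>, \<open>g \<in> G - E\<close>. Likewise two distinct edges are
  \<open>(d + 1)\<close>-disjoint if and only if they are disjoint and no exchange of a vertex of the first for
  a vertex of the second yields an edge.

  Lower bound. Let \<open>Y\<close> be the union of \<open>c\<close> pairwise \<open>(d + 1)\<close>-disjoint edges. By exchange, no other edge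
  lies inside \<open>Y\<close>, so in multidegree \<open>Y\<close> the ideal looks like a complete intersection of \<open>c\<close> monomials of
  degree \<open>d\<close>. Choosing one vertex from each of the edges gives a Koszul cycle of homological degree \<open>c\<close>
  and internal degree \<open>c d\<close>. It is not a boundary, because the sum of the coefficients over
  all transversals vanishes on boundaries (\<open>transversal_sum_zero\<close>). So \<open>reg I \<ge> c d - (c - 1)\<close>.

  Upper bound. If \<open>J\<close> is a monomial ideal and \<open>m\<close> a monomial, then \<open>reg R/(J + (m))\<close> is at most
  the maximum of \<open>reg R/J\<close> and \<open>reg R/(J : m) + deg m - 1\<close> (\<open>reg_le_add_monomial\<close>). Take a vertex \<open>x\<close>
  whose neighbourhood is complete and add the edges through \<open>x\<close> one at a time to the edges avoiding
  \<open>x\<close>. When \<open>E\<close> is added, exchange shows that the colon ideal is generated by variables and by the edges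
  of an induced subhypergraph in which every edge is \<open>(d + 1)\<close>-disjoint from \<open>E\<close>. There the maximal
  number of pairwise \<open>(d + 1)\<close>-disjoint edges is at most \<open>c - 1\<close>, so by induction the colon ideal contributes
  at most \<open>(d - 1) (c - 1) + d - 1 = (d - 1) c\<close> (\<open>reg_le_triangulated\<close>).
\<close>

section \<open>The Koszul boundary\<close>

text \<open>
  The injection \<open>idx\<close> orders the vertices and thereby fixes the signs. The parameter \<open>kk\<close> fixes
  the coefficient field for predicates in whose arguments the field does not occur.
\<close>

locale koszul =
  fixes X :: "'v set" and idx :: "'v \<Rightarrow> nat" and kk :: "'k::field itself"
  assumes finX: "finite X" and inj_idx: "inj_on idx X"
begin

definition ksgn :: "'v \<Rightarrow> 'v set \<Rightarrow> 'r::comm_ring_1" where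
  "ksgn x T = (-1) ^ card {y\<in>T. idx y < idx x}"

text \<open>
  Here \<open>f S\<close> is the coefficient of the basis element \<open>e\<^sub>S\<close> of the exterior algebra. With \<open>w x\<close> the variable
  \<open>x\<close> this is the Koszul differential, and with \<open>w x = 1\<close> its restriction to one multidegree.
\<close>

definition bdry :: "('v \<Rightarrow> 'r::comm_ring_1) \<Rightarrow> ('v set \<Rightarrow> 'r) \<Rightarrow> 'v set \<Rightarrow> 'r" where
  "bdry w f T = (if T \<subseteq> X then (\<Sum>x\<in>X - T. ksgn x T * w x * f (insert x T)) else 0)"

lemma ksgn_square [simp]: "ksgn x T * ksgn x T = (1 :: 'r::comm_ring_1)"
  by (simp add: ksgn_def flip: power_mult_distrib)

lemma ksgn_square_left [simp]: "ksgn x T * (ksgn x T * r) = (r :: 'r::comm_ring_1)"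
  by (simp flip: mult.assoc)

lemma ksgn_cases: "ksgn x T = (1::'r::comm_ring_1) \<or> ksgn x T = (-1::'r)"
  unfolding ksgn_def by (cases "even (card {y\<in>T. idx y < idx x})") auto

lemma ksgn_insert:
  assumes "finite T" "y \<notin> T"
  shows "ksgn x (insert y T) = (if idx y < idx x then - ksgn x T else (ksgn x T :: 'r::comm_ring_1))"
proof (cases "idx y < idx x")
  case True
  then have "{z \<in> insert y T. idx z < idx x} = insert y {z\<in>T. idx z < idx x}" by auto
  then show ?thesis using True assms by (simp add: ksgn_def)
next
  case False
  then have "{z \<in> insert y T. idx z < idx x} = {z\<in>T. idx z < idx x}" by auto
  then show ?thesis using False by (simp add: ksgn_def)
qed

lemma ksgn_swap:
  assumes "T \<subseteq> X" "x \<in> X - T" "y \<in> X - T" "x \<noteq> y"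
  shows "ksgn x T * ksgn y (insert x T) = - (ksgn y T * ksgn x (insert y T) :: 'r::comm_ring_1)"
proof -
  have "finite T" using assms(1) finX finite_subset by blast
  moreover have "idx x \<noteq> idx y" using assms inj_idx by (auto dest: inj_onD)
  ultimately show ?thesis using assms by (auto simp: ksgn_insert mult.commute)
qed

text \<open>
  Antisymmetry only shows that the sum equals its negative, which says nothing in characteristic 2. So
  the terms with \<open>x\<close> before \<open>y\<close> are paired with those in the other order.
\<close>

lemma antisym_sum_zero:
  fixes h :: "'v \<Rightarrow> 'v \<Rightarrow> 'r::comm_ring_1"
  assumes "A \<subseteq> X" "\<And>x y. \<lbrakk>x \<in> A; y \<in> A; x \<noteq> y\<rbrakk> \<Longrightarrow> h x y = - h y x"
  shows "(\<Sum>x\<in>A. \<Sum>y\<in>A - {x}. h x y) = 0"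
proof -
  have fA: "finite A" using assms(1) finX finite_subset by blast
  define P where "P = {(x,y). x \<in> A \<and> y \<in> A \<and> idx x < idx y}"
  define Q where "Q = {(x,y). x \<in> A \<and> y \<in> A \<and> idx y < idx x}"
  have fin: "finite P" "finite Q"
    by (rule finite_subset[of _ "A \<times> A"]; use fA in \<open>auto simp: P_def Q_def\<close>)+
  have U: "Sigma A (\<lambda>x. A - {x}) = P \<union> Q"
  proof -
    have "\<And>x y. x \<in> A \<Longrightarrow> y \<in> A \<Longrightarrow> x \<noteq> y \<Longrightarrow> idx x < idx y \<or> idx y < idx x"
      using assms(1) inj_idx by (metis inj_onD nat_neq_iff subsetD)
    then show ?thesis by (auto simp: P_def Q_def)
  qed
  have "(\<Sum>x\<in>A. \<Sum>y\<in>A - {x}. h x y) = (\<Sum>(x,y)\<in>Sigma A (\<lambda>x. A - {x}). h x y)"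
    using fA by (subst sum.Sigma) auto
  also have "\<dots> = (\<Sum>(x,y)\<in>P. h x y) + (\<Sum>(x,y)\<in>Q. h x y)"
    unfolding U using fin by (subst sum.union_disjoint) (auto simp: P_def Q_def)
  also have "(\<Sum>(x,y)\<in>Q. h x y) = (\<Sum>(x,y)\<in>P. h y x)"
    by (rule sum.reindex_bij_witness[where i="prod.swap" and j="prod.swap"]) (auto simp: P_def Q_def)
  also have "\<dots> = (\<Sum>(x,y)\<in>P. - h x y)"
  proof (rule sum.cong, simp)
    fix p assume "p \<in> P"
    then show "(case p of (x, y) \<Rightarrow> h y x) = (case p of (x, y) \<Rightarrow> - h x y)"
      using assms(2) by (fastforce simp: P_def)
  qed
  finally show ?thesis by (simp add: sum_negf case_prod_unfold)
qed

text \<open>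
  The two orders in which two given vertices can be removed contribute with opposite signs.
\<close>

lemma bdry_bdry: "bdry w (bdry w f) T = (0 :: 'r::comm_ring_1)"
proof (cases "T \<subseteq> X")
  case True
  have "bdry w (bdry w f) T = (\<Sum>x\<in>X - T. \<Sum>y\<in>(X - T) - {x}.
      ksgn x T * ksgn y (insert x T) * w x * w y * f (insert y (insert x T)))"
    using True by (auto simp: bdry_def sum_distrib_left mult_ac intro!: sum.cong)
  also have "\<dots> = 0"
  proof (rule antisym_sum_zero)
    fix x y assume "x \<in> X - T" "y \<in> X - T" "x \<noteq> y"
    from ksgn_swap[OF True this, where 'r='r]
    show "ksgn x T * ksgn y (insert x T) * w x * w y * f (insert y (insert x T))
      = - (ksgn y T * ksgn x (insert y T) * w y * w x * f (insert x (insert y T)))"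
      by (simp add: insert_commute mult_ac)
  qed auto
  finally show ?thesis .
qed (simp add: bdry_def)

lemma bdry_zero [simp]: "bdry w (\<lambda>_. 0) T = 0" by (simp add: bdry_def)

lemma bdry_add: "bdry w (\<lambda>S. f S + g S) T = bdry w f T + bdry w g T"
  by (simp add: bdry_def algebra_simps sum.distrib)

lemma bdry_diff: "bdry w (\<lambda>S. f S - g S) T = bdry w f T - bdry w g T"
  by (simp add: bdry_def algebra_simps sum_subtractf)

lemma bdry_cmult: "bdry w (\<lambda>S. c * f S) T = c * bdry w f T"
  by (simp add: bdry_def sum_distrib_left mult_ac)

lemma bdry_sum: "bdry w (\<lambda>S. \<Sum>b\<in>B. f b S) T = (\<Sum>b\<in>B. bdry w (f b) T)"
  by (induction B rule: infinite_finite_induct) (simp_all add: bdry_add)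

text \<open>
  The vanishing of the homology at \<open>p\<close> of the complex with basis \<open>e\<^sub>S\<close>, \<open>S \<in> D\<close>, in which every \<open>e\<^sub>S\<close>
  with \<open>S \<notin> D\<close> is set to 0.
\<close>

definition acyclic_in :: "nat \<Rightarrow> 'v set set \<Rightarrow> bool" where
  "acyclic_in p D \<longleftrightarrow> (\<forall>f :: 'v set \<Rightarrow> 'k.
     (\<forall>S. f S \<noteq> 0 \<longrightarrow> S \<in> D \<and> card S = p) \<longrightarrow> (\<forall>T\<in>D. bdry (\<lambda>_. 1) f T = 0) \<longrightarrow>
     (\<exists>g. (\<forall>S. g S \<noteq> 0 \<longrightarrow> S \<in> D \<and> card S = Suc p) \<and> (\<forall>S\<in>D. f S = bdry (\<lambda>_. 1) g S)))"

lemma acyclic_inD: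
  fixes f :: "'v set \<Rightarrow> 'k"
  assumes "acyclic_in p D" "\<And>S. f S \<noteq> 0 \<Longrightarrow> S \<in> D" "\<And>S. f S \<noteq> 0 \<Longrightarrow> card S = p"
    "\<And>T. T \<in> D \<Longrightarrow> bdry (\<lambda>_. 1) f T = 0"
  obtains g where "\<And>S. g S \<noteq> 0 \<Longrightarrow> S \<in> D" "\<And>S. g S \<noteq> 0 \<Longrightarrow> card S = Suc p"
    "\<And>S. S \<in> D \<Longrightarrow> f S = bdry (\<lambda>_. 1) g S"
  using assms unfolding acyclic_in_def by metis

text \<open>
  A full simplex is contractible: multiplication by \<open>e\<^sub>x\<close> for a fixed vertex \<open>x\<close> is a contracting
  homotopy.
\<close>

lemma acyclic_in_Pow:
  assumes "Y \<subseteq> X" "Y \<noteq> {} \<or> p \<noteq> 0"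
  shows "acyclic_in p (Pow Y)"
  unfolding acyclic_in_def
proof (intro allI impI)
  fix f :: "'v set \<Rightarrow> 'k"
  assume f: "\<forall>S. f S \<noteq> 0 \<longrightarrow> S \<in> Pow Y \<and> card S = p" and cyc: "\<forall>T\<in>Pow Y. bdry (\<lambda>_. 1) f T = 0"
  show "\<exists>g. (\<forall>S. g S \<noteq> 0 \<longrightarrow> S \<in> Pow Y \<and> card S = Suc p) \<and> (\<forall>S\<in>Pow Y. f S = bdry (\<lambda>_. 1) g S)"
  proof (cases "Y = {}")
    case True
    then have "\<forall>S. f S = 0" using f assms(2) by force
    then show ?thesis by (intro exI[of _ "\<lambda>_. 0"]) simp
  next
    case False
    then obtain x where x: "x \<in> Y" by blast
    define g where "g S = (if x \<in> S then ksgn x (S - {x}) * f (S - {x}) else 0)" for S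
    have finY: "finite Y" using assms(1) finX finite_subset by blast
    have "f T = bdry (\<lambda>_. 1) g T" if T: "T \<subseteq> Y" for T
    proof (cases "x \<in> T")
      case False
      have "bdry (\<lambda>_. 1) g T = (\<Sum>y\<in>X - T. ksgn y T * g (insert y T))"
        using T assms(1) by (simp add: bdry_def)
      also have "\<dots> = (\<Sum>y\<in>{x}. ksgn y T * g (insert y T))"
        using False x assms(1) finX by (intro sum.mono_neutral_right) (auto simp: g_def)
      finally show ?thesis using False by (simp add: g_def)
    next
      case True
      define T' where "T' = T - {x}"
      have T': "T = insert x T'" "x \<notin> T'" "T' \<subseteq> X" "T' \<subseteq> Y" using True T assms(1) by (auto simp: T'_def)
      have "0 = bdry (\<lambda>_. 1) f T'" using cyc T' by auto
      also have "\<dots> = (\<Sum>y\<in>X - T'. ksgn y T' * f (insert y T'))" using T' by (simp add: bdry_def)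
      also have "\<dots> = ksgn x T' * f T + (\<Sum>y\<in>X - T. ksgn y T' * f (insert y T'))"
      proof -
        have "X - T' = insert x (X - T)" using T' x assms(1) by auto
        moreover have "(\<Sum>y\<in>insert x (X - T). ksgn y T' * f (insert y T'))
            = ksgn x T' * f (insert x T') + (\<Sum>y\<in>X - T. ksgn y T' * f (insert y T'))"
          using finX True by (subst sum.insert) auto
        ultimately show ?thesis using T'(1) by metis
      qed
      finally have "ksgn x T' * f T = - (\<Sum>y\<in>X - T. ksgn y T' * f (insert y T'))"
        by (metis eq_neg_iff_add_eq_0)
      then have "ksgn x T' * (ksgn x T' * f T) = ksgn x T' * - (\<Sum>y\<in>X - T. ksgn y T' * f (insert y T'))"
        by simp
      then have fT: "f T = (\<Sum>y\<in>X - T. - (ksgn x T' * ksgn y T') * f (insert y T'))"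
        by (simp add: sum_distrib_left mult.assoc sum_negf)
      have "bdry (\<lambda>_. 1) g T = (\<Sum>y\<in>X - T. ksgn y T * g (insert y T))"
        using T assms(1) by (auto simp: bdry_def)
      also have "\<dots> = (\<Sum>y\<in>X - T. - (ksgn x T' * ksgn y T') * f (insert y T'))"
      proof (rule sum.cong, simp)
        fix y assume y: "y \<in> X - T"
        have *: "insert y T - {x} = insert y T'" using y T' by auto
        have xX: "x \<in> X - T'" "y \<in> X - T'" "x \<noteq> y" using x y T' assms(1) by auto
        have "ksgn x T' * ksgn y T = - (ksgn y T' * ksgn x (insert y T') :: 'k)"
          using ksgn_swap[OF T'(3) xX] T' by simp
        then have "ksgn x T' * (ksgn x T' * ksgn y T) * ksgn x (insert y T')
            = ksgn x T' * - (ksgn y T' * ksgn x (insert y T')) * (ksgn x (insert y T') :: 'k)"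
          by simp
        then have "ksgn y T * ksgn x (insert y T') = - (ksgn x T' * ksgn y T' :: 'k)"
          by (simp add: mult.assoc)
        then show "ksgn y T * g (insert y T) = - (ksgn x T' * ksgn y T') * f (insert y T')"
          unfolding g_def * using T' by (simp add: mult.assoc[symmetric])
      qed
      finally show ?thesis using fT by simp
    qed
    moreover have "S \<in> Pow Y \<and> card S = Suc p" if "g S \<noteq> 0" for S
    proof -
      have "x \<in> S" "f (S - {x}) \<noteq> 0" using that by (auto simp: g_def split: if_splits)
      then have *: "S - {x} \<subseteq> Y" "card (S - {x}) = p" "x \<in> S" using f by auto
      then have "S \<subseteq> Y" using x by blast
      moreover from this have "finite S" using finY finite_subset by blast
      ultimately show ?thesis using * by (metis PowI card_Suc_Diff1)
    qed
    ultimately show ?thesis by (intro exI[of _ g]) auto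
  qed
qed

lemma bdry_neq_zeroE:
  assumes "bdry w f T \<noteq> 0"
  obtains x where "T \<subseteq> X" "x \<in> X - T" "f (insert x T) \<noteq> 0"
proof -
  have T: "T \<subseteq> X" using assms by (auto simp: bdry_def split: if_splits)
  moreover have "\<exists>x\<in>X - T. f (insert x T) \<noteq> 0"
  proof (rule ccontr)
    assume "\<not> ?thesis"
    then have "bdry w f T = 0" unfolding bdry_def by (auto intro!: sum.neutral)
    with assms show False by simp
  qed
  ultimately show ?thesis using that by blast
qed

text \<open>
  This is the exactness at the middle term of \<open>H\<^sub>p(D1 \<union> D2) \<rightarrow> H\<^sub>p(D1) \<rightarrow> H\<^sub>p\<^sub>-\<^sub>1(D2)\<close>. The hypotheses say
  that the union is convex and that \<open>D2\<close> is closed downwards in it, so that \<open>D1\<close> spans a quotient of the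
  complex of the union.
\<close>

lemma acyclic_in_quotient:
  assumes disj: "D1 \<inter> D2 = {}"
    and conv: "\<And>T x S. \<lbrakk>T \<in> D1 \<union> D2; S \<in> D1 \<union> D2; T \<subseteq> S; x \<in> S\<rbrakk> \<Longrightarrow> insert x T \<in> D1 \<union> D2"
    and up: "\<And>T x. \<lbrakk>T \<in> D1; insert x T \<in> D1 \<union> D2\<rbrakk> \<Longrightarrow> insert x T \<in> D1"
    and ac: "acyclic_in p (D1 \<union> D2)" "p > 0 \<Longrightarrow> acyclic_in (p - 1) D2" and sub: "D2 \<subseteq> Pow X"
  shows "acyclic_in p D1"
  unfolding acyclic_in_def
proof (intro allI impI)
  fix f :: "'v set \<Rightarrow> 'k"
  let ?bdry = "bdry (\<lambda>_. 1 :: 'k)"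
  assume f: "\<forall>S. f S \<noteq> 0 \<longrightarrow> S \<in> D1 \<and> card S = p" and cyc: "\<forall>T\<in>D1. ?bdry f T = 0"
  \<comment> \<open>The connecting homomorphism: the boundary of \<open>f\<close> in the complex of \<open>D1 \<union> D2\<close> lives on \<open>D2\<close>.\<close>
  define w where "w T = (if T \<in> D2 then ?bdry f T else 0)" for T
  have bdcard: "Suc (card T) = p" if "?bdry f T \<noteq> 0" for T
    using that
  proof (rule bdry_neq_zeroE)
    fix x assume "T \<subseteq> X" "x \<in> X - T" "f (insert x T) \<noteq> 0"
    moreover have "finite T" using \<open>T \<subseteq> X\<close> finX finite_subset by blast
    ultimately show ?thesis using f by (metis DiffD2 card_insert_disjoint)
  qed
  have "\<exists>g. (\<forall>S. g S \<noteq> 0 \<longrightarrow> S \<in> D2 \<and> card S = p) \<and> (\<forall>S\<in>D2. w S = ?bdry g S)"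
  proof (cases "p = 0")
    case True
    then have "w S = 0" for S using bdcard[of S] by (auto simp: w_def)
    then show ?thesis by (intro exI[of _ "\<lambda>_. 0"]) simp
  next
    case False
    have "?bdry w T = 0" if T: "T \<in> D2" for T
    proof -
      have "?bdry w T = ?bdry (?bdry f) T"
      proof -
        have "w (insert x T) = ?bdry f (insert x T)" for x
        proof (cases "insert x T \<in> D2 \<or> ?bdry f (insert x T) = 0")
          case True then show ?thesis by (auto simp: w_def)
        next
          case False
          then obtain y where "f (insert y (insert x T)) \<noteq> 0" by (meson bdry_neq_zeroE)
          then have "insert y (insert x T) \<in> D1" using f by blast
          then have "insert x T \<in> D1 \<union> D2" using conv[of T "insert y (insert x T)" x] T by auto
          then show ?thesis using False cyc by blast
        qed
        then show ?thesis by (simp add: bdry_def)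
      qed
      then show ?thesis by (simp add: bdry_bdry)
    qed
    moreover have "card S = p - 1" if "w S \<noteq> 0" for S
      using that bdcard[of S] by (auto simp: w_def split: if_splits)
    ultimately obtain g where "\<And>S. g S \<noteq> 0 \<Longrightarrow> S \<in> D2" "\<And>S. g S \<noteq> 0 \<Longrightarrow> card S = Suc (p - 1)"
      "\<And>S. S \<in> D2 \<Longrightarrow> w S = ?bdry g S"
      using acyclic_inD[OF ac(2), of w] False by (metis gr0I w_def)
    then show ?thesis using False by (intro exI[of _ g]) auto
  qed
  then obtain g where g: "\<And>S. g S \<noteq> 0 \<Longrightarrow> S \<in> D2 \<and> card S = p" "\<And>S. S \<in> D2 \<Longrightarrow> w S = ?bdry g S"
    by blast
  have D1g: "?bdry g T = 0" if "T \<in> D1" for T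
  proof (rule ccontr)
    assume "?bdry g T \<noteq> 0"
    then obtain x where "g (insert x T) \<noteq> 0" by (meson bdry_neq_zeroE)
    then have "insert x T \<in> D2" using g by blast
    then show False using up[of T x] that disj by blast
  qed
  define u where "u S = f S - g S" for S
  have "u S \<noteq> 0 \<Longrightarrow> S \<in> D1 \<union> D2" "u S \<noteq> 0 \<Longrightarrow> card S = p" for S
    using f g by (auto simp: u_def) (metis diff_0_right diff_self)+
  moreover have "?bdry u T = 0" if "T \<in> D1 \<union> D2" for T
    using that D1g cyc g(2) disj by (auto simp: u_def[abs_def] bdry_diff w_def)
  ultimately obtain h where h: "\<And>S. h S \<noteq> 0 \<Longrightarrow> S \<in> D1 \<union> D2" "\<And>S. h S \<noteq> 0 \<Longrightarrow> card S = Suc p"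
    "\<And>S. S \<in> D1 \<union> D2 \<Longrightarrow> u S = ?bdry h S"
    using acyclic_inD[OF ac(1), of u] by metis
  define h1 where "h1 S = (if S \<in> D1 then h S else 0)" for S
  have "f S = ?bdry h1 S" if S: "S \<in> D1" for S
  proof -
    have "g S = 0" using g S disj by blast
    then have "f S = ?bdry h S" using h(3)[of S] S by (simp add: u_def)
    also have "\<dots> = ?bdry h1 S"
    proof -
      have "h (insert x S) = h1 (insert x S)" for x
        using h(1)[of "insert x S"] up[OF S, of x] by (auto simp: h1_def)
      then show ?thesis by (simp add: bdry_def)
    qed
    finally show ?thesis .
  qed
  moreover have "S \<in> D1 \<and> card S = Suc p" if "h1 S \<noteq> 0" for S
    using that h(2) by (auto simp: h1_def split: if_splits)
  ultimately show "\<exists>g. (\<forall>S. g S \<noteq> 0 \<longrightarrow> S \<in> D1 \<and> card S = Suc p) \<and> (\<forall>S\<in>D1. f S = ?bdry g S)"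
    by blast
qed

end

section \<open>Monomial ideals and the exchange property\<close>

text \<open>
  A monomial ideal is represented by the set of exponent vectors of its monomials; \<open>multiples M\<close> belongs to the
  ideal generated by \<open>M\<close>, and \<open>colon U m\<close> to the colon ideal by the monomial \<open>m\<close>.
\<close>

definition upset :: "('v \<Rightarrow> nat) set \<Rightarrow> bool" where
  "upset U \<longleftrightarrow> (\<forall>t\<in>U. \<forall>u. t \<le> u \<longrightarrow> u \<in> U)"

definition multiples :: "('v \<Rightarrow> nat) set \<Rightarrow> ('v \<Rightarrow> nat) set" where
  "multiples M = {u. \<exists>t\<in>M. t \<le> u}"

definition colon :: "('v \<Rightarrow> nat) set \<Rightarrow> ('v \<Rightarrow> nat) \<Rightarrow> ('v \<Rightarrow> nat) set" where
  "colon U m = {t. t + m \<in> U}"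

abbreviation sqfree :: "'v set \<Rightarrow> 'v \<Rightarrow> nat" where
  "sqfree S \<equiv> (\<lambda>x. of_bool (x \<in> S))"

lemma upset_multiples [simp]: "upset (multiples M)"
  unfolding upset_def multiples_def by (auto intro: order_trans)

lemma multiples_empty [simp]: "multiples {} = {}" by (simp add: multiples_def)

lemma multiples_Un: "multiples (M \<union> N) = multiples M \<union> multiples N" by (auto simp: multiples_def)

lemma colon_multiples: "colon (multiples M) m = multiples ((\<lambda>t x. t x - m x) ` M)"
  by (auto simp: colon_def multiples_def le_fun_def le_diff_conv)

definition exchange :: "'v set set \<Rightarrow> bool" where
  "exchange EE \<longleftrightarrow> (\<forall>E\<in>EE. \<forall>F\<in>EE. E \<noteq> F \<longrightarrow> E \<inter> F \<noteq> {} \<longrightarrow>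
     (\<exists>e\<in>E - F. \<exists>f\<in>F - E. insert f (E - {e}) \<in> EE))"

text \<open>
  In a properly-connected \<open>d\<close>-uniform hypergraph this is \<open>(d + 1)\<close>-disjointness of distinct edges. Unlike the
  distance, it mentions only edges inside \<open>E \<union> F\<close>, and hence passes to induced subhypergraphs.
\<close>

definition far :: "'v set set \<Rightarrow> 'v set \<Rightarrow> 'v set \<Rightarrow> bool" where
  "far EE E F \<longleftrightarrow> E \<inter> F = {} \<and> (\<forall>e\<in>E. \<forall>f\<in>F. insert f (E - {e}) \<notin> EE)"

text \<open>
  If exchanging a vertex of \<open>F\<close> gives an edge \<open>M\<close>, then \<open>M\<close> meets both \<open>E\<close> and \<open>F\<close>, and the exchange
  property for \<open>E\<close> and \<open>M\<close> yields an edge that differs from \<open>E\<close> by one vertex of \<open>F\<close>.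
\<close>

lemma far_sym:
  assumes ex: "exchange EE" and E: "E \<in> EE" and F: "F \<in> EE" "card F \<ge> 2" and far: "far EE E F"
  shows "far EE F E"
  unfolding far_def
proof (intro conjI ballI notI)
  show "F \<inter> E = {}" using far by (auto simp: far_def)
next
  fix f e assume fe: "f \<in> F" "e \<in> E" and M: "insert e (F - {f}) \<in> EE"
  have "\<not> F \<subseteq> {f}"
  proof
    assume "F \<subseteq> {f}"
    then have "card F \<le> card {f}" by (rule card_mono[rotated]) simp
    then show False using F(2) by simp
  qed
  then obtain f1 where f1: "f1 \<in> F" "f1 \<noteq> f" by blast
  have "f1 \<notin> E" using f1 far by (auto simp: far_def)
  then have "E \<noteq> insert e (F - {f})" "E \<inter> insert e (F - {f}) \<noteq> {}" using f1 fe by auto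
  from ex[unfolded exchange_def, rule_format, OF E M this]
  obtain e' f' where "e' \<in> E" "f' \<in> insert e (F - {f}) - E" "insert f' (E - {e'}) \<in> EE"
    by (meson Diff_iff)
  then show False using far fe unfolding far_def by blast
qed

context koszul
begin

text \<open>
  The part of the Koszul complex of \<open>R/I\<close> in multidegree \<open>\<alpha>\<close> has the basis \<open>x\<^sup>\<alpha>\<^sup>-\<^sup>S e\<^sub>S\<close>, where \<open>S\<close> runs
  through this family.
\<close>

definition koszul_basis :: "('v \<Rightarrow> nat) \<Rightarrow> ('v \<Rightarrow> nat) set \<Rightarrow> 'v set set" where
  "koszul_basis \<alpha> U = {S. S \<subseteq> X \<and> (\<forall>x\<in>S. \<alpha> x > 0) \<and> (\<lambda>x. \<alpha> x - sqfree S x) \<notin> U}"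

text \<open>
  The vanishing of \<open>H\<^sub>p(R/I)\<close> in all multidegrees of total degree above \<open>B + p\<close>, that is
  \<open>reg R/I \<le> B\<close>.
\<close>

definition reg_le :: "('v \<Rightarrow> nat) set \<Rightarrow> nat \<Rightarrow> bool" where
  "reg_le U B \<longleftrightarrow> (\<forall>\<alpha> p. (\<forall>x. x \<notin> X \<longrightarrow> \<alpha> x = 0) \<longrightarrow> sum \<alpha> X > B + p \<longrightarrow> acyclic_in p (koszul_basis \<alpha> U))"

lemma acyclic_in_empty: "acyclic_in p {}"
  unfolding acyclic_in_def by (auto intro: exI[of _ "\<lambda>_. 0"])

lemma reg_le_mono: "reg_le U B \<Longrightarrow> B \<le> B' \<Longrightarrow> reg_le U B'"
  by (auto simp: reg_le_def)

lemma koszul_basis_empty: "koszul_basis \<alpha> {} = Pow {x\<in>X. \<alpha> x > 0}"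
  by (auto simp: koszul_basis_def)

lemma reg_le_empty: "reg_le {} B"
  unfolding reg_le_def koszul_basis_empty
proof (intro allI impI acyclic_in_Pow)
  fix \<alpha> :: "'v \<Rightarrow> nat" and p assume "B + p < sum \<alpha> X"
  then have "sum \<alpha> X \<noteq> 0" by simp
  then have "\<exists>x\<in>X. \<alpha> x \<noteq> 0" using finX by (simp)
  then show "{x \<in> X. 0 < \<alpha> x} \<noteq> {} \<or> p \<noteq> 0" by auto
qed auto

lemma koszul_basis_up:
  assumes "upset U" "T \<in> koszul_basis \<alpha> U" "T \<subseteq> S" "S \<subseteq> X" "\<forall>x\<in>S. \<alpha> x > 0"
  shows "S \<in> koszul_basis \<alpha> U"
proof -
  have "(\<lambda>x. \<alpha> x - sqfree S x) \<le> (\<lambda>x. \<alpha> x - sqfree T x)"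
    using assms(3) by (auto simp: le_fun_def)
  then have "(\<lambda>x. \<alpha> x - sqfree S x) \<notin> U"
    using assms(1,2) unfolding koszul_basis_def upset_def by blast
  then show ?thesis using assms(4,5) by (simp add: koszul_basis_def)
qed

text \<open>
  In multidegree \<open>\<alpha>\<close>, the family for \<open>J\<close> is the disjoint union of that for \<open>J + (m)\<close> and that for
  \<open>J : m\<close> in multidegree \<open>\<alpha> - m\<close>. This is the exact sequence
  \<open>0 \<rightarrow> R/(J : m)(-deg m) \<rightarrow> R/J \<rightarrow> R/(J + (m)) \<rightarrow> 0\<close>.
\<close>

lemma reg_le_add_monomial:
  assumes up: "upset J" and J: "reg_le J B" and C: "reg_le (colon J m) B'"
    and m: "\<And>x. x \<notin> X \<Longrightarrow> m x = 0" and B: "B' + sum m X \<le> Suc B"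
  shows "reg_le (J \<union> multiples {m}) B"
  unfolding reg_le_def
proof (intro allI impI)
  fix \<alpha> :: "'v \<Rightarrow> nat" and p assume \<alpha>: "\<forall>x. x \<notin> X \<longrightarrow> \<alpha> x = 0" and deg: "B + p < sum \<alpha> X"
  \<comment> \<open>The family of \<open>J : m\<close> in multidegree \<open>\<alpha> - m\<close>, which is empty if \<open>m\<close> does not divide \<open>x\<^sup>\<alpha>\<close>.\<close>
  define D2 where "D2 = (if m \<le> \<alpha> then koszul_basis (\<alpha> - m) (colon J m) else {})"
  have eq: "S \<in> D2 \<longleftrightarrow> S \<in> koszul_basis \<alpha> J \<and> m \<le> (\<lambda>x. \<alpha> x - sqfree S x)" for S
  proof
    assume S: "S \<in> D2"
    then have ma: "m \<le> \<alpha>" and S: "S \<subseteq> X" "\<forall>x\<in>S. \<alpha> x > m x"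
      and nJ: "(\<lambda>x. (\<alpha> - m) x - sqfree S x) + m \<notin> J"
      by (auto simp: D2_def koszul_basis_def colon_def split: if_splits)
    have "(\<lambda>x. (\<alpha> - m) x - sqfree S x) + m = (\<lambda>x. \<alpha> x - sqfree S x)"
    proof
      fix x show "((\<lambda>x. (\<alpha> - m) x - sqfree S x) + m) x = \<alpha> x - sqfree S x"
        using S(2) ma[unfolded le_fun_def, rule_format, of x] by (cases "x \<in> S") auto
    qed
    moreover have "m x \<le> \<alpha> x - sqfree S x" for x
      using S(2) ma[unfolded le_fun_def, rule_format, of x] by (cases "x \<in> S") auto
    ultimately show "S \<in> koszul_basis \<alpha> J \<and> m \<le> (\<lambda>x. \<alpha> x - sqfree S x)"
      using S nJ by (auto simp: koszul_basis_def le_fun_def)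
  next
    assume S: "S \<in> koszul_basis \<alpha> J \<and> m \<le> (\<lambda>x. \<alpha> x - sqfree S x)"
    then have le: "m x \<le> \<alpha> x - sqfree S x" for x by (auto simp: le_fun_def)
    have ma: "m \<le> \<alpha>" unfolding le_fun_def using le diff_le_self order_trans by blast
    have pos: "\<alpha> x > m x" if "x \<in> S" for x
      using S le[of x] that by (auto simp: koszul_basis_def)
    have "(\<lambda>x. (\<alpha> - m) x - sqfree S x) + m = (\<lambda>x. \<alpha> x - sqfree S x)"
    proof
      fix x show "((\<lambda>x. (\<alpha> - m) x - sqfree S x) + m) x = \<alpha> x - sqfree S x"
        using pos[of x] ma[unfolded le_fun_def, rule_format, of x] by (cases "x \<in> S") auto
    qed
    then show "S \<in> D2" using S ma pos by (auto simp: D2_def koszul_basis_def colon_def)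
  qed
  have D1: "S \<in> koszul_basis \<alpha> (J \<union> multiples {m}) \<longleftrightarrow> S \<in> koszul_basis \<alpha> J \<and> \<not> m \<le> (\<lambda>x. \<alpha> x - sqfree S x)" for S
    by (auto simp: koszul_basis_def multiples_def)
  have un: "koszul_basis \<alpha> (J \<union> multiples {m}) \<union> D2 = koszul_basis \<alpha> J" using eq D1 by blast
  show "acyclic_in p (koszul_basis \<alpha> (J \<union> multiples {m}))"
  proof (rule acyclic_in_quotient)
    show "koszul_basis \<alpha> (J \<union> multiples {m}) \<inter> D2 = {}" using eq D1 by blast
    show "insert x T \<in> koszul_basis \<alpha> (J \<union> multiples {m}) \<union> D2"
      if "T \<in> koszul_basis \<alpha> (J \<union> multiples {m}) \<union> D2" "S \<in> koszul_basis \<alpha> (J \<union> multiples {m}) \<union> D2" "T \<subseteq> S" "x \<in> S" for T x S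
    proof -
      have TS: "T \<in> koszul_basis \<alpha> J" "S \<in> koszul_basis \<alpha> J" using that(1,2) unfolding un by blast+
      then have "insert x T \<subseteq> X" "\<forall>y\<in>insert x T. \<alpha> y > 0"
        using that(3,4) by (auto simp: koszul_basis_def)
      then show ?thesis unfolding un using koszul_basis_up[OF up TS(1)] by blast
    qed
    show "insert x T \<in> koszul_basis \<alpha> (J \<union> multiples {m})"
      if "T \<in> koszul_basis \<alpha> (J \<union> multiples {m})" "insert x T \<in> koszul_basis \<alpha> (J \<union> multiples {m}) \<union> D2" for T x
    proof -
      have "upset (J \<union> multiples {m})" using up upset_multiples[of "{m}"] unfolding upset_def by blast
      moreover have "insert x T \<subseteq> X" "\<forall>y\<in>insert x T. \<alpha> y > 0"
        using that(2) unfolding un by (auto simp: koszul_basis_def)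
      ultimately show ?thesis using koszul_basis_up[OF _ that(1)] by blast
    qed
    show "acyclic_in p (koszul_basis \<alpha> (J \<union> multiples {m}) \<union> D2)"
      unfolding un using J \<alpha> deg by (auto simp: reg_le_def)
    show "acyclic_in (p - 1) D2" if "p > 0"
    proof (cases "m \<le> \<alpha>")
      case True
      then have "sum (\<alpha> - m) X = sum \<alpha> X - sum m X"
        by (simp add: sum_subtractf_nat le_fun_def)
      then have "sum (\<alpha> - m) X > B' + (p - 1)" using deg B that by linarith
      then show ?thesis using True C \<alpha> by (auto simp: reg_le_def D2_def)
    qed (simp add: D2_def acyclic_in_empty)
    show "D2 \<subseteq> Pow X" by (auto simp: D2_def koszul_basis_def)
  qed
qed

text \<open>
  Some bound is needed for every edge ideal, triangulated or not, to get finite resolutions. A colon ideal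
  has no more generators than the ideal itself, so induction on their number works.
\<close>

lemma reg_le_finitely_generated:
  assumes "finite M" "\<And>t x. t \<in> M \<Longrightarrow> x \<notin> X \<Longrightarrow> t x = 0"
  shows "\<exists>B. reg_le (multiples M) B"
proof -
  have "\<exists>B. reg_le (multiples M) B" if "finite M" "card M \<le> n" "\<And>t x. t \<in> M \<Longrightarrow> x \<notin> X \<Longrightarrow> t x = 0" for n M
    using that
  proof (induction n arbitrary: M)
    case 0
    then show ?case using reg_le_empty by auto
  next
    case (Suc n)
    show ?case
    proof (cases "M = {}")
      case True then show ?thesis using reg_le_empty by auto
    next
      case False
      then obtain m where m: "m \<in> M" by blast
      define N where "N = M - {m}"
      have MN: "M = N \<union> {m}" and N: "finite N" "card N \<le> n" using m Suc.prems by (auto simp: N_def)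
      obtain B1 where B1: "reg_le (multiples N) B1" using Suc.IH[of N] N Suc.prems(3) by (auto simp: N_def)
      have "card ((\<lambda>t x. t x - m x) ` N) \<le> n" using N card_image_le le_trans by blast
      then obtain B2 where B2: "reg_le (multiples ((\<lambda>t x. t x - m x) ` N)) B2"
        using Suc.IH[of "(\<lambda>t x. t x - m x) ` N"] N Suc.prems(3) unfolding N_def by fastforce
      have "reg_le (multiples M) (B1 + B2 + sum m X)"
        unfolding MN multiples_Un
        by (rule reg_le_add_monomial[OF _ reg_le_mono[OF B1] B2[folded colon_multiples]])
          (use Suc.prems m in auto)
      then show ?thesis by blast
    qed
  qed
  then show ?thesis using assms by blast
qed

text \<open>
  If the generators of \<open>J\<close> avoid the variable \<open>z\<close>, then \<open>J : z = J\<close>.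
\<close>

lemma reg_le_add_variables:
  assumes "finite W" "W \<subseteq> X" "reg_le (multiples M) B" "\<And>t x. t \<in> M \<Longrightarrow> x \<in> W \<Longrightarrow> t x = 0"
  shows "reg_le (multiples (M \<union> (\<lambda>z. sqfree {z}) ` W)) B"
  using assms
proof (induction W rule: finite_induct)
  case (insert z W)
  define N where "N = M \<union> (\<lambda>z. sqfree {z}) ` W"
  have N: "reg_le (multiples N) B" using insert by (auto simp: N_def)
  have z0: "t z = 0" if "t \<in> N" for t
    using that insert by (auto simp: N_def)
  have "(\<lambda>x. t x - sqfree {z} x) = t" if "t \<in> N" for t
    using z0[OF that] by fastforce
  then have "(\<lambda>t x. t x - sqfree {z} x) ` N = (\<lambda>t. t) ` N" by (intro image_cong) auto
  then have c: "colon (multiples N) (sqfree {z}) = multiples N" unfolding colon_multiples by simp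
  have "reg_le (multiples (N \<union> {sqfree {z}})) B"
    unfolding multiples_Un
  proof (rule reg_le_add_monomial[OF upset_multiples N])
    show "reg_le (colon (multiples N) (sqfree {z})) B" unfolding c by (rule N)
  qed (use insert finX in auto)
  then show ?case by (simp add: N_def Un_insert_right)
qed simp

section \<open>The upper bound for triangulated hypergraphs\<close>

lemma sum_sqfree: "S \<subseteq> X \<Longrightarrow> sum (sqfree S) X = card S"
  using finX by (simp add: Int_absorb1 flip: sum.inter_restrict)

definition nbr :: "'v set set \<Rightarrow> 'v set \<Rightarrow> 'v \<Rightarrow> 'v set" where
  "nbr EE Y x = {y\<in>Y. y \<noteq> x \<and> (\<exists>E\<in>EE. E \<subseteq> Y \<and> x \<in> E \<and> y \<in> E)}"

lemma colon_squarefree: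
  "t \<in> colon (multiples (sqfree ` GG)) (sqfree E) \<longleftrightarrow> (\<exists>G\<in>GG. \<forall>x\<in>G - E. t x > 0)"
proof -
  have "sqfree G \<le> t + sqfree E \<longleftrightarrow> (\<forall>x\<in>G - E. t x > 0)" for G
    by (auto simp: le_fun_def of_bool_def Suc_le_eq split: if_splits)
  then show ?thesis by (auto simp: colon_def multiples_def)
qed

text \<open>
  Strong induction on \<open>Y\<close>, along the edges through a vertex \<open>x\<close> with complete neighbourhood. For an edge
  \<open>E\<close> through \<open>x\<close>, the set \<open>W\<close> of variables in the colon ideal contains every vertex \<open>f\<close> that can be
  exchanged into \<open>E\<close>: if the exchange keeps \<open>x\<close>, then \<open>f\<close> is a neighbour of \<open>x\<close> and by completeness
  it can also be exchanged for \<open>x\<close>. Hence only edges \<open>far\<close> from \<open>E\<close> contribute generators beyond \<open>W\<close>.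
\<close>

lemma reg_le_triangulated:
  assumes EE: "\<And>E. E \<in> EE \<Longrightarrow> E \<subseteq> X \<and> card E = Suc d" and d: "d \<ge> 1"
    and ex: "exchange EE"
    and tri: "\<And>Y. \<lbrakk>Y \<subseteq> X; Y \<noteq> {}\<rbrakk> \<Longrightarrow>
      \<exists>x\<in>Y. \<forall>G. G \<subseteq> insert x (nbr EE Y x) \<longrightarrow> card G = Suc d \<longrightarrow> G \<in> EE"
    and Y: "Y \<subseteq> X"
    and c: "\<And>S. \<lbrakk>S \<subseteq> {E\<in>EE. E \<subseteq> Y}; pairwise (far EE) S\<rbrakk> \<Longrightarrow> card S \<le> c"
  shows "reg_le (multiples (sqfree ` {E\<in>EE. E \<subseteq> Y})) (d * c)"
proof -
  have "finite Y" using Y finX finite_subset by blast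
  then show ?thesis using Y c
  proof (induction Y arbitrary: c rule: finite_psubset_induct)
    case (psubset Y)
    define EY where "EY = (\<lambda>Y. {E\<in>EE. E \<subseteq> Y})"
    show ?case
    proof (cases "Y = {}")
      case True
      have "{E\<in>EE. E \<subseteq> Y} = {}" using EE True d by fastforce
      then show ?thesis by (simp only: image_empty multiples_empty reg_le_empty)
    next
      case False
      then obtain x where x: "x \<in> Y"
        and compl: "\<And>G. G \<subseteq> insert x (nbr EE Y x) \<Longrightarrow> card G = Suc d \<Longrightarrow> G \<in> EE"
        using tri[of Y] psubset.prems by blast
      define Y1 where "Y1 = Y - {x}"
      have "Y1 \<subset> Y" using x by (auto simp: Y1_def)
      have fin_EE: "finite EE" by (rule finite_subset[of _ "Pow X"]) (use EE finX in auto)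
      have main: "reg_le (multiples (sqfree ` (EY Y1 \<union> A))) (d * c)" if "A \<subseteq> {E\<in>EY Y. x \<in> E}" for A
      proof -
        have "finite A" using that fin_EE by (auto simp: EY_def intro: finite_subset)
        then show ?thesis using that
        proof (induction A rule: finite_induct)
          case empty
          have "Y1 \<subseteq> X" and sub: "{E\<in>EE. E \<subseteq> Y1} \<subseteq> {E\<in>EE. E \<subseteq> Y}"
            using psubset.prems(1) \<open>Y1 \<subset> Y\<close> by auto
          have "reg_le (multiples (sqfree ` {E\<in>EE. E \<subseteq> Y1})) (d * c)"
          proof (rule psubset.IH[OF \<open>Y1 \<subset> Y\<close> \<open>Y1 \<subseteq> X\<close>])
            fix S assume "S \<subseteq> {E\<in>EE. E \<subseteq> Y1}" "pairwise (far EE) S"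
            then show "card S \<le> c" using psubset.prems(2)[of S] sub by blast
          qed
          then show ?case by (simp add: EY_def)
        next
          case (insert E A)
          define GG where "GG = EY Y1 \<union> A"
          have E: "E \<in> EE" "E \<subseteq> Y" "x \<in> E" using insert.prems by (auto simp: EY_def)
          have finE: "card E = Suc d" "E \<subseteq> X" using EE[OF E(1)] by auto
          then have "finite E" using finX finite_subset by blast
          note finE = \<open>finite E\<close> finE
          have E_notin: "E \<notin> GG" using insert.hyps E by (auto simp: GG_def EY_def Y1_def)
          \<comment> \<open>The variables that lie in the colon ideal.\<close>
          define W where "W = {z\<in>Y - E. \<exists>G\<in>GG. G - E \<subseteq> {z}}"
          \<comment> \<open>The edges inside \<open>Y2\<close> are the remaining generators of the colon ideal.\<close>
          define Y2 where "Y2 = Y - E - W"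
          have "Y2 \<subset> Y" using E by (auto simp: Y2_def)
          have inW: "f \<in> W" if f: "f \<in> Y - E" and e: "e \<in> E" and M: "insert f (E - {e}) \<in> EE" for e f
          proof -
            have "\<exists>G\<in>EY Y1. G - E \<subseteq> {f}"
            proof (cases "e = x")
              case True
              then have "insert f (E - {e}) \<in> EY Y1" using M f E by (auto simp: EY_def Y1_def)
              moreover have "insert f (E - {e}) - E \<subseteq> {f}" by auto
              ultimately show ?thesis by (rule bexI[rotated])
            next
              case False
              let ?G = "insert f (E - {x})"
              have "f \<noteq> x" "insert f (E - {e}) \<subseteq> Y" "x \<in> insert f (E - {e})" using f False E by auto
              with M f have "f \<in> nbr EE Y x" unfolding nbr_def by blast
              moreover have "E - {x} \<subseteq> nbr EE Y x" using E unfolding nbr_def by blast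
              moreover have "card ?G = Suc d" using f finE E by auto
              ultimately have "?G \<in> EE" by (intro compl) auto
              moreover have "?G \<subseteq> Y1" using f E by (auto simp: Y1_def)
              ultimately show ?thesis by (intro bexI[of _ ?G]) (auto simp: EY_def)
            qed
            then show ?thesis using f by (auto simp: W_def GG_def)
          qed
          have farE: "far EE E G" if "G \<in> EY Y2" for G
          proof -
            have G: "E \<inter> G = {}" "G \<subseteq> Y" "G \<inter> W = {}" using that by (auto simp: EY_def Y2_def)
            have "insert f (E - {e}) \<notin> EE" if "e \<in> E" "f \<in> G" for e f
              using inW[of f e] that G by blast
            then show ?thesis using G(1) by (simp add: far_def)
          qed
          have col: "colon (multiples (sqfree ` GG)) (sqfree E) = multiples (sqfree ` EY Y2 \<union> (\<lambda>z. sqfree {z}) ` W)"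
          proof (rule subset_antisym; rule subsetI)
            fix t assume "t \<in> colon (multiples (sqfree ` GG)) (sqfree E)"
            then obtain G where G: "G \<in> GG" "\<And>x. x \<in> G - E \<Longrightarrow> t x > 0"
              unfolding colon_squarefree by blast
            have GY: "G \<in> EE" "G \<subseteq> Y" using G(1) insert.prems by (auto simp: GG_def EY_def Y1_def)
            show "t \<in> multiples (sqfree ` EY Y2 \<union> (\<lambda>z. sqfree {z}) ` W)"
            proof (cases "G \<inter> W = {}")
              case False
              then obtain z where "z \<in> G" "z \<in> W" by blast
              moreover from this have "sqfree {z} \<le> t" using G(2)[of z] by (auto simp: le_fun_def W_def)
              ultimately show ?thesis by (auto simp: multiples_def)
            next
              case True
              have "E \<inter> G = {}"
              proof (rule ccontr)
                assume "E \<inter> G \<noteq> {}"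
                moreover have "E \<noteq> G" using E_notin G(1) by blast
                ultimately obtain e f where "e \<in> E - G" "f \<in> G - E" "insert f (E - {e}) \<in> EE"
                  using ex E(1) GY(1) unfolding exchange_def by blast
                then show False using inW[of f e] GY True by blast
              qed
              then have "G \<in> EY Y2" using GY True by (auto simp: EY_def Y2_def)
              moreover have "sqfree G \<le> t" using G(2) \<open>E \<inter> G = {}\<close>
                by (auto simp: le_fun_def of_bool_def Suc_le_eq)
              ultimately show ?thesis by (auto simp: multiples_def)
            qed
          next
            fix t assume "t \<in> multiples (sqfree ` EY Y2 \<union> (\<lambda>z. sqfree {z}) ` W)"
            then consider G where "G \<in> EY Y2" "sqfree G \<le> t" | z where "z \<in> W" "sqfree {z} \<le> t"
              by (auto simp: multiples_def)
            then show "t \<in> colon (multiples (sqfree ` GG)) (sqfree E)"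
            proof cases
              case 1
              then have "G \<in> GG" using E by (auto simp: GG_def EY_def Y2_def Y1_def)
              moreover have "\<forall>x\<in>G. t x > 0"
              proof
                fix x assume "x \<in> G"
                then show "t x > 0" using 1(2)[unfolded le_fun_def, rule_format, of x] by simp
              qed
              ultimately show ?thesis unfolding colon_squarefree by blast
            next
              case 2
              have "t z > 0" using 2(2)[unfolded le_fun_def, rule_format, of z] by simp
              moreover obtain G where "G \<in> GG" "G - E \<subseteq> {z}" using 2(1) unfolding W_def by blast
              moreover from this \<open>t z > 0\<close> have "\<forall>x\<in>G - E. t x > 0" by blast
              ultimately show ?thesis unfolding colon_squarefree by blast
            qed
          qed
          have sing: "pairwise (far EE) {E}" by simp
          have "card {E} \<le> c" by (rule psubset.prems(2)[OF _ sing]) (use E in simp)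
          then have "c \<ge> 1" by simp
          have cS: "card S \<le> c - 1" if S: "S \<subseteq> EY Y2" "pairwise (far EE) S" for S
          proof -
            have "pairwise (far EE) (insert E S)"
            proof -
              have "far EE E G \<and> far EE G E" if "G \<in> S" for G
              proof -
                have G: "G \<in> EY Y2" using that S by blast
                then have "card G \<ge> 2" "G \<in> EE" using EE d by (auto simp: EY_def)
                then show ?thesis using far_sym[OF ex E(1) _ _ farE[OF G]] farE[OF G] by simp
              qed
              then show ?thesis using S(2) by (auto simp: pairwise_insert)
            qed
            moreover have "insert E S \<subseteq> {E\<in>EE. E \<subseteq> Y}"
              using S(1) E by (auto simp: EY_def Y2_def)
            ultimately have "card (insert E S) \<le> c" using psubset.prems(2) by blast
            moreover have "E \<notin> S" using S(1) E by (auto simp: EY_def Y2_def)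
            moreover have "finite S" using S(1) fin_EE by (auto simp: EY_def intro: finite_subset)
            ultimately show ?thesis by simp
          qed
          have "reg_le (multiples (sqfree ` EY Y2)) (d * (c - 1))"
            using psubset.IH[OF \<open>Y2 \<subset> Y\<close>, of "c - 1"] cS psubset.prems(1) \<open>Y2 \<subset> Y\<close>
            unfolding EY_def by blast
          then have "reg_le (multiples (sqfree ` EY Y2 \<union> (\<lambda>z. sqfree {z}) ` W)) (d * (c - 1))"
          proof (rule reg_le_add_variables[rotated 2])
            show "W \<subseteq> X" using psubset.prems(1) by (auto simp: W_def)
            then show "finite W" using finX finite_subset by blast
            show "t x = 0" if "t \<in> sqfree ` EY Y2" "x \<in> W" for t x
              using that by (auto simp: EY_def Y2_def)
          qed
          then have C: "reg_le (colon (multiples (sqfree ` GG)) (sqfree E)) (d * (c - 1))" unfolding col .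
          have "reg_le (multiples (sqfree ` GG) \<union> multiples {sqfree E}) (d * c)"
          proof (rule reg_le_add_monomial[OF upset_multiples _ C])
            show "reg_le (multiples (sqfree ` GG)) (d * c)" using insert by (auto simp: GG_def)
            show "sqfree E x = 0" if "x \<notin> X" for x using that finE by auto
            show "d * (c - 1) + sum (sqfree E) X \<le> Suc (d * c)"
              using \<open>c \<ge> 1\<close> finE by (simp add: sum_sqfree) (metis One_nat_def Suc_pred add.commute less_eq_Suc_le mult_Suc_right order_refl)
          qed
          then show ?case by (simp add: GG_def Un_insert_right flip: multiples_Un)
        qed
      qed
      have "EY Y = EY Y1 \<union> {E\<in>EY Y. x \<in> E}" by (auto simp: EY_def Y1_def)
      then show ?thesis using main[OF order_refl] unfolding EY_def by metis
    qed
  qed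
qed

end

section \<open>Polynomials and monomial ideals\<close>

abbreviation lookup :: "('a \<Rightarrow>\<^sub>0 'b::zero) \<Rightarrow> 'a \<Rightarrow> 'b" where "lookup \<equiv> Poly_Mapping.lookup"
abbreviation keys :: "('a \<Rightarrow>\<^sub>0 'b::zero) \<Rightarrow> 'a set" where "keys \<equiv> Poly_Mapping.keys"
abbreviation single :: "'a \<Rightarrow> 'b::zero \<Rightarrow> 'a \<Rightarrow>\<^sub>0 'b" where "single \<equiv> Poly_Mapping.single"

type_synonym ('v, 'k) differentials = "nat \<Rightarrow> nat \<Rightarrow> nat \<Rightarrow> ('v, 'k) mpoly"

lemma lookup_sum_single:
  assumes "finite A"
  shows "lookup (\<Sum>t\<in>A. single t (c t)) m = (if m \<in> A then c m else 0)"
  using assms by (simp add: lookup_sum lookup_single when_def)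

lemma sum_single_keys: "(\<Sum>t\<in>keys p. single t (lookup p t)) = p"
  by (rule poly_mapping_eqI) (simp add: lookup_sum_single in_keys_iff)

lemma lookup_single_mult:
  fixes p :: "'a::cancel_comm_monoid_add \<Rightarrow>\<^sub>0 'k::comm_ring_1"
  shows "lookup (single a c * p) m = (if \<exists>t. m = a + t then c * lookup p (m - a) else 0)"
proof -
  have "single a c * p = (\<Sum>t\<in>keys p. single (a + t) (c * lookup p t))"
    by (subst (1) sum_single_keys[of p, symmetric]) (simp add: sum_distrib_left mult_single)
  then have *: "lookup (single a c * p) m = (\<Sum>t\<in>keys p. c * lookup p t when a + t = m)"
    by (simp add: lookup_sum lookup_single)
  show ?thesis
  proof (cases "\<exists>t. m = a + t")
    case True
    then obtain t where t: "m = a + t" by blast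
    have "(\<Sum>t'\<in>keys p. c * lookup p t' when a + t' = m) = (\<Sum>t'\<in>keys p. if t' = t then c * lookup p t' else 0)"
      by (rule sum.cong) (auto simp: t when_def)
    also have "\<dots> = c * lookup p t" by (simp add: in_keys_iff)
    finally show ?thesis using * t by simp
  next
    case False
    then show ?thesis using * by (auto simp: when_def intro!: sum.neutral)
  qed
qed

lemma lookup_variable_mult:
  fixes p :: "('v, 'k::comm_ring_1) mpoly"
  shows "lookup (variable x * p) m = (if lookup m x > 0 then lookup p (m - single x 1) else 0)"
proof -
  have "(\<exists>t. m = single x 1 + t) \<longleftrightarrow> lookup m x > 0"
  proof
    assume "lookup m x > 0"
    then have "m = single x 1 + (m - single x 1)"
      by (intro poly_mapping_eqI) (auto simp: lookup_add lookup_minus lookup_single when_def)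
    then show "\<exists>t. m = single x 1 + t" by blast
  qed (auto simp: lookup_add)
  then show ?thesis by (simp add: variable_def lookup_single_mult)
qed

lemma keys_add_nat: "keys (a + b :: 'v \<Rightarrow>\<^sub>0 nat) = keys a \<union> keys b"
  by (auto simp: in_keys_iff lookup_add)

lemma mon_degree_eq_sum: "finite A \<Longrightarrow> keys m \<subseteq> A \<Longrightarrow> mon_degree m = sum (lookup m) A"
  unfolding mon_degree_def by (rule sum.mono_neutral_left) (auto simp: in_keys_iff)

lemma mon_degree_add: "mon_degree (a + b) = mon_degree a + mon_degree b"
proof -
  let ?A = "keys a \<union> keys b"
  have "mon_degree (a + b) = sum (lookup (a + b)) ?A"
    by (rule mon_degree_eq_sum) (auto simp: keys_add_nat)
  also have "\<dots> = sum (lookup a) ?A + sum (lookup b) ?A" by (simp add: lookup_add sum.distrib)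
  also have "\<dots> = mon_degree a + mon_degree b"
    by (simp add: mon_degree_eq_sum[of ?A a] mon_degree_eq_sum[of ?A b])
  finally show ?thesis .
qed

lemma mon_degree_zero [simp]: "mon_degree 0 = 0" by (simp add: mon_degree_def)

lemma mon_degree_eq_0_iff: "mon_degree m = 0 \<longleftrightarrow> m = 0"
proof
  assume "mon_degree m = 0"
  then have "\<forall>a. lookup m a = 0" by (auto simp: mon_degree_def in_keys_iff)
  then show "m = 0" by (intro poly_mapping_eqI) simp
qed simp

lemma mon_degree_single [simp]: "mon_degree (single x n) = n"
  by (simp add: mon_degree_def)

definition mon_ideal :: "('v \<Rightarrow> nat) set \<Rightarrow> ('v, 'k::comm_ring_1) mpoly set" where
  "mon_ideal U = {p. \<forall>m\<in>keys p. lookup m \<in> U}"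

lemma mon_ideal_zero [simp]: "0 \<in> mon_ideal U" by (simp add: mon_ideal_def)

lemma mon_ideal_add: "p \<in> mon_ideal U \<Longrightarrow> q \<in> mon_ideal U \<Longrightarrow> p + q \<in> mon_ideal U"
  using keys_add[of p q] by (auto simp: mon_ideal_def)

lemma keys_uminus_eq: "keys (- p :: 'a \<Rightarrow>\<^sub>0 'b::ab_group_add) = keys p"
  by (auto simp: in_keys_iff)

lemma keys_minus_subset: "keys (p - q :: 'a \<Rightarrow>\<^sub>0 'b::ab_group_add) \<subseteq> keys p \<union> keys q"
  by (auto simp: in_keys_iff lookup_minus)

lemma mon_ideal_sum: "(\<And>b. b \<in> B \<Longrightarrow> f b \<in> mon_ideal U) \<Longrightarrow> sum f B \<in> mon_ideal U"
  by (induction B rule: infinite_finite_induct) (auto intro: mon_ideal_add)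

lemma keys_multE:
  assumes "m \<in> keys (p * q :: 'a::comm_monoid_add \<Rightarrow>\<^sub>0 'k::comm_ring_1)"
  obtains a b where "m = a + b" "a \<in> keys p" "b \<in> keys q"
  using keys_mult[of p q] assms by blast

lemma mon_ideal_mult: "upset U \<Longrightarrow> q \<in> mon_ideal U \<Longrightarrow> p * q \<in> mon_ideal U"
  by (auto simp: mon_ideal_def upset_def le_fun_def lookup_add elim!: keys_multE)

lemma mon_ideal_empty: "mon_ideal {} = {0}"
  by (auto simp: mon_ideal_def)

context koszul
begin

text \<open>
  The polynomials in the variables \<open>X\<close> that are homogeneous of degree \<open>j - e\<close>. The offset \<open>e\<close>
  is the degree of the basis element that the polynomial multiplies; keeping it on the other side of
  the equation avoids truncated subtraction.
\<close>

definition homog :: "nat \<Rightarrow> nat \<Rightarrow> ('v, 'k) mpoly set" where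
  "homog e j = {p. \<forall>m\<in>keys p. keys m \<subseteq> X \<and> mon_degree m + e = j}"

lemma homog_zero [simp]: "0 \<in> homog e j" by (simp add: homog_def)

lemma homog_add: "p \<in> homog e j \<Longrightarrow> q \<in> homog e j \<Longrightarrow> p + q \<in> homog e j"
  using keys_add[of p q] by (auto simp: homog_def)

lemma homog_diff: "p \<in> homog e j \<Longrightarrow> q \<in> homog e j \<Longrightarrow> p - q \<in> homog e j"
  using keys_minus_subset[of p q] by (auto simp: homog_def)

lemma homog_uminus: "p \<in> homog e j \<Longrightarrow> - p \<in> homog e j"
  by (auto simp: homog_def keys_uminus_eq)

lemma homog_sum: "(\<And>b. b \<in> B \<Longrightarrow> f b \<in> homog e j) \<Longrightarrow> sum f B \<in> homog e j"
  by (induction B rule: infinite_finite_induct) (auto intro: homog_add)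

lemma homog_mult: "p \<in> homog e j \<Longrightarrow> q \<in> homog e' e \<Longrightarrow> p * q \<in> homog e' j"
  unfolding homog_def by (fastforce simp: mon_degree_add keys_add_nat elim!: keys_multE)

lemma homog_variable: "x \<in> X \<Longrightarrow> variable x \<in> homog e (Suc e)"
  by (auto simp: homog_def variable_def)

lemma homog_ksgn: "p \<in> homog e j \<Longrightarrow> ksgn x T * p \<in> homog e j"
  using ksgn_cases[of x T, where 'r="('v,'k) mpoly"] by (auto intro: homog_uminus)

lemma lookup_ksgn: "lookup (ksgn x T * p) t = ksgn x T * lookup p (t :: 'a::comm_monoid_add)"
  unfolding ksgn_def by (cases "even (card {y\<in>T. idx y < idx x})") auto

lemma homog_bdry:
  assumes "\<And>S. f S \<in> homog (Suc e) j"
  shows "bdry variable f T \<in> homog e j"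
proof -
  have "ksgn x T * variable x * f (insert x T) \<in> homog e j" if "x \<in> X" for x
    using homog_ksgn[OF homog_mult[OF assms homog_variable[OF that]]] by (metis mult.assoc mult.commute)
  then show ?thesis by (auto simp: bdry_def intro: homog_sum)
qed

lemma lookup_bdry_variable:
  assumes "T \<subseteq> X"
  shows "lookup (bdry variable f T :: ('v,'k) mpoly) t =
    (\<Sum>x\<in>X - T. ksgn x T * (if lookup t x > 0 then lookup (f (insert x T)) (t - single x 1) else 0))"
  using assms unfolding bdry_def
  by (simp add: lookup_sum lookup_ksgn lookup_variable_mult mult.assoc cong: sum.cong)

definition sqfree_mon :: "'v set \<Rightarrow> 'v \<Rightarrow>\<^sub>0 nat" where
  "sqfree_mon S = (\<Sum>x\<in>S. single x 1)"

lemma lookup_sqfree_mon: "S \<subseteq> X \<Longrightarrow> lookup (sqfree_mon S) x = of_bool (x \<in> S)"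
  using finX finite_subset unfolding sqfree_mon_def by (subst lookup_sum_single) auto

lemma keys_sqfree_mon: "S \<subseteq> X \<Longrightarrow> keys (sqfree_mon S) = S"
  by (auto simp: in_keys_iff lookup_sqfree_mon)

lemma mon_degree_sqfree_mon: "S \<subseteq> X \<Longrightarrow> mon_degree (sqfree_mon S) = card S"
  by (simp add: mon_degree_def keys_sqfree_mon lookup_sqfree_mon)

lemma finite_mons: "finite {m :: 'v \<Rightarrow>\<^sub>0 nat. keys m \<subseteq> X \<and> mon_degree m + e = j}"
proof -
  let ?A = "{m :: 'v \<Rightarrow>\<^sub>0 nat. keys m \<subseteq> X \<and> mon_degree m + e = j}"
  have "lookup ` ?A \<subseteq> {f. \<forall>x. (x \<in> X \<longrightarrow> f x \<in> {0..j}) \<and> (x \<notin> X \<longrightarrow> f x = 0)}"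
  proof clarsimp
    fix m :: "'v \<Rightarrow>\<^sub>0 nat" and x
    assume m: "keys m \<subseteq> X" "j = mon_degree m + e"
    have "lookup m x \<le> mon_degree m + e" if "x \<in> X"
      using member_le_sum[of x X "lookup m"] that finX by (simp add: mon_degree_eq_sum[OF finX m(1)])
    moreover have "lookup m x = 0" if "x \<notin> X" using that m by (meson in_keys_iff subsetD)
    ultimately show "(x \<in> X \<longrightarrow> lookup m x \<le> mon_degree m + e) \<and> (x \<notin> X \<longrightarrow> lookup m x = 0)" by blast
  qed
  then have "finite (lookup ` ?A)"
    by (rule finite_subset) (intro finite_set_of_finite_funs finX, simp)
  then show ?thesis
    by (rule finite_imageD) (rule inj_onI, rule poly_mapping_eqI, simp)
qed

section \<open>Koszul homology from multidegrees\<close>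

text \<open>
  The degree \<open>j\<close> part of the Koszul complex of \<open>R(-e)\<close>, at \<open>p\<close>.
\<close>

definition koszul1 :: "nat \<Rightarrow> nat \<Rightarrow> nat \<Rightarrow> ('v set \<Rightarrow> ('v, 'k) mpoly) set" where
  "koszul1 p e j = {f. \<forall>S. (f S \<noteq> 0 \<longrightarrow> S \<subseteq> X \<and> card S = p) \<and> f S \<in> homog (p + e) j}"

text \<open>
  A Koszul cycle of \<open>R/I\<close> is the sum of its multigraded parts, whose coefficients form cycles of the finite
  complexes \<open>koszul_basis\<close>; their preimages are put together to a preimage. The second alternative covers
  multidegrees with homology to which the given cycle does not contribute; it is needed for \<open>\<alpha> = 0\<close>, where even
  a free module has homology.
\<close>

lemma koszul_exact_modulo_mon_ideal:
  assumes up: "upset U" and f: "f \<in> koszul1 p e j" and cyc: "\<And>T. bdry variable f T \<in> mon_ideal U"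
    and ac: "\<And>\<alpha>. \<lbrakk>keys \<alpha> \<subseteq> X; mon_degree \<alpha> + e = j\<rbrakk> \<Longrightarrow>
      acyclic_in p (koszul_basis (lookup \<alpha>) U) \<or> (\<forall>S\<in>koszul_basis (lookup \<alpha>) U. lookup (f S) (\<alpha> - sqfree_mon S) = 0)"
  shows "\<exists>g\<in>koszul1 (Suc p) e j. \<forall>S. f S - bdry variable g S \<in> mon_ideal U"
proof -
  define c where "c \<alpha> S = (if S \<in> koszul_basis (lookup \<alpha>) U then lookup (f S) (\<alpha> - sqfree_mon S) else 0)" for \<alpha> S
  have lookup_diff: "lookup (\<alpha> - sqfree_mon T) = (\<lambda>x. lookup \<alpha> x - sqfree T x)" if "T \<subseteq> X" for T \<alpha>
    using that by (simp add: lookup_minus lookup_sqfree_mon fun_eq_iff)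
  have "\<exists>g. (\<forall>S. g S \<noteq> 0 \<longrightarrow> S \<in> koszul_basis (lookup \<alpha>) U \<and> card S = Suc p)
      \<and> (\<forall>S\<in>koszul_basis (lookup \<alpha>) U. c \<alpha> S = bdry (\<lambda>_. 1) g S)"
    if \<alpha>: "keys \<alpha> \<subseteq> X" "mon_degree \<alpha> + e = j" for \<alpha>
    using ac[OF \<alpha>]
  proof
    assume "\<forall>S\<in>koszul_basis (lookup \<alpha>) U. lookup (f S) (\<alpha> - sqfree_mon S) = 0"
    then show ?thesis by (intro exI[of _ "\<lambda>_. 0"]) (simp add: c_def)
  next
    assume A: "acyclic_in p (koszul_basis (lookup \<alpha>) U)"
    have "bdry (\<lambda>_. 1) (c \<alpha>) T = 0" if T: "T \<in> koszul_basis (lookup \<alpha>) U" for T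
    proof -
      have TX: "T \<subseteq> X" using T by (simp add: koszul_basis_def)
      let ?t = "\<alpha> - sqfree_mon T"
      have "bdry (\<lambda>_. 1) (c \<alpha>) T = (\<Sum>x\<in>X - T. ksgn x T * c \<alpha> (insert x T))"
        using TX by (simp add: bdry_def)
      also have "\<dots> = (\<Sum>x\<in>X - T. ksgn x T * (if lookup ?t x > 0 then lookup (f (insert x T)) (?t - single x 1) else 0))"
      proof (rule sum.cong, simp)
        fix x assume x: "x \<in> X - T"
        have ins: "insert x T \<subseteq> X" using x TX by auto
        have "insert x T \<in> koszul_basis (lookup \<alpha>) U \<longleftrightarrow> lookup ?t x > 0"
        proof
          assume "lookup ?t x > 0"
          then show "insert x T \<in> koszul_basis (lookup \<alpha>) U"
            using x T TX by (intro koszul_basis_up[OF up T]) (auto simp: koszul_basis_def lookup_diff)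
        qed (use x TX in \<open>simp add: koszul_basis_def lookup_diff\<close>)
        moreover have "\<alpha> - sqfree_mon (insert x T) = ?t - single x 1"
          using ins TX x by (intro poly_mapping_eqI) (auto simp: lookup_minus lookup_sqfree_mon lookup_single when_def)
        ultimately show "ksgn x T * c \<alpha> (insert x T)
          = ksgn x T * (if lookup ?t x > 0 then lookup (f (insert x T)) (?t - single x 1) else 0)"
          by (simp add: c_def)
      qed
      also have "\<dots> = lookup (bdry variable f T) ?t"
        using lookup_bdry_variable[OF TX, of f ?t] by simp
      also have "\<dots> = 0"
      proof (rule ccontr)
        assume "lookup (bdry variable f T) ?t \<noteq> 0"
        then have "lookup ?t \<in> U" using cyc[of T] by (auto simp: mon_ideal_def in_keys_iff)
        then show False using T TX by (simp add: lookup_diff koszul_basis_def)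
      qed
      finally show ?thesis .
    qed
    moreover have "S \<in> koszul_basis (lookup \<alpha>) U \<and> card S = p" if "c \<alpha> S \<noteq> 0" for S
    proof -
      have "f S \<noteq> 0" using that by (auto simp: c_def split: if_splits)
      then show ?thesis using that f by (auto simp: c_def koszul1_def split: if_splits)
    qed
    ultimately show ?thesis using A unfolding acyclic_in_def by blast
  qed
  then obtain G where G: "\<And>\<alpha> S. \<lbrakk>keys \<alpha> \<subseteq> X; mon_degree \<alpha> + e = j; G \<alpha> S \<noteq> 0\<rbrakk>
        \<Longrightarrow> S \<in> koszul_basis (lookup \<alpha>) U \<and> card S = Suc p"
    and G2: "\<And>\<alpha> S. \<lbrakk>keys \<alpha> \<subseteq> X; mon_degree \<alpha> + e = j; S \<in> koszul_basis (lookup \<alpha>) U\<rbrakk>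
        \<Longrightarrow> c \<alpha> S = bdry (\<lambda>_. 1) (G \<alpha>) S"
    by metis
  define A where "A = {t :: 'v \<Rightarrow>\<^sub>0 nat. keys t \<subseteq> X \<and> mon_degree t + (Suc p + e) = j}"
  have finA: "finite A" unfolding A_def by (rule finite_mons)
  define g where "g S = (if S \<subseteq> X \<and> card S = Suc p then \<Sum>t\<in>A. single t (G (t + sqfree_mon S) S) else 0)" for S
  have lookup_g: "lookup (g S) t = (if S \<subseteq> X \<and> card S = Suc p \<and> t \<in> A then G (t + sqfree_mon S) S else 0)" for S t
    by (simp add: g_def lookup_sum_single[OF finA])
  have g_koszul_ch: "g \<in> koszul1 (Suc p) e j"
  proof -
    have "g S \<in> homog (Suc p + e) j" for S
    proof -
      have "m \<in> A" if "m \<in> keys (g S)" for m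
        using that lookup_g[of S m] by (auto simp: in_keys_iff split: if_splits)
      then show ?thesis unfolding homog_def A_def by blast
    qed
    then show ?thesis by (auto simp: koszul1_def g_def)
  qed
  have bdg: "bdry variable g S \<in> homog (p + e) j" for S
    using g_koszul_ch by (intro homog_bdry) (simp add: koszul1_def)
  have "f S - bdry variable g S \<in> mon_ideal U" for S
  proof (cases "S \<subseteq> X \<and> card S = p")
    case False
    have "f S = 0" using f False by (auto simp: koszul1_def)
    moreover have "bdry variable g S = 0"
    proof (rule ccontr)
      assume "bdry variable g S \<noteq> 0"
      then obtain x where x: "S \<subseteq> X" "x \<in> X - S" "g (insert x S) \<noteq> 0" by (rule bdry_neq_zeroE)
      then have "card (insert x S) = Suc p" by (auto simp: g_def split: if_splits)
      moreover have "finite S" using x finX finite_subset by blast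
      ultimately show False using x False by simp
    qed
    ultimately show ?thesis by simp
  next
    case True
    then have S: "S \<subseteq> X" "card S = p" by auto
    have finS: "finite S" using S finX finite_subset by blast
    show ?thesis unfolding mon_ideal_def
    proof (intro CollectI ballI, rule ccontr)
      fix t assume t: "t \<in> keys (f S - bdry variable g S)" and tU: "lookup t \<notin> U"
      have "f S - bdry variable g S \<in> homog (p + e) j" using f bdg by (auto simp: koszul1_def intro: homog_diff)
      then have t': "keys t \<subseteq> X" "mon_degree t + (p + e) = j" using t by (auto simp: homog_def)
      define \<alpha> where "\<alpha> = t + sqfree_mon S"
      have \<alpha>: "keys \<alpha> \<subseteq> X" "mon_degree \<alpha> + e = j"
        using S t' by (auto simp: \<alpha>_def keys_add_nat keys_sqfree_mon mon_degree_add mon_degree_sqfree_mon)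
      have la: "lookup \<alpha> = (\<lambda>x. lookup t x + sqfree S x)"
        using S by (simp add: \<alpha>_def lookup_add lookup_sqfree_mon fun_eq_iff)
      have \<alpha>S: "S \<in> koszul_basis (lookup \<alpha>) U" using S tU by (simp add: koszul_basis_def la)
      have at: "\<alpha> - sqfree_mon S = t" by (simp add: \<alpha>_def)
      have "lookup (f S) t = bdry (\<lambda>_. 1) (G \<alpha>) S"
        using G2[OF \<alpha> \<alpha>S] \<alpha>S by (simp add: c_def at)
      also have "\<dots> = (\<Sum>x\<in>X - S. ksgn x S * G \<alpha> (insert x S))" using S by (simp add: bdry_def)
      also have "\<dots> = (\<Sum>x\<in>X - S. ksgn x S * (if lookup t x > 0 then lookup (g (insert x S)) (t - single x 1) else 0))"
      proof (rule sum.cong, simp)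
        fix x assume x: "x \<in> X - S"
        show "ksgn x S * G \<alpha> (insert x S)
          = ksgn x S * (if lookup t x > 0 then lookup (g (insert x S)) (t - single x 1) else 0)"
        proof (cases "lookup t x > 0")
          case True
          have t1: "t = (t - single x 1) + single x 1"
            using True by (intro poly_mapping_eqI) (auto simp: lookup_add lookup_minus lookup_single when_def)
          have "mon_degree t = Suc (mon_degree (t - single x 1))" by (subst t1) (simp add: mon_degree_add)
          moreover have "keys (t - single x 1) \<subseteq> X"
            using t'(1) by (auto simp: in_keys_iff lookup_minus)
          ultimately have "t - single x 1 \<in> A" using t' by (simp add: A_def)
          moreover have "(t - single x 1) + sqfree_mon (insert x S) = \<alpha>"
            using True x S unfolding \<alpha>_def
            by (intro poly_mapping_eqI) (auto simp: lookup_add lookup_minus lookup_sqfree_mon lookup_single when_def)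
          ultimately show ?thesis using True x S finS by (simp add: lookup_g)
        next
          case False
          then have "G \<alpha> (insert x S) = 0"
            using G[OF \<alpha>, of "insert x S"] x by (auto simp: koszul_basis_def la)
          then show ?thesis using False by simp
        qed
      qed
      also have "\<dots> = lookup (bdry variable g S) t"
        using lookup_bdry_variable[OF S(1), of g t] by simp
      finally show False using t by (simp add: in_keys_iff lookup_minus)
    qed
  qed
  then show ?thesis using g_koszul_ch by blast
qed

section \<open>Koszul complexes of graded free modules\<close>

text \<open>
  The part of degree \<open>j - e\<close> of the free module \<open>\<Oplus>\<^sub>a R(-s\<^sub>a)\<close>, with vectors padded by zeros so that vectors of
  all lengths have one type. Below, \<open>koszul_ch p s j\<close> is the degree \<open>j\<close> part of the Koszul complex of this module.
\<close>

definition free_deg :: "nat list \<Rightarrow> nat \<Rightarrow> nat \<Rightarrow> (nat \<Rightarrow> ('v, 'k) mpoly) set" where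
  "free_deg s e j = {v. (\<forall>a. v a \<noteq> 0 \<longrightarrow> a < length s) \<and> (\<forall>a<length s. v a \<in> homog (e + s ! a) j)}"

definition koszul_ch :: "nat \<Rightarrow> nat list \<Rightarrow> nat \<Rightarrow> ('v set \<Rightarrow> nat \<Rightarrow> ('v, 'k) mpoly) set" where
  "koszul_ch p s j = {f. (\<forall>S a. f S a \<noteq> 0 \<longrightarrow> S \<subseteq> X \<and> card S = p) \<and> (\<forall>S. f S \<in> free_deg s p j)}"

definition bdrym :: "('v set \<Rightarrow> nat \<Rightarrow> ('v, 'k) mpoly) \<Rightarrow> 'v set \<Rightarrow> nat \<Rightarrow> ('v, 'k) mpoly" where
  "bdrym f T a = bdry variable (\<lambda>S. f S a) T"

definition mat_app :: "nat \<Rightarrow> nat \<Rightarrow> (nat \<Rightarrow> nat \<Rightarrow> ('v, 'k) mpoly) \<Rightarrow> (nat \<Rightarrow> ('v, 'k) mpoly) \<Rightarrow> nat \<Rightarrow> ('v, 'k) mpoly" where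
  "mat_app r c M v a = (if a < r then \<Sum>b<c. M a b * v b else 0)"

lemma free_deg_diff: "v \<in> free_deg s e j \<Longrightarrow> w \<in> free_deg s e j \<Longrightarrow> (\<lambda>a. v a - w a) \<in> free_deg s e j"
  unfolding free_deg_def by (auto intro: homog_diff) (metis diff_0_right)

lemma free_deg_zero [simp]: "(\<lambda>_. 0) \<in> free_deg s e j" by (simp add: free_deg_def)

lemma bdrym_zero [simp]: "bdrym (\<lambda>_ _. 0) T a = 0" by (simp add: bdrym_def)

lemma bdrym_bdrym: "bdrym (bdrym f) T a = 0"
  unfolding bdrym_def by (rule bdry_bdry)

lemma bdrym_diff: "bdrym (\<lambda>S a. f S a - g S a) T a = bdrym f T a - bdrym g T a"
  by (simp add: bdrym_def bdry_diff)

lemma bdrym_cong: "(\<And>S. f S a = g S a) \<Longrightarrow> bdrym f T a = bdrym g T a"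
  by (simp add: bdrym_def)

lemma bdrym_mat_app: "bdrym (\<lambda>S. mat_app r c M (f S)) T = mat_app r c M (bdrym f T)"
  by (rule ext) (simp add: bdrym_def mat_app_def bdry_sum bdry_cmult)

lemma mat_app_diff: "mat_app r c M (\<lambda>a. v a - w a) a = mat_app r c M v a - mat_app r c M w a"
  by (simp add: mat_app_def algebra_simps sum_subtractf)

lemma mat_app_zero [simp]: "mat_app r c M (\<lambda>_. 0) a = 0" by (simp add: mat_app_def)

lemma mat_app_free_deg:
  assumes "\<And>a b. a < length s \<Longrightarrow> b < length s' \<Longrightarrow> M a b \<in> homog (s ! a) (s' ! b)" "w \<in> free_deg s' e j"
  shows "mat_app (length s) (length s') M w \<in> free_deg s e j"
proof -
  have "M a b * w b \<in> homog (e + s ! a) j" if "a < length s" "b < length s'" for a b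
  proof -
    have "M a b \<in> homog (e + s ! a) (e + s' ! b)" using assms(1)[OF that] by (auto simp: homog_def)
    moreover have "w b \<in> homog (e + s' ! b) j" using assms(2) that by (simp add: free_deg_def)
    ultimately show ?thesis by (subst mult.commute) (rule homog_mult)
  qed
  then show ?thesis by (auto simp: free_deg_def mat_app_def intro: homog_sum)
qed

lemma bdrym_koszul_ch:
  assumes "f \<in> koszul_ch (Suc p) s j"
  shows "bdrym f \<in> koszul_ch p s j"
proof -
  have 1: "T \<subseteq> X \<and> card T = p \<and> a < length s" if nz: "bdrym f T a \<noteq> 0" for T a
  proof -
    obtain x where x: "T \<subseteq> X" "x \<in> X - T" "f (insert x T) a \<noteq> 0"
      using nz unfolding bdrym_def by (rule bdry_neq_zeroE)
    then have "card (insert x T) = Suc p" "a < length s" using assms unfolding koszul_ch_def free_deg_def by blast+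
    moreover have "finite T" using x finX finite_subset by blast
    ultimately show ?thesis using x by simp
  qed
  moreover have "bdrym f T a \<in> homog (p + s ! a) j" if "a < length s" for T a
    unfolding bdrym_def using assms that by (intro homog_bdry) (simp add: koszul_ch_def free_deg_def)
  ultimately show ?thesis unfolding koszul_ch_def free_deg_def by blast
qed

lemma bdrym_koszul_ch_0: "f \<in> koszul_ch 0 s j \<Longrightarrow> bdrym f T a = 0"
proof (rule ccontr)
  assume f: "f \<in> koszul_ch 0 s j" and "bdrym f T a \<noteq> 0"
  then obtain x where x: "T \<subseteq> X" "x \<in> X - T" "f (insert x T) a \<noteq> 0"
    unfolding bdrym_def by (elim bdry_neq_zeroE)
  then have "card (insert x T) = 0" using f unfolding koszul_ch_def by blast
  moreover have "finite T" using x finX finite_subset by blast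
  ultimately show False by simp
qed

lemma koszul_ch_diff: "f \<in> koszul_ch p s j \<Longrightarrow> g \<in> koszul_ch p s j \<Longrightarrow> (\<lambda>S a. f S a - g S a) \<in> koszul_ch p s j"
proof -
  assume f: "f \<in> koszul_ch p s j" and g: "g \<in> koszul_ch p s j"
  have "S \<subseteq> X \<and> card S = p" if "f S a - g S a \<noteq> 0" for S a
  proof -
    have "f S a \<noteq> 0 \<or> g S a \<noteq> 0" using that by auto
    then show ?thesis using f g unfolding koszul_ch_def by blast
  qed
  moreover have "(\<lambda>a. f S a - g S a) \<in> free_deg s p j" for S
    using f g by (intro free_deg_diff) (simp_all add: koszul_ch_def)
  ultimately show ?thesis unfolding koszul_ch_def by blast
qed

lemma mat_app_koszul_ch:
  assumes "\<And>a b. a < length s \<Longrightarrow> b < length s' \<Longrightarrow> M a b \<in> homog (s ! a) (s' ! b)" "w \<in> koszul_ch p s' j"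
  shows "(\<lambda>S. mat_app (length s) (length s') M (w S)) \<in> koszul_ch p s j"
proof -
  have "S \<subseteq> X \<and> card S = p" if nz: "mat_app (length s) (length s') M (w S) a \<noteq> 0" for S a
  proof (rule ccontr)
    assume "\<not> ?thesis"
    then have "w S b = 0" for b using assms(2) unfolding koszul_ch_def by blast
    then show False using nz by (simp add: mat_app_def split: if_splits)
  qed
  moreover have "mat_app (length s) (length s') M (w S) \<in> free_deg s p j" for S
    using assms by (intro mat_app_free_deg) (auto simp: koszul_ch_def)
  ultimately show ?thesis unfolding koszul_ch_def by blast
qed

lemma koszul_ch_components:
  assumes g: "\<And>a. a < length s \<Longrightarrow> (\<lambda>S. g S a) \<in> koszul1 p (s ! a) j"
    and g0: "\<And>S a. a \<ge> length s \<Longrightarrow> g S a = 0"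
  shows "g \<in> koszul_ch p s j"
proof -
  have "S \<subseteq> X \<and> card S = p \<and> a < length s" if "g S a \<noteq> 0" for S a
  proof -
    have "a < length s" using g0 that by (meson not_le)
    then show ?thesis using g[of a] that by (simp add: koszul1_def)
  qed
  moreover have "g S a \<in> homog (p + s ! a) j" if "a < length s" for S a
    using g[OF that] by (simp add: koszul1_def)
  ultimately show ?thesis unfolding koszul_ch_def free_deg_def by blast
qed

lemma koszul_ch_component: "f \<in> koszul_ch p s j \<Longrightarrow> a < length s \<Longrightarrow> (\<lambda>S. f S a) \<in> koszul1 p (s ! a) j"
  unfolding koszul_ch_def koszul1_def free_deg_def by auto

text \<open>
  Free modules have no Koszul homology except in homological degree 0, where it sits in the constant
  coefficients.
\<close>

lemma koszul_exact:
  assumes f: "f \<in> koszul_ch p s j" and cyc: "\<And>T a. bdrym f T a = 0"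
    and const: "p = 0 \<Longrightarrow> (\<And>a. lookup (f {} a) 0 = 0)"
  shows "\<exists>g\<in>koszul_ch (Suc p) s j. \<forall>S a. f S a = bdrym g S a"
proof -
  have "\<exists>g\<in>koszul1 (Suc p) (s ! a) j. \<forall>S. f S a - bdry variable g S \<in> mon_ideal {}" if a: "a < length s" for a
  proof (rule koszul_exact_modulo_mon_ideal)
    show "(\<lambda>S. f S a) \<in> koszul1 p (s ! a) j" using f a by (rule koszul_ch_component)
    show "bdry variable (\<lambda>S. f S a) T \<in> mon_ideal {}" for T using cyc[of T a] by (simp add: bdrym_def)
    fix \<alpha> :: "'v \<Rightarrow>\<^sub>0 nat" assume \<alpha>: "keys \<alpha> \<subseteq> X" "mon_degree \<alpha> + s ! a = j"
    show "acyclic_in p (koszul_basis (lookup \<alpha>) {}) \<or> (\<forall>S\<in>koszul_basis (lookup \<alpha>) {}. lookup (f S a) (\<alpha> - sqfree_mon S) = 0)"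
    proof (cases "p = 0 \<and> \<alpha> = 0")
      case True
      then show ?thesis using const[of a] by (simp add: koszul_basis_empty sqfree_mon_def)
    next
      case False
      have "{x\<in>X. lookup \<alpha> x > 0} \<noteq> {} \<or> p \<noteq> 0"
      proof (rule ccontr)
        assume "\<not> ?thesis"
        then have "p = 0" "\<forall>x\<in>X. lookup \<alpha> x = 0" by auto
        then have "mon_degree \<alpha> = 0" using \<alpha>(1) by (simp add: mon_degree_eq_sum[OF finX])
        then show False using False \<open>p = 0\<close> by (simp add: mon_degree_eq_0_iff)
      qed
      then have "acyclic_in p (Pow {x\<in>X. lookup \<alpha> x > 0})" by (intro acyclic_in_Pow) simp_all
      then show ?thesis by (simp add: koszul_basis_empty)
    qed
  qed (simp add: upset_def)
  then obtain g where g: "\<And>a. a < length s \<Longrightarrow> g a \<in> koszul1 (Suc p) (s ! a) j"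
    "\<And>a S. a < length s \<Longrightarrow> f S a = bdry variable (g a) S"
    unfolding mon_ideal_empty by (metis (no_types, lifting) eq_iff_diff_eq_0 singletonD)
  define h where "h S a = (if a < length s then g a S else 0)" for S a
  have "h \<in> koszul_ch (Suc p) s j" using g(1) by (intro koszul_ch_components) (auto simp: h_def)
  moreover have "f S a = bdrym h S a" for S a
  proof (cases "a < length s")
    case True then show ?thesis using g(2) by (simp add: bdrym_def h_def)
  next
    case False
    then have "f S a = 0" using f unfolding koszul_ch_def free_deg_def by blast
    then show ?thesis using False by (simp add: bdrym_def h_def)
  qed
  ultimately show ?thesis by blast
qed

text \<open>
  The vanishing of the Koszul homology \<open>H\<^sub>p(R/I)\<^sub>j\<close>.
\<close>

definition koszul_zero :: "('v \<Rightarrow> nat) set \<Rightarrow> nat \<Rightarrow> nat \<Rightarrow> bool" where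
  "koszul_zero U p j \<longleftrightarrow> (\<forall>f\<in>koszul_ch p [0] j. (\<forall>T. bdrym f T 0 \<in> mon_ideal U) \<longrightarrow>
     (\<exists>g\<in>koszul_ch (Suc p) [0] j. \<forall>S. f S 0 - bdrym g S 0 \<in> mon_ideal U))"

lemma koszul_zero_of_reg_le:
  assumes "upset U" "reg_le U B" "j > B + p"
  shows "koszul_zero U p j"
  unfolding koszul_zero_def
proof (intro ballI impI)
  fix f assume f: "f \<in> koszul_ch p [0] j" and cyc: "\<forall>T. bdrym f T 0 \<in> mon_ideal U"
  have "\<exists>g\<in>koszul1 (Suc p) 0 j. \<forall>S. f S 0 - bdry variable g S \<in> mon_ideal U"
  proof (rule koszul_exact_modulo_mon_ideal[OF assms(1)])
    show "(\<lambda>S. f S 0) \<in> koszul1 p 0 j" using koszul_ch_component[OF f, of 0] by simp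
    show "bdry variable (\<lambda>S. f S 0) T \<in> mon_ideal U" for T using cyc by (simp add: bdrym_def)
    fix \<alpha> :: "'v \<Rightarrow>\<^sub>0 nat" assume \<alpha>: "keys \<alpha> \<subseteq> X" "mon_degree \<alpha> + 0 = j"
    have "lookup \<alpha> x = 0" if "x \<notin> X" for x using that \<alpha>(1) by (meson in_keys_iff subsetD)
    moreover have "sum (lookup \<alpha>) X > B + p" using assms(3) \<alpha> by (simp add: mon_degree_eq_sum[OF finX])
    ultimately show "acyclic_in p (koszul_basis (lookup \<alpha>) U) \<or> (\<forall>S\<in>koszul_basis (lookup \<alpha>) U. lookup (f S 0) (\<alpha> - sqfree_mon S) = 0)"
      using assms(2) by (simp add: reg_le_def)
  qed
  then obtain g where g: "g \<in> koszul1 (Suc p) 0 j" "\<And>S. f S 0 - bdry variable g S \<in> mon_ideal U" by blast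
  define h where "h S a = (if a = 0 then g S else 0)" for S and a :: nat
  have "h \<in> koszul_ch (Suc p) [0] j" using g(1) by (intro koszul_ch_components) (auto simp: h_def)
  moreover have "bdrym h S 0 = bdry variable g S" for S by (simp add: bdrym_def h_def)
  ultimately show "\<exists>g\<in>koszul_ch (Suc p) [0] j. \<forall>S. f S 0 - bdrym g S 0 \<in> mon_ideal U"
    using g(2) by (intro bexI[of _ h]) auto
qed

lemma koszul_zero_above_card: "p > card X \<Longrightarrow> koszul_zero U p j"
proof -
  assume p: "p > card X"
  have zero: "f S a = 0" if "f \<in> koszul_ch p [0] j" for f S a
  proof (rule ccontr)
    assume "f S a \<noteq> 0"
    then have "S \<subseteq> X" "card S = p" using that by (auto simp: koszul_ch_def)
    moreover have "card S \<le> card X" using \<open>S \<subseteq> X\<close> by (rule card_mono[OF finX])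
    ultimately show False using p by simp
  qed
  show ?thesis unfolding koszul_zero_def
  proof (intro ballI impI bexI allI)
    show "(\<lambda>_ _. 0) \<in> koszul_ch (Suc p) [0] j" by (simp add: koszul_ch_def)
    fix f S assume "f \<in> koszul_ch p [0] j"
    from zero[OF this] show "f S 0 - bdrym (\<lambda>_ _. 0) S 0 \<in> mon_ideal U" by simp
  qed
qed

section \<open>Comparing resolutions with the Koszul complex\<close>

text \<open>
  A complex \<open>R = M\<^sub>0 \<leftarrow> M\<^sub>1 \<leftarrow> M\<^sub>2 \<leftarrow> \<dots>\<close> of graded free modules is given by the shifts \<open>s q\<close> of
  \<open>M\<^sub>q\<close> and the matrix \<open>D q\<close> of the differential \<open>M\<^sub>q\<^sub>+\<^sub>1 \<rightarrow> M\<^sub>q\<close>. It resolves \<open>R/I\<close>, so the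
  augmentation of a resolution of \<open>I\<close> becomes \<open>D 0\<close>.
\<close>

definition dmap :: "(nat \<Rightarrow> nat list) \<Rightarrow> ('v, 'k) differentials \<Rightarrow> nat \<Rightarrow> (nat \<Rightarrow> ('v, 'k) mpoly) \<Rightarrow> nat \<Rightarrow> ('v, 'k) mpoly" where
  "dmap s D q = mat_app (length (s q)) (length (s (Suc q))) (D q)"

text \<open>
  Membership in the submodule of \<open>M\<^sub>q\<close> that the next differential has to hit: a kernel for \<open>q > 0\<close>, but the
  ideal \<open>I\<close> for \<open>q = 0\<close>. With this convention exactness has the same form at all places.
\<close>

definition syz :: "('v \<Rightarrow> nat) set \<Rightarrow> (nat \<Rightarrow> nat list) \<Rightarrow> ('v, 'k) differentials \<Rightarrow> nat \<Rightarrow> (nat \<Rightarrow> ('v, 'k) mpoly) \<Rightarrow> bool" where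
  "syz U s D q v = (case q of 0 \<Rightarrow> v 0 \<in> mon_ideal U | Suc i \<Rightarrow> (\<forall>a. dmap s D i v a = 0))"

text \<open>
  Exactness is stated degree by degree because the zigzags stay in one internal degree; the offset \<open>e\<close> is the
  homological degree of the Koszul basis element that the vector multiplies.
\<close>

definition exact_at :: "('v \<Rightarrow> nat) set \<Rightarrow> (nat \<Rightarrow> nat list) \<Rightarrow> ('v, 'k) differentials \<Rightarrow> nat \<Rightarrow> bool" where
  "exact_at U s D q \<longleftrightarrow>
     (\<forall>a<length (s q). \<forall>b<length (s (Suc q)). D q a b \<in> homog (s q ! a) (s (Suc q) ! b)) \<and>
     (\<forall>e j. \<forall>w\<in>free_deg (s (Suc q)) e j. syz U s D q (dmap s D q w)) \<and>
     (\<forall>e j. \<forall>v\<in>free_deg (s q) e j. syz U s D q v \<longrightarrow> (\<exists>w\<in>free_deg (s (Suc q)) e j. \<forall>a. v a = dmap s D q w a))"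

lemma syz_0: "syz U s D 0 v \<longleftrightarrow> v 0 \<in> mon_ideal U" by (simp add: syz_def)
lemma syz_Suc: "syz U s D (Suc i) v \<longleftrightarrow> (\<forall>a. dmap s D i v a = 0)" by (simp add: syz_def)

lemma exact_at_lift:
  assumes "exact_at U s D q" "f \<in> koszul_ch p (s q) j" "\<And>S. syz U s D q (f S)"
  shows "\<exists>u\<in>koszul_ch p (s (Suc q)) j. \<forall>S a. f S a = dmap s D q (u S) a"
proof -
  have "\<exists>w. w \<in> free_deg (s (Suc q)) p j \<and> (\<forall>a. f S a = dmap s D q w a)" for S
  proof -
    have "f S \<in> free_deg (s q) p j" using assms(2) by (simp add: koszul_ch_def)
    then show ?thesis using assms(1,3) unfolding exact_at_def by meson
  qed
  then obtain u where u: "\<And>S. u S \<in> free_deg (s (Suc q)) p j" "\<And>S a. f S a = dmap s D q (u S) a" by metis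
  define u' where "u' S a = (if S \<subseteq> X \<and> card S = p then u S a else 0)" for S a
  have "u' \<in> koszul_ch p (s (Suc q)) j" using u(1) by (auto simp: koszul_ch_def u'_def free_deg_def)
  moreover have "f S a = dmap s D q (u' S) a" for S a
  proof (cases "S \<subseteq> X \<and> card S = p")
    case True
    then have "u' S = u S" by (simp add: u'_def fun_eq_iff)
    then show ?thesis using u(2) by simp
  next
    case False
    then have "f S a = 0" using assms(2) unfolding koszul_ch_def by blast
    moreover have "u' S = (\<lambda>_. 0)" using False by (auto simp: u'_def fun_eq_iff)
    ultimately show ?thesis by (simp add: dmap_def)
  qed
  ultimately show ?thesis by blast
qed

lemma dmap_koszul_ch: "exact_at U s D q \<Longrightarrow> w \<in> koszul_ch p (s (Suc q)) j \<Longrightarrow> (\<lambda>S. dmap s D q (w S)) \<in> koszul_ch p (s q) j"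
  unfolding dmap_def by (rule mat_app_koszul_ch) (auto simp: exact_at_def)

lemma bdrym_dmap: "bdrym (\<lambda>S. dmap s D q (f S)) T = dmap s D q (bdrym f T)"
  unfolding dmap_def by (rule bdrym_mat_app)

lemma dmap_diff: "dmap s D q (\<lambda>a. v a - w a) a = dmap s D q v a - dmap s D q w a"
  unfolding dmap_def by (rule mat_app_diff)

text \<open>
  For \<open>i = 0\<close>, vanishing of \<open>H\<^sub>n(R/I)\<^sub>j\<close> turns a cycle modulo \<open>I\<close> into a boundary modulo \<open>I\<close>, and
  subtracting this boundary leaves a chain with entries in \<open>I\<close>. For larger \<open>i\<close>, push \<open>w\<close> down the
  resolution, lift the result along the Koszul differential, apply the statement for the previous \<open>i\<close>, and
  lift back along the resolution.
\<close>

lemma zigzag_upward: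
  assumes s0: "s 0 = [0]" and HK: "koszul_zero U n j"
  shows "\<lbrakk>\<And>q. q < i \<Longrightarrow> exact_at U s D q; p + i = n; p \<ge> 1; w \<in> koszul_ch p (s i) j; \<And>T. syz U s D i (bdrym w T)\<rbrakk>
    \<Longrightarrow> \<exists>y\<in>koszul_ch p (s i) j. (\<forall>S. syz U s D i (y S)) \<and> (\<forall>T a. bdrym y T a = bdrym w T a)"
proof (induction i arbitrary: p w)
  case 0
  then obtain g where g: "g \<in> koszul_ch (Suc p) [0] j" "\<And>S. w S 0 - bdrym g S 0 \<in> mon_ideal U"
    using HK unfolding koszul_zero_def s0 by (auto simp: syz_0)
  show ?case
  proof (intro bexI conjI allI)
    show "(\<lambda>S a. w S a - bdrym g S a) \<in> koszul_ch p (s 0) j"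
      using 0 bdrym_koszul_ch[OF g(1)] by (auto simp: s0 intro: koszul_ch_diff)
    show "syz U s D 0 (\<lambda>a. w S a - bdrym g S a)" for S using g by (simp add: syz_0)
    show "bdrym (\<lambda>S a. w S a - bdrym g S a) T a = bdrym w T a" for T a by (simp add: bdrym_diff bdrym_bdrym)
  qed
next
  case (Suc i)
  have ex: "exact_at U s D i" using Suc.prems by simp
  let ?dw = "\<lambda>S. dmap s D i (w S)"
  have dw: "?dw \<in> koszul_ch p (s i) j" using dmap_koszul_ch[OF ex] Suc.prems by blast
  have "bdrym ?dw T a = 0" for T a
    using Suc.prems(5)[of T] by (simp add: bdrym_dmap syz_Suc)
  then obtain w' where w': "w' \<in> koszul_ch (Suc p) (s i) j" "\<And>S a. dmap s D i (w S) a = bdrym w' S a"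
    using koszul_exact[OF dw] Suc.prems by auto
  have "syz U s D i (bdrym w' T)" for T
  proof -
    have "w T \<in> free_deg (s (Suc i)) p j" using Suc.prems by (simp add: koszul_ch_def)
    then have "syz U s D i (dmap s D i (w T))" using ex by (auto simp: exact_at_def)
    moreover have "dmap s D i (w T) = bdrym w' T" using w' by blast
    ultimately show ?thesis by simp
  qed
  then obtain y' where y': "y' \<in> koszul_ch (Suc p) (s i) j" "\<And>S. syz U s D i (y' S)" "\<And>T a. bdrym y' T a = bdrym w' T a"
    using Suc.IH[of "Suc p" w'] Suc.prems w' by auto
  obtain u where u: "u \<in> koszul_ch (Suc p) (s (Suc i)) j" "\<And>S a. y' S a = dmap s D i (u S) a"
    using exact_at_lift[OF ex y'(1,2)] by blast
  have eq: "dmap s D i (bdrym u T) a = dmap s D i (w T) a" for T a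
  proof -
    have "dmap s D i (bdrym u T) a = bdrym (\<lambda>S. dmap s D i (u S)) T a" by (simp add: bdrym_dmap)
    also have "\<dots> = bdrym y' T a" using u(2) by (intro bdrym_cong) simp
    finally show ?thesis using y'(3) w'(2) by simp
  qed
  show ?case
  proof (intro bexI conjI allI)
    show "(\<lambda>S a. w S a - bdrym u S a) \<in> koszul_ch p (s (Suc i)) j"
      using Suc.prems bdrym_koszul_ch[OF u(1)] by (auto intro: koszul_ch_diff)
    show "syz U s D (Suc i) (\<lambda>a. w S a - bdrym u S a)" for S by (simp add: syz_Suc dmap_diff eq)
    show "bdrym (\<lambda>S a. w S a - bdrym u S a) T a = bdrym w T a" for T a by (simp add: bdrym_diff bdrym_bdrym)
  qed
qed

text \<open>
  The same walk through the double complex in the other direction. It ends in \<open>M\<^sub>n\<close>, where a chain of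
  degree \<open>j\<close> with \<open>p = 0\<close> has no constant coefficients because \<open>j\<close> is not a shift, and is therefore a Koszul
  boundary.
\<close>

lemma zigzag_downward:
  assumes ex: "\<And>q. q < n \<Longrightarrow> exact_at U s D q" and nj: "j \<notin> set (s n)"
    and "i \<le> n" "p + i = n" "w \<in> koszul_ch p (s i) j" "\<And>T. syz U s D i (bdrym w T)"
  shows "\<exists>g\<in>koszul_ch (Suc p) (s i) j. \<forall>S. syz U s D i (\<lambda>a. w S a - bdrym g S a)"
  using assms(3-)
proof (induction p arbitrary: i w)
  case 0
  then have i: "i = n" by simp
  have "lookup (w {} a) 0 = 0" for a
  proof (rule ccontr)
    assume a: "lookup (w {} a) 0 \<noteq> 0"
    then have "0 \<in> keys (w {} a)" "w {} a \<noteq> 0" by (auto simp: in_keys_iff)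
    moreover from this(2) have "a < length (s i)" using 0 unfolding koszul_ch_def free_deg_def by blast
    moreover from this have "w {} a \<in> homog (s i ! a) j" using 0 by (simp add: koszul_ch_def free_deg_def)
    ultimately have "s n ! a = j" using i by (auto simp: homog_def)
    then show False using nj \<open>a < length (s i)\<close> i by auto
  qed
  then obtain g where g: "g \<in> koszul_ch (Suc 0) (s i) j" "\<And>S a. w S a = bdrym g S a"
    using koszul_exact[OF 0(3) bdrym_koszul_ch_0[OF 0(3)]] by auto
  have "syz U s D i (\<lambda>_. 0)" by (cases i) (simp_all add: syz_0 syz_Suc dmap_def)
  then have "syz U s D i (\<lambda>a. w S a - bdrym g S a)" for S using g by simp
  then show ?case using g by blast
next
  case (Suc p)
  then have exi: "exact_at U s D i" using ex by simp
  have bw: "bdrym w \<in> koszul_ch p (s i) j" using bdrym_koszul_ch Suc.prems by blast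
  obtain u where u: "u \<in> koszul_ch p (s (Suc i)) j" "\<And>S a. bdrym w S a = dmap s D i (u S) a"
    using exact_at_lift[OF exi bw] Suc.prems by blast
  have Zu: "syz U s D (Suc i) (bdrym u T)" for T
  proof -
    have "dmap s D i (bdrym u T) a = bdrym (\<lambda>S. dmap s D i (u S)) T a" for a by (simp add: bdrym_dmap)
    also have "\<dots> a = bdrym (bdrym w) T a" for a using u(2) by (intro bdrym_cong) simp
    finally show ?thesis by (simp add: syz_Suc bdrym_bdrym)
  qed
  obtain g' where g': "g' \<in> koszul_ch (Suc p) (s (Suc i)) j" "\<And>S. syz U s D (Suc i) (\<lambda>a. u S a - bdrym g' S a)"
    using Suc.IH[of "Suc i" u] Suc.prems u Zu by auto
  define f where "f = (\<lambda>S a. w S a - dmap s D i (g' S) a)"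
  have f: "f \<in> koszul_ch (Suc p) (s i) j"
    unfolding f_def using Suc.prems dmap_koszul_ch[OF exi g'(1)] by (auto intro: koszul_ch_diff)
  have "bdrym f T a = 0" for T a
  proof -
    have "bdrym f T a = bdrym w T a - dmap s D i (bdrym g' T) a"
      unfolding f_def by (simp add: bdrym_diff bdrym_dmap)
    also have "\<dots> = dmap s D i (\<lambda>a. u T a - bdrym g' T a) a" using u(2) by (simp add: dmap_diff)
    also have "\<dots> = 0" using g'(2) by (simp add: syz_Suc)
    finally show ?thesis .
  qed
  then obtain g where g: "g \<in> koszul_ch (Suc (Suc p)) (s i) j" "\<And>S a. f S a = bdrym g S a"
    using koszul_exact[OF f] by auto
  have "syz U s D i (\<lambda>a. w S a - bdrym g S a)" for S
  proof -
    have "(\<lambda>a. w S a - bdrym g S a) = dmap s D i (g' S)"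
      unfolding g(2)[symmetric] f_def by simp
    moreover have "g' S \<in> free_deg (s (Suc i)) (Suc p) j" using g' by (simp add: koszul_ch_def)
    ultimately show ?thesis using exi unfolding exact_at_def by metis
  qed
  then show ?case using g by blast
qed

end

section \<open>Homogeneous parts and spans\<close>

definition terms_in :: "('a \<Rightarrow> bool) \<Rightarrow> ('a \<Rightarrow>\<^sub>0 'b::zero) \<Rightarrow> 'a \<Rightarrow>\<^sub>0 'b" where
  "terms_in P p = Poly_Mapping.mapp (\<lambda>m c. c when P m) p"

lemma lookup_terms_in: "lookup (terms_in P p) m = (lookup p m when P m)"
  by (auto simp: terms_in_def lookup_mapp when_def in_keys_iff)

lemma keys_terms_in: "keys (terms_in P p) = {m\<in>keys p. P m}"
  by (auto simp: in_keys_iff lookup_terms_in)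

lemma terms_in_eq_self: "(\<And>m. m \<in> keys p \<Longrightarrow> P m) \<Longrightarrow> terms_in P p = p"
  by (intro poly_mapping_eqI) (auto simp: lookup_terms_in when_def in_keys_iff)

lemma terms_in_eq_zero: "(\<And>m. m \<in> keys p \<Longrightarrow> \<not> P m) \<Longrightarrow> terms_in P p = 0"
  by (intro poly_mapping_eqI) (auto simp: lookup_terms_in when_def in_keys_iff)

lemma terms_in_add: "terms_in P (p + q) = terms_in P p + terms_in P (q :: 'a \<Rightarrow>\<^sub>0 'b::comm_monoid_add)"
  by (intro poly_mapping_eqI) (auto simp: lookup_terms_in lookup_add when_def)

lemma terms_in_zero [simp]: "terms_in P 0 = 0"
  by (intro poly_mapping_eqI) (auto simp: lookup_terms_in)

lemma terms_in_sum: "terms_in P (sum f B) = (\<Sum>b\<in>B. terms_in P (f b :: 'a \<Rightarrow>\<^sub>0 'b::comm_monoid_add))"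
  by (induction B rule: infinite_finite_induct) (auto simp: terms_in_add)

lemma terms_in_split: "terms_in P p + terms_in (\<lambda>m. \<not> P m) p = (p :: 'a \<Rightarrow>\<^sub>0 'b::comm_monoid_add)"
  by (intro poly_mapping_eqI) (auto simp: lookup_terms_in lookup_add when_def)

lemma terms_in_mult:
  fixes h p :: "'a::comm_monoid_add \<Rightarrow>\<^sub>0 'k::comm_ring_1"
  assumes "\<And>k m. k \<in> keys h \<Longrightarrow> P (k + m) \<longleftrightarrow> Q m"
  shows "terms_in P (h * p) = h * terms_in Q p"
proof -
  have "terms_in P (h * p) = terms_in P (h * terms_in Q p) + terms_in P (h * terms_in (\<lambda>m. \<not> Q m) p)"
    by (simp flip: terms_in_add distrib_left add: terms_in_split)
  also have "terms_in P (h * terms_in Q p) = h * terms_in Q p"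
    by (rule terms_in_eq_self) (auto simp: keys_terms_in assms elim!: keys_multE)
  also have "terms_in P (h * terms_in (\<lambda>m. \<not> Q m) p) = 0"
    by (rule terms_in_eq_zero) (auto simp: keys_terms_in assms elim!: keys_multE)
  finally show ?thesis by simp
qed

lemma sum_fun_apply: "(\<Sum>b\<in>B. f b) x = (\<Sum>b\<in>B. f b x :: 'b::comm_monoid_add)"
  by (induction B rule: infinite_finite_induct) simp_all

text \<open>
  Scalar multiplication by polynomials and by constants. The first gives generated submodules and the second
  finite dimension in each degree.
\<close>

definition pscale :: "('v,'k::field) mpoly \<Rightarrow> (nat \<Rightarrow> ('v,'k) mpoly) \<Rightarrow> nat \<Rightarrow> ('v,'k) mpoly" where
  "pscale p v = (\<lambda>a. p * v a)"

definition kscale :: "'k::field \<Rightarrow> (nat \<Rightarrow> ('v,'k) mpoly) \<Rightarrow> nat \<Rightarrow> ('v,'k) mpoly" where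
  "kscale c v = (\<lambda>a. single 0 c * v a)"

interpretation PM: Modules.module pscale
  by unfold_locales (auto simp: pscale_def fun_eq_iff algebra_simps)

interpretation KV: Vector_Spaces.vector_space kscale
  by unfold_locales (auto simp: kscale_def fun_eq_iff algebra_simps single_add mult_single simp flip: mult.assoc)

lemma kscale_eq_pscale: "kscale c v = pscale (single 0 c) v"
  by (simp add: kscale_def pscale_def)

context koszul
begin

lemma terms_in_homog [simp]: "terms_in (\<lambda>m. keys m \<subseteq> X \<and> mon_degree m + e = j) p \<in> homog e j"
  by (auto simp: homog_def keys_terms_in)

lemma terms_in_homog_self: "p \<in> homog e j \<Longrightarrow> terms_in (\<lambda>m. keys m \<subseteq> X \<and> mon_degree m + e = j) p = p"
  by (rule terms_in_eq_self) (auto simp: homog_def)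

lemma terms_in_homog_mult:
  assumes "h \<in> homog e' e"
  shows "terms_in (\<lambda>m. keys m \<subseteq> X \<and> mon_degree m + e' = j) (h * p)
    = h * terms_in (\<lambda>m. keys m \<subseteq> X \<and> mon_degree m + e = j) p"
  by (rule terms_in_mult) (use assms in \<open>auto simp: homog_def keys_add_nat mon_degree_add\<close>)

lemma free_deg_offset: "e \<le> j \<Longrightarrow> free_deg s e j = free_deg s 0 (j - e)"
proof -
  assume "e \<le> j"
  then have "homog (e + x) j = homog (0 + x) (j - e)" for x by (auto simp: homog_def)
  then show ?thesis by (simp add: free_deg_def)
qed

lemma free_deg_offset_zero: "\<not> e \<le> j \<Longrightarrow> v \<in> free_deg s e j \<Longrightarrow> v = (\<lambda>_. 0)"
proof
  fix a assume e: "\<not> e \<le> j" and v: "v \<in> free_deg s e j"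
  show "v a = 0"
  proof (rule ccontr)
    assume nz: "v a \<noteq> 0"
    then have "v a \<in> homog (e + s ! a) j" using v by (simp add: free_deg_def)
    moreover obtain m where "m \<in> keys (v a)" using nz by (metis ex_in_conv keys_eq_empty)
    ultimately show False using e by (auto simp: homog_def)
  qed
qed

lemma free_deg_kspan:
  "\<exists>Bs. finite Bs \<and> free_deg s 0 j \<subseteq> KV.span Bs"
proof -
  \<comment> \<open>The monomial vectors of degree \<open>j\<close> span.\<close>
  define e where "e a m = (\<lambda>a'. if a' = a then single m (1::'k) else 0)" for a :: nat and m :: "'v \<Rightarrow>\<^sub>0 nat"
  define Bs where "Bs = (\<Union>a<length s. e a ` {m. keys m \<subseteq> X \<and> mon_degree m + s ! a = j})"
  have "finite Bs" unfolding Bs_def using finite_mons by blast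
  moreover have "v \<in> KV.span Bs" if v: "v \<in> free_deg s 0 j" for v
  proof -
    have v_eq: "v = (\<Sum>a<length s. \<Sum>m\<in>keys (v a). kscale (lookup (v a) m) (e a m))"
    proof
      fix a'
      have "(\<Sum>a<length s. \<Sum>m\<in>keys (v a). kscale (lookup (v a) m) (e a m)) a'
        = (\<Sum>a<length s. if a = a' then \<Sum>m\<in>keys (v a). single m (lookup (v a) m) else 0)"
        unfolding sum_fun_apply
        by (rule sum.cong) (auto simp: kscale_def e_def mult_single)
      also have "\<dots> = v a'" using v by (auto simp: sum_single_keys free_deg_def)
      finally show "v a' = (\<Sum>a<length s. \<Sum>m\<in>keys (v a). kscale (lookup (v a) m) (e a m)) a'" ..
    qed
    have eB: "e a m \<in> Bs" if "a < length s" "m \<in> keys (v a)" for a m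
    proof -
      have "v a \<in> homog (s ! a) j" using that v by (simp add: free_deg_def)
      then have "m \<in> {m. keys m \<subseteq> X \<and> mon_degree m + s ! a = j}" using that by (simp add: homog_def)
      then show ?thesis using that unfolding Bs_def by blast
    qed
    have "(\<Sum>a<length s. \<Sum>m\<in>keys (v a). kscale (lookup (v a) m) (e a m)) \<in> KV.span Bs"
    proof (rule KV.span_sum, rule KV.span_sum)
      fix a m assume "a \<in> {..<length s}" "m \<in> keys (v a)"
      then show "kscale (lookup (v a) m) (e a m) \<in> KV.span Bs"
        using KV.span_scale[OF KV.span_base[OF eB[of a m]]] by simp
    qed
    then show ?thesis by (rule ssubst[OF v_eq])
  qed
  ultimately show ?thesis by blast
qed

definition submod :: "((nat \<Rightarrow> ('v,'k) mpoly) \<Rightarrow> bool) \<Rightarrow> bool" where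
  "submod N \<longleftrightarrow> PM.subspace {v. N v}"

text \<open>
  The homogeneous vectors of a given degree form a finite-dimensional vector space, so a basis of the part
  of the submodule in this degree is finite.
\<close>

lemma finite_generators_in_degree:
  "\<exists>S. finite S \<and> S \<subseteq> {z \<in> free_deg s 0 j. N z} \<and> {z \<in> free_deg s 0 j. N z} \<subseteq> PM.span S"
proof -
  let ?T = "{z \<in> free_deg s 0 j. N z}"
  obtain S where S: "S \<subseteq> ?T" "KV.independent S" "?T \<subseteq> KV.span S"
    using KV.maximal_independent_subset by blast
  obtain Bs where Bs: "finite Bs" "free_deg s 0 j \<subseteq> KV.span Bs" using free_deg_kspan by blast
  have "finite S"
    using KV.independent_span_bound[OF Bs(1) S(2)] S(1) Bs(2) by blast
  moreover have "KV.span S \<subseteq> PM.span S"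
  proof (rule KV.span_minimal)
    show "S \<subseteq> PM.span S" by (rule PM.span_superset)
    show "KV.subspace (PM.span S)"
      unfolding KV.subspace_def kscale_eq_pscale
      by (auto intro: PM.span_zero PM.span_add PM.span_scale)
  qed
  ultimately show ?thesis using S by blast
qed

section \<open>Existence of minimal resolutions\<close>

text \<open>
  By hypothesis the elements of degree above \<open>B\<close> are generated by elements of smaller degree, so bases in
  the degrees up to \<open>B\<close> generate. A generating set of least cardinality is minimal in the sense of resolutions: in a
  homogeneous relation a nonzero constant coefficient is a unit, and the generator it belongs to could be dropped.
\<close>

lemma minimal_generators:
  assumes N: "submod N"
    and red: "\<And>j z. \<lbrakk>j > B; z \<in> free_deg s 0 j; N z\<rbrakk> \<Longrightarrow>
      \<exists>y. (\<forall>x\<in>X. y x \<in> free_deg s 1 j \<and> N (y x)) \<and> z = (\<Sum>x\<in>X. pscale (variable x) (y x))"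
  shows "\<exists>t g. (\<forall>b<length t. g b \<in> free_deg s 0 (t ! b) \<and> N (g b)) \<and>
    (\<forall>j. \<forall>z\<in>free_deg s 0 j. N z \<longrightarrow> (\<exists>w\<in>free_deg t 0 j. z = (\<lambda>a. \<Sum>b<length t. g b a * w b))) \<and>
    (\<forall>j. \<forall>w\<in>free_deg t 0 j. (\<forall>a. (\<Sum>b<length t. g b a * w b) = 0) \<longrightarrow> (\<forall>b. lookup (w b) 0 = 0))"
proof -
  define P where "P G \<longleftrightarrow> finite G \<and> (\<forall>g\<in>G. \<exists>j. g \<in> free_deg s 0 j \<and> N g) \<and> (\<forall>j. {z \<in> free_deg s 0 j. N z} \<subseteq> PM.span G)" for G
  have "\<exists>G. P G"
  proof -
    have "\<forall>j. \<exists>S. finite S \<and> S \<subseteq> {z \<in> free_deg s 0 j. N z} \<and> {z \<in> free_deg s 0 j. N z} \<subseteq> PM.span S"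
      using finite_generators_in_degree by (rule allI)
    from choice[OF this] obtain S where
      S': "\<forall>j. finite (S j) \<and> S j \<subseteq> {z \<in> free_deg s 0 j. N z} \<and> {z \<in> free_deg s 0 j. N z} \<subseteq> PM.span (S j)" ..
    have S: "finite (S j)" "S j \<subseteq> {z \<in> free_deg s 0 j. N z}" "{z \<in> free_deg s 0 j. N z} \<subseteq> PM.span (S j)" for j
      using S'[rule_format, of j] by simp_all
    define G where "G = (\<Union>j\<le>B. S j)"
    have "{z \<in> free_deg s 0 j. N z} \<subseteq> PM.span G" for j
    proof (induction j rule: less_induct)
      case (less j)
      show ?case
      proof (cases "j \<le> B")
        case True
        then have "S j \<subseteq> G" by (auto simp: G_def)
        then show ?thesis using S(3)[of j] PM.span_mono by blast
      next
        case False
        show ?thesis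
        proof clarify
          fix z assume "z \<in> free_deg s 0 j" "N z"
          then obtain y where y: "\<And>x. x \<in> X \<Longrightarrow> y x \<in> free_deg s 1 j" "\<And>x. x \<in> X \<Longrightarrow> N (y x)"
            and z: "z = (\<Sum>x\<in>X. pscale (variable x) (y x))"
            using red[of j z] False by auto
          have "y x \<in> PM.span G" if "x \<in> X" for x
            using less.IH[of "j - 1"] False y[OF that] free_deg_offset[of 1 j s] by auto
          then show "z \<in> PM.span G" unfolding z by (auto intro: PM.span_sum PM.span_scale)
        qed
      qed
    qed
    moreover have "finite G" "\<forall>g\<in>G. \<exists>j. g \<in> free_deg s 0 j \<and> N g" using S by (auto simp: G_def)
    ultimately show ?thesis unfolding P_def by blast
  qed
  then obtain G where G: "P G" and G_min: "\<And>G'. P G' \<Longrightarrow> card G \<le> card G'"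
    using ex_has_least_nat[of P _ card] by metis
  have finG: "finite G" using G by (simp add: P_def)
  obtain gl where gl: "set gl = G" "distinct gl" using finite_distinct_list[OF finG] by blast
  have "\<forall>g\<in>G. \<exists>j. g \<in> free_deg s 0 j \<and> N g" using G by (simp add: P_def)
  from bchoice[OF this] obtain tt where "\<forall>g\<in>G. g \<in> free_deg s 0 (tt g) \<and> N g" ..
  then have tt: "g \<in> free_deg s 0 (tt g) \<and> N g" if "g \<in> G" for g using that by simp
  define t where "t = map tt gl"
  define g where "g b = gl ! b" for b
  have len: "length t = length gl" by (simp add: t_def)
  have g: "g b \<in> free_deg s 0 (t ! b) \<and> N (g b)" "g b \<in> G" if "b < length t" for b
    using that tt gl(1) by (auto simp: t_def g_def)
  have sumG: "(\<Sum>v\<in>G. F v) = (\<Sum>b<length t. F (g b))" for F :: "_ \<Rightarrow> nat \<Rightarrow> ('v,'k) mpoly"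
    unfolding g_def using sum.reindex_bij_betw[OF bij_betw_nth[OF gl(2) refl gl(1)[symmetric]], of F] len by simp
  have multiples: "\<exists>w\<in>free_deg t 0 j. z = (\<lambda>a. \<Sum>b<length t. g b a * w b)" if z: "z \<in> free_deg s 0 j" "N z" for z j
  proof -
    have "{z \<in> free_deg s 0 j. N z} \<subseteq> PM.span G" using G by (simp add: P_def)
    then have "z \<in> PM.span G" using z by blast
    then obtain u where "z = (\<Sum>v\<in>G. pscale (u v) v)"
      unfolding PM.span_finite[OF finG] by blast
    then have zu: "z = (\<Sum>b<length t. pscale (u (g b)) (g b))" by (simp add: sumG)
    define w where "w b = (if b < length t then terms_in (\<lambda>m. keys m \<subseteq> X \<and> mon_degree m + t ! b = j) (u (g b)) else 0)" for b
    have "w \<in> free_deg t 0 j" by (auto simp: free_deg_def w_def)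
    moreover have "z a = (\<Sum>b<length t. g b a * w b)" for a
    proof (cases "a < length s")
      case False
      then have "z a = 0" "\<And>b. b < length t \<Longrightarrow> g b a = 0" using z g unfolding free_deg_def by blast+
      then show ?thesis by simp
    next
      case True
      let ?P = "\<lambda>m. keys m \<subseteq> X \<and> mon_degree m + s ! a = j"
      have za: "z a = (\<Sum>b<length t. g b a * u (g b))"
        unfolding zu by (simp add: sum_fun_apply pscale_def mult.commute)
      have "z a = terms_in ?P (z a)" using z True by (simp add: terms_in_homog_self free_deg_def)
      also have "\<dots> = terms_in ?P (\<Sum>b<length t. g b a * u (g b))" by (rule arg_cong[OF za])
      also have "\<dots> = (\<Sum>b<length t. g b a * w b)"
        unfolding terms_in_sum
      proof (rule sum.cong, simp)
        fix b assume b: "b \<in> {..<length t}"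
        then have "g b a \<in> homog (s ! a) (t ! b)" using g[of b] True by (simp add: free_deg_def)
        then show "terms_in ?P (g b a * u (g b)) = g b a * w b"
          using b by (simp add: terms_in_homog_mult w_def)
      qed
      finally show ?thesis .
    qed
    ultimately show ?thesis by blast
  qed
  have minimal: "lookup (w b) 0 = 0" if w: "w \<in> free_deg t 0 j" and rel: "\<And>a. (\<Sum>b<length t. g b a * w b) = 0" for w j b
  proof (rule ccontr)
    assume nz: "lookup (w b) 0 \<noteq> 0"
    then have "w b \<noteq> 0" by auto
    then have b: "b < length t" using w by (simp add: free_deg_def)
    then have wb: "w b \<in> homog (t ! b) j" using w by (simp add: free_deg_def)
    moreover have "0 \<in> keys (w b)" using nz by (simp add: in_keys_iff)
    ultimately have "t ! b = j" by (auto simp: homog_def)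
    then have key0: "m = 0" if "m \<in> keys (w b)" for m
      using wb that by (auto simp: homog_def simp flip: mon_degree_eq_0_iff)
    define c where "c = lookup (w b) 0"
    have wc: "w b = single 0 c"
      using key0 by (intro poly_mapping_eqI) (auto simp: c_def lookup_single when_def in_keys_iff)
    have c: "c \<noteq> 0" using nz by (simp add: c_def)
    let ?R = "{..<length t} - {b}"
    have "g b a = (\<Sum>b'\<in>?R. pscale (- single 0 (inverse c) * w b') (g b')) a" for a
    proof -
      have "0 = g b a * w b + (\<Sum>b'\<in>?R. g b' a * w b')"
        using rel[of a] b by (subst (asm) sum.remove[of _ b]) auto
      then have "g b a * w b = - (\<Sum>b'\<in>?R. g b' a * w b')"
        by (rule eq_neg_iff_add_eq_0[THEN iffD2, OF sym])
      then have "g b a * single 0 c = - (\<Sum>b'\<in>?R. g b' a * w b')"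
        by (simp only: wc)
      moreover have "single 0 (inverse c) * single 0 c = (1 :: ('v,'k) mpoly)" using c by (simp add: mult_single)
      then have "g b a = single 0 (inverse c) * (g b a * single 0 c)"
        by (metis mult.assoc mult.commute mult_1)
      ultimately have "g b a = single 0 (inverse c) * - (\<Sum>b'\<in>?R. g b' a * w b')" by metis
      also have "\<dots> = (\<Sum>b'\<in>?R. pscale (- single 0 (inverse c) * w b') (g b')) a"
        by (simp add: sum_fun_apply pscale_def sum_distrib_left sum_negf mult_ac)
      finally show ?thesis .
    qed
    then have g_eq: "g b = (\<Sum>b'\<in>?R. pscale (- single 0 (inverse c) * w b') (g b'))" by blast
    have gR: "g b' \<in> G - {g b}" if "b' \<in> ?R" for b'
      using that g(2) b gl(2) len by (auto simp: g_def nth_eq_iff_index_eq)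
    have "(\<Sum>b'\<in>?R. pscale (- single 0 (inverse c) * w b') (g b')) \<in> PM.span (G - {g b})"
      by (rule PM.span_sum) (rule PM.span_scale[OF PM.span_base[OF gR]])
    then have sp: "g b \<in> PM.span (G - {g b})" using g_eq by metis
    have "G \<subseteq> PM.span (G - {g b})"
      using sp PM.span_superset[of "G - {g b}"] by blast
    then have "PM.span G \<subseteq> PM.span (G - {g b})" by (rule PM.span_minimal) (rule PM.subspace_span)
    then have "P (G - {g b})" using G subset_trans[of _ "PM.span G" "PM.span (G - {g b})"]
      unfolding P_def by simp
    then have "card G \<le> card (G - {g b})" by (rule G_min)
    moreover have "card (G - {g b}) < card G" using finG g(2)[OF b] by (rule card_Diff1_less)
    ultimately show False by simp
  qed
  show ?thesis
    by (intro exI[of _ t] exI[of _ g] conjI allI ballI impI g minimal multiples) auto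
qed

text \<open>
  The syzygies at \<open>q\<close> lie in \<open>\<mm> M\<^sub>q\<close>. For \<open>q > 0\<close> these are the relations between the columns of \<open>D (q - 1)\<close>.
\<close>

definition minimal_at :: "('v \<Rightarrow> nat) set \<Rightarrow> (nat \<Rightarrow> nat list) \<Rightarrow> ('v, 'k) differentials \<Rightarrow> nat \<Rightarrow> bool" where
  "minimal_at U s D q \<longleftrightarrow> (\<forall>j. \<forall>z\<in>free_deg (s q) 0 j. syz U s D q z \<longrightarrow> (\<forall>a. lookup (z a) 0 = 0))"

lemma submod_syz: "upset U \<Longrightarrow> submod (syz U s D q)"
  unfolding submod_def PM.subspace_def
proof (cases q)
  case 0
  assume "upset U"
  then show "0 \<in> {v. syz U s D q v} \<and> (\<forall>x\<in>{v. syz U s D q v}. \<forall>y\<in>{v. syz U s D q v}. x + y \<in> {v. syz U s D q v}) \<and>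
    (\<forall>c. \<forall>x\<in>{v. syz U s D q v}. pscale c x \<in> {v. syz U s D q v})"
    using 0 by (simp add: syz_0 pscale_def mon_ideal_add mon_ideal_mult)
next
  case (Suc i)
  have "dmap s D i (x + y) a = dmap s D i x a + dmap s D i y a" for x y a
    by (simp add: dmap_def mat_app_def algebra_simps sum.distrib)
  moreover have "dmap s D i (pscale c x) a = c * dmap s D i x a" for x c a
    by (simp add: dmap_def mat_app_def pscale_def algebra_simps sum_distrib_left)
  moreover have "dmap s D i 0 a = 0" for a
    by (simp add: dmap_def mat_app_def)
  ultimately show "0 \<in> {v. syz U s D q v} \<and> (\<forall>x\<in>{v. syz U s D q v}. \<forall>y\<in>{v. syz U s D q v}. x + y \<in> {v. syz U s D q v}) \<and>
    (\<forall>c. \<forall>x\<in>{v. syz U s D q v}. pscale c x \<in> {v. syz U s D q v})"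
    using Suc by (simp add: syz_Suc)
qed

text \<open>
  A syzygy \<open>z\<close> in \<open>\<mm> M\<^sub>q\<close> is the Koszul boundary of some \<open>w\<close> with entries in \<open>M\<^sub>q\<close>; by \<open>zigzag_upward\<close>, \<open>w\<close>
  can be replaced by a chain whose entries are syzygies.
\<close>

lemma syz_in_max_ideal_times_syz:
  assumes s0: "s 0 = [0]" and HK: "koszul_zero U (Suc q) j" and ex: "\<And>i. i < q \<Longrightarrow> exact_at U s D i"
    and z: "z \<in> free_deg (s q) 0 j" "syz U s D q z" "\<And>a. lookup (z a) 0 = 0"
  shows "\<exists>y. (\<forall>x\<in>X. y x \<in> free_deg (s q) 1 j \<and> syz U s D q (y x)) \<and> z = (\<Sum>x\<in>X. pscale (variable x) (y x))"
proof -
  define f where "f S a = (if S = {} then z a else 0)" for S :: "'v set" and a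
  have f: "f \<in> koszul_ch 0 (s q) j" using z(1) by (auto simp: f_def koszul_ch_def free_deg_def)
  obtain w where w: "w \<in> koszul_ch (Suc 0) (s q) j" "\<And>S a. f S a = bdrym w S a"
    using koszul_exact[OF f bdrym_koszul_ch_0[OF f]] z(3) by (auto simp: f_def)
  have zero: "syz U s D q (\<lambda>_. 0)" by (cases q) (simp_all add: syz_0 syz_Suc dmap_def)
  have "syz U s D q (bdrym w T)" for T
  proof -
    have "bdrym w T = f T" using w(2)[of T] by (simp add: fun_eq_iff)
    also have "\<dots> = (if T = {} then z else (\<lambda>_. 0))" by (simp add: f_def fun_eq_iff)
    finally show ?thesis using z(2) zero by simp
  qed
  then obtain y where y: "y \<in> koszul_ch 1 (s q) j" "\<And>S. syz U s D q (y S)" "\<And>T a. bdrym y T a = bdrym w T a"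
    using zigzag_upward[of s U "Suc q" j q D 1 w] s0 HK ex w(1) by auto
  have "z = (\<Sum>x\<in>X. pscale (variable x) (y {x}))"
  proof
    fix a
    have "z a = bdrym y {} a" using w(2)[of "{}" a] y(3) by (simp add: f_def)
    also have "\<dots> = (\<Sum>x\<in>X. pscale (variable x) (y {x})) a"
      by (simp add: bdrym_def bdry_def ksgn_def sum_fun_apply pscale_def)
    finally show "z a = (\<Sum>x\<in>X. pscale (variable x) (y {x})) a" .
  qed
  moreover have "y {x} \<in> free_deg (s q) 1 j" for x using y(1) by (simp add: koszul_ch_def)
  ultimately show ?thesis using y(2) by (intro exI[of _ "\<lambda>x. y {x}"]) simp
qed

lemma resolution_step:
  assumes up: "upset U" and reg_le: "reg_le U B" and s0: "s 0 = [0]"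
    and ex: "\<And>i. i < q \<Longrightarrow> exact_at U s D i" and min: "minimal_at U s D q"
  shows "\<exists>t M. exact_at U (s(Suc q := t)) (D(q := M)) q \<and> minimal_at U (s(Suc q := t)) (D(q := M)) (Suc q)"
proof -
  have red: "\<exists>y. (\<forall>x\<in>X. y x \<in> free_deg (s q) 1 j \<and> syz U s D q (y x)) \<and> z = (\<Sum>x\<in>X. pscale (variable x) (y x))"
    if "j > B + Suc q" "z \<in> free_deg (s q) 0 j" "syz U s D q z" for j z
    using that min by (intro syz_in_max_ideal_times_syz s0 ex koszul_zero_of_reg_le[OF up reg_le]) (auto simp: minimal_at_def)
  have "\<exists>t g. (\<forall>b<length t. g b \<in> free_deg (s q) 0 (t ! b) \<and> syz U s D q (g b)) \<and>
    (\<forall>j. \<forall>z\<in>free_deg (s q) 0 j. syz U s D q z \<longrightarrow> (\<exists>w\<in>free_deg t 0 j. z = (\<lambda>a. \<Sum>b<length t. g b a * w b))) \<and>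
    (\<forall>j. \<forall>w\<in>free_deg t 0 j. (\<forall>a. (\<Sum>b<length t. g b a * w b) = 0) \<longrightarrow> (\<forall>b. lookup (w b) 0 = 0))"
    by (rule minimal_generators[OF submod_syz[OF up]]) (rule red)
  then obtain t g where G: "\<forall>b<length t. g b \<in> free_deg (s q) 0 (t ! b) \<and> syz U s D q (g b)"
    "\<forall>j. \<forall>z\<in>free_deg (s q) 0 j. syz U s D q z \<longrightarrow> (\<exists>w\<in>free_deg t 0 j. z = (\<lambda>a. \<Sum>b<length t. g b a * w b))"
    "\<forall>j. \<forall>w\<in>free_deg t 0 j. (\<forall>a. (\<Sum>b<length t. g b a * w b) = 0) \<longrightarrow> (\<forall>b. lookup (w b) 0 = 0)"
    by (elim exE conjE)
  have g: "g b \<in> free_deg (s q) 0 (t ! b)" "syz U s D q (g b)" if "b < length t" for b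
    using G(1) that by simp_all
  have multiples: "\<exists>w\<in>free_deg t 0 j. z = (\<lambda>a. \<Sum>b<length t. g b a * w b)" if "z \<in> free_deg (s q) 0 j" "syz U s D q z" for j z
    using G(2) that by simp
  have mini: "lookup (w b) 0 = 0" if "w \<in> free_deg t 0 j" "\<And>a. (\<Sum>b<length t. g b a * w b) = 0" for j w b
    using G(3) that by simp
  define M where "M a b = g b a" for a b
  define s' where "s' = s(Suc q := t)"
  define D' where "D' = D(q := M)"
  have Zq: "syz U s' D' q = syz U s D q"
    by (rule ext) (cases q; simp add: syz_def s'_def D'_def dmap_def)
  have s'q: "s' q = s q" "s' (Suc q) = t" by (simp_all add: s'_def)
  have dmap_sum: "dmap s' D' q w = (\<lambda>a. \<Sum>b<length t. g b a * w b)" for w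
  proof
    fix a
    have "g b a = 0" if "\<not> a < length (s q)" "b < length t" for b
      using g(1)[OF that(2)] that(1) unfolding free_deg_def by blast
    then show "dmap s' D' q w a = (\<Sum>b<length t. g b a * w b)"
      by (simp add: dmap_def mat_app_def s'q D'_def M_def)
  qed
  have sum_eq: "(\<lambda>a. \<Sum>b<length t. g b a * w b) = (\<Sum>b<length t. pscale (w b) (g b))" for w
    by (auto simp: fun_eq_iff sum_fun_apply pscale_def mult.commute)
  have "exact_at U s' D' q"
    unfolding exact_at_def s'q Zq dmap_sum
  proof (intro conjI allI impI ballI)
    fix a b assume "a < length (s q)" "b < length t"
    then show "D' q a b \<in> homog (s q ! a) (t ! b)" using g(1)[of b] by (simp add: D'_def M_def free_deg_def)
  next
    fix w
    have sub: "PM.subspace {v. syz U s D q v}" using submod_syz[OF up] by (simp add: submod_def)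
    have "(\<Sum>b<length t. pscale (w b) (g b)) \<in> {v. syz U s D q v}"
      by (intro PM.subspace_sum[OF sub] PM.subspace_scale[OF sub]) (simp add: g(2))
    then show "syz U s D q (\<lambda>a. \<Sum>b<length t. g b a * w b)" unfolding sum_eq by simp
  next
    fix e j v assume v: "v \<in> free_deg (s q) e j" "syz U s D q v"
    show "\<exists>w\<in>free_deg t e j. \<forall>a. v a = (\<Sum>b<length t. g b a * w b)"
    proof (cases "e \<le> j")
      case True
      have "\<exists>w\<in>free_deg t 0 (j - e). v = (\<lambda>a. \<Sum>b<length t. g b a * w b)"
        using multiples v unfolding free_deg_offset[OF True] by simp
      then obtain w where w: "w \<in> free_deg t 0 (j - e)" "v = (\<lambda>a. \<Sum>b<length t. g b a * w b)" ..
      show ?thesis unfolding free_deg_offset[OF True]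
        by (rule bexI[OF _ w(1)]) (rule allI, rule fun_cong[OF w(2)])
    next
      case False
      then show ?thesis using free_deg_offset_zero[OF False v(1)] by (intro bexI[of _ "\<lambda>_. 0"]) simp_all
    qed
  qed
  moreover have "minimal_at U s' D' (Suc q)"
    unfolding minimal_at_def s'q syz_Suc dmap_sum
    by (intro allI ballI impI) (erule mini, erule spec)
  ultimately show ?thesis unfolding s'_def D'_def by blast
qed

lemma exact_at_cong:
  assumes "\<And>i. i \<le> Suc q \<Longrightarrow> s i = s' i" "\<And>i. i \<le> q \<Longrightarrow> D i = D' i" "exact_at U s D q"
  shows "exact_at U s' D' q"
proof -
  have "syz U s D q = syz U s' D' q"
  proof (cases q)
    case (Suc i)
    then have "s i = s' i" "s q = s' q" "D i = D' i" using assms(1)[of i] assms(1)[of q] assms(2)[of i] by simp_all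
    then show ?thesis using Suc by (intro ext) (simp add: syz_def dmap_def)
  qed (simp add: syz_def fun_eq_iff)
  moreover have "dmap s D q = dmap s' D' q" using assms(1,2) by (simp add: dmap_def)
  ultimately show ?thesis using assms unfolding exact_at_def by simp
qed

lemma minimal_at_cong:
  assumes "\<And>i. i \<le> q \<Longrightarrow> s i = s' i" "\<And>i. i < q \<Longrightarrow> D i = D' i" "minimal_at U s D q"
  shows "minimal_at U s' D' q"
proof -
  have "syz U s D q = syz U s' D' q"
  proof (cases q)
    case (Suc i)
    then have "s i = s' i" "s q = s' q" "D i = D' i" using assms(1)[of i] assms(1)[of q] assms(2)[of i] by simp_all
    then show ?thesis using Suc by (intro ext) (simp add: syz_def dmap_def)
  qed (simp add: syz_def fun_eq_iff)
  then show ?thesis using assms unfolding minimal_at_def by simp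
qed

text \<open>
  The steps are chosen one after the other. Each choice changes the shifts and the matrix at a single index, so the
  states agree on ever longer initial segments and have a limit.
\<close>

lemma minimal_resolution_exists:
  assumes up: "upset U" and reg_le: "reg_le U B" and U0: "(\<lambda>_. 0) \<notin> U"
  shows "\<exists>s D. s 0 = [0] \<and> (\<forall>q. exact_at U s D q \<and> minimal_at U s D q)"
proof -
  define P where "P n sD \<longleftrightarrow> (case sD of (s, D) \<Rightarrow>
    s 0 = [0] \<and> (\<forall>i<n. exact_at U s D i) \<and> minimal_at U s D n)"
    for n :: nat and sD :: "(nat \<Rightarrow> nat list) \<times> ('v, 'k) differentials"
  \<comment> \<open>Step \<open>n\<close> may change the shifts above \<open>n\<close> and the matrices from \<open>n\<close> on.\<close>
  define Q where "Q n sD sD' \<longleftrightarrow> (\<forall>i\<le>n. fst sD i = fst sD' i) \<and> (\<forall>i<n. snd sD i = snd sD' i)"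
    for n :: nat and sD sD' :: "(nat \<Rightarrow> nat list) \<times> ('v, 'k) differentials"
  have "\<exists>f. \<forall>n. P n (f n) \<and> Q n (f n) (f (Suc n))"
  proof (rule dependent_nat_choice)
    have "lookup (z a) 0 = 0" if "z \<in> free_deg [0] 0 j" "z 0 \<in> mon_ideal U" for z j a
    proof (cases "a = 0")
      case True
      have "lookup 0 \<notin> U" using U0 by (metis (no_types) lookup_zero ext)
      then show ?thesis using that(2) True by (auto simp: mon_ideal_def in_keys_iff)
    next
      case False
      then have "z a = 0" using that(1) unfolding free_deg_def by auto
      then show ?thesis by simp
    qed
    then have "P 0 (\<lambda>_. [0], \<lambda>_ _ _. 0)" by (auto simp: P_def minimal_at_def syz_0)
    then show "\<exists>x. P 0 x" by blast
  next
    fix sD n assume sD: "P n sD"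
    obtain s D where [simp]: "sD = (s, D)" by fastforce
    have ex: "\<And>i. i < n \<Longrightarrow> exact_at U s D i" and s0: "s 0 = [0]" and mi: "minimal_at U s D n" using sD by (auto simp: P_def)
    obtain t M where tM: "exact_at U (s(Suc n := t)) (D(n := M)) n" "minimal_at U (s(Suc n := t)) (D(n := M)) (Suc n)"
      using resolution_step[OF up reg_le s0 ex mi] by blast
    have "exact_at U (s(Suc n := t)) (D(n := M)) i" if "i < Suc n" for i
    proof (cases "i = n")
      case False
      then have "i < n" using that by simp
      then show ?thesis by (intro exact_at_cong[OF _ _ ex[of i]]) auto
    qed (simp add: tM(1))
    then have "P (Suc n) (s(Suc n := t), D(n := M))" using tM(2) s0 by (simp add: P_def)
    moreover have "Q n sD (s(Suc n := t), D(n := M))" by (simp add: Q_def)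
    ultimately show "\<exists>y. P (Suc n) y \<and> Q n sD y" by blast
  qed
  then obtain F where F: "\<And>n. P n (F n)" "\<And>n. Q n (F n) (F (Suc n))" by blast
  have agree: "fst (F (n + m)) i = fst (F n) i" "i < n \<Longrightarrow> snd (F (n + m)) i = snd (F n) i" if "i \<le> n" for n m i
  proof (induction m)
    case (Suc m)
    { case 1 then show ?case using F(2)[of "n + m"] Suc(1) that by (auto simp: Q_def) }
    { case 2 then show ?case using F(2)[of "n + m"] Suc(2) that by (auto simp: Q_def) }
  qed auto
  define s where "s i = fst (F i) i" for i
  define D where "D i = snd (F (Suc i)) i" for i
  have s_eq: "fst (F n) i = s i" if "i \<le> n" for n i
    using agree(1)[of i i "n - i"] that by (simp add: s_def)
  have D_eq: "snd (F n) i = D i" if "i < n" for n i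
    using agree(2)[of i "Suc i" "n - Suc i"] that by (simp add: D_def)
  have "exact_at U s D q" for q
  proof (rule exact_at_cong)
    show "exact_at U (fst (F (Suc q))) (snd (F (Suc q))) q" using F(1)[of "Suc q"] by (simp add: P_def case_prod_unfold)
  qed (simp_all add: s_eq D_eq)
  moreover have "minimal_at U s D q" for q
  proof (rule minimal_at_cong)
    show "minimal_at U (fst (F q)) (snd (F q)) q" using F(1)[of q] by (simp add: P_def case_prod_unfold)
  qed (simp_all add: s_eq D_eq)
  moreover have "s 0 = [0]" using F(1)[of 0] by (simp add: P_def s_def case_prod_unfold)
  ultimately show ?thesis by blast
qed

end

section \<open>Resolutions given by matrices\<close>

lemma lookup_mult_0:
  fixes p q :: "('v, 'k::comm_ring_1) mpoly"
  assumes "lookup p 0 = 0"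
  shows "lookup (p * q) 0 = 0"
proof (rule ccontr)
  assume "lookup (p * q) 0 \<noteq> 0"
  then have "0 \<in> keys (p * q)" by (simp add: in_keys_iff)
  then obtain a b where ab: "0 = a + b" "a \<in> keys p" by (elim keys_multE)
  have "mon_degree a + mon_degree b = 0" by (simp flip: mon_degree_add ab(1))
  then have "a = 0" by (simp add: mon_degree_eq_0_iff)
  then show False using ab(2) assms by (simp add: in_keys_iff)
qed

lemma polys_zero [simp]: "0 \<in> polys X" by (simp add: polys_def)

lemma polys_add: "p \<in> polys X \<Longrightarrow> q \<in> polys X \<Longrightarrow> p + q \<in> polys X"
  using keys_add[of p q] by (auto simp: polys_def)

lemma polys_sum: "(\<And>b. b \<in> B \<Longrightarrow> f b \<in> polys X) \<Longrightarrow> sum f B \<in> polys X"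
  by (induction B rule: infinite_finite_induct) (auto intro: polys_add)

lemma polys_mult:
  fixes p q :: "('v, 'k::comm_ring_1) mpoly"
  shows "p \<in> polys X \<Longrightarrow> q \<in> polys X \<Longrightarrow> p * q \<in> polys X"
  by (fastforce simp: polys_def keys_add_nat elim!: keys_multE)

context koszul
begin

lemma homog_polys: "p \<in> homog e j \<Longrightarrow> p \<in> polys X"
  by (simp add: homog_def polys_def)

text \<open>
  All vectors of the free module, not only the homogeneous ones of one degree.
\<close>

definition free_mod :: "nat list \<Rightarrow> (nat \<Rightarrow> ('v, 'k) mpoly) set" where
  "free_mod s = {v. (\<forall>a. v a \<noteq> 0 \<longrightarrow> a < length s) \<and> (\<forall>a. v a \<in> polys X)}"

lemma free_deg_free_mod: "free_deg s e j \<subseteq> free_mod s"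
proof
  fix v assume v: "v \<in> free_deg s e j"
  have "v a \<in> polys X" for a
  proof (cases "a < length s")
    case True then show ?thesis using v homog_polys by (auto simp: free_deg_def)
  next
    case False
    then have "v a = 0" using v unfolding free_deg_def by blast
    then show ?thesis by simp
  qed
  then show "v \<in> free_mod s" using v by (simp add: free_mod_def free_deg_def)
qed

definition graded :: "(nat \<Rightarrow> nat list) \<Rightarrow> ('v, 'k) differentials \<Rightarrow> bool" where
  "graded s D \<longleftrightarrow> (\<forall>q. \<forall>a<length (s q). \<forall>b<length (s (Suc q)). D q a b \<in> homog (s q ! a) (s (Suc q) ! b))"

definition homog_part :: "nat list \<Rightarrow> nat \<Rightarrow> nat \<Rightarrow> (nat \<Rightarrow> ('v, 'k) mpoly) \<Rightarrow> nat \<Rightarrow> ('v, 'k) mpoly" where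
  "homog_part s e j v a = (if a < length s then terms_in (\<lambda>m. keys m \<subseteq> X \<and> mon_degree m + (e + s ! a) = j) (v a) else 0)"

lemma homog_part_free_deg: "homog_part s e j v \<in> free_deg s e j"
  by (auto simp: homog_part_def free_deg_def)

lemma homog_part_self: "v \<in> free_deg s e j \<Longrightarrow> homog_part s e j v = v"
proof
  fix a assume v: "v \<in> free_deg s e j"
  show "homog_part s e j v a = v a"
  proof (cases "a < length s")
    case True then show ?thesis using v by (simp add: homog_part_def free_deg_def terms_in_homog_self)
  next
    case False
    then have "v a = 0" using v unfolding free_deg_def by blast
    then show ?thesis using False by (simp add: homog_part_def)
  qed
qed

text \<open>
  Homogeneous matrices commute with taking homogeneous parts. So exactness in each degree and exactness
  for all vectors are equivalent.
\<close>

lemma homog_part_dmap: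
  assumes "graded s D"
  shows "homog_part (s q) e j (dmap s D q W) = dmap s D q (homog_part (s (Suc q)) e j W)"
proof
  fix a
  show "homog_part (s q) e j (dmap s D q W) a = dmap s D q (homog_part (s (Suc q)) e j W) a"
  proof (cases "a < length (s q)")
    case True
    have "terms_in (\<lambda>m. keys m \<subseteq> X \<and> mon_degree m + (e + s q ! a) = j) (D q a b * W b)
      = D q a b * homog_part (s (Suc q)) e j W b" if "b < length (s (Suc q))" for b
    proof -
      have "D q a b \<in> homog (e + s q ! a) (e + s (Suc q) ! b)"
        using assms True that by (auto simp: graded_def homog_def)
      from terms_in_homog_mult[OF this] show ?thesis using that by (simp add: homog_part_def)
    qed
    then show ?thesis using True
      unfolding homog_part_def[of "s q"] by (simp add: dmap_def mat_app_def terms_in_sum)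
  next
    case False
    then show ?thesis by (simp add: homog_part_def dmap_def mat_app_def)
  qed
qed

lemma free_mod_decompose:
  assumes "v \<in> free_mod s"
  shows "\<exists>J. finite J \<and> (\<forall>a. v a = (\<Sum>j\<in>J. homog_part s 0 j v a))"
proof -
  define J where "J = (\<Union>a<length s. (\<lambda>m. mon_degree m + s ! a) ` keys (v a))"
  have finJ: "finite J" by (simp add: J_def)
  have "v a = (\<Sum>j\<in>J. homog_part s 0 j v a)" for a
  proof (cases "a < length s")
    case True
    show ?thesis
    proof (rule poly_mapping_eqI)
      fix m
      have "lookup (\<Sum>j\<in>J. homog_part s 0 j v a) m
        = (\<Sum>j\<in>J. if j = mon_degree m + s ! a then lookup (v a) m when keys m \<subseteq> X else 0)"
        unfolding lookup_sum by (rule sum.cong) (use True in \<open>auto simp: homog_part_def lookup_terms_in when_def\<close>)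
      also have "\<dots> = (if mon_degree m + s ! a \<in> J then lookup (v a) m when keys m \<subseteq> X else 0)"
        using finJ by simp
      also have "\<dots> = lookup (v a) m"
      proof (cases "m \<in> keys (v a)")
        case m: True
        then have "keys m \<subseteq> X" using assms by (auto simp: free_mod_def polys_def)
        moreover have "mon_degree m + s ! a \<in> J" using True m by (auto simp: J_def)
        ultimately show ?thesis by simp
      qed (simp add: in_keys_iff when_def)
      finally show "lookup (v a) m = lookup (\<Sum>j\<in>J. homog_part s 0 j v a) m" ..
    qed
  next
    case False
    then have "v a = 0" using assms unfolding free_mod_def by blast
    then show ?thesis using False by (simp add: homog_part_def)
  qed
  then show ?thesis using finJ by blast
qed

lemma dmap_sum: "dmap s D q (\<lambda>b. \<Sum>j\<in>J. w j b) a = (\<Sum>j\<in>J. dmap s D q (w j) a)"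
  by (simp add: dmap_def mat_app_def sum_distrib_left sum.swap[of _ J])

lemma syz_sum:
  assumes "upset U" "\<And>j. j \<in> J \<Longrightarrow> syz U s D q (w j)"
  shows "syz U s D q (\<lambda>b. \<Sum>j\<in>J. w j b)"
  using assms(2) by (cases q) (auto simp: syz_0 syz_Suc dmap_sum intro: mon_ideal_sum)

definition exact_full :: "('v \<Rightarrow> nat) set \<Rightarrow> (nat \<Rightarrow> nat list) \<Rightarrow> ('v, 'k) differentials \<Rightarrow> nat \<Rightarrow> bool" where
  "exact_full U s D q \<longleftrightarrow> (\<forall>W\<in>free_mod (s (Suc q)). syz U s D q (dmap s D q W)) \<and>
     (\<forall>v\<in>free_mod (s q). syz U s D q v \<longrightarrow> (\<exists>W\<in>free_mod (s (Suc q)). \<forall>a. v a = dmap s D q W a))"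

lemma free_mod_sum: "(\<And>j. j \<in> J \<Longrightarrow> w j \<in> free_mod s) \<Longrightarrow> (\<lambda>b. \<Sum>j\<in>J. w j b) \<in> free_mod s"
proof -
  assume w: "\<And>j. j \<in> J \<Longrightarrow> w j \<in> free_mod s"
  have "a < length s" if nz: "(\<Sum>j\<in>J. w j a) \<noteq> 0" for a
  proof (rule ccontr)
    assume "\<not> ?thesis"
    then have "w j a = 0" if "j \<in> J" for j using w[OF that] unfolding free_mod_def by blast
    then show False using nz by simp
  qed
  moreover have "(\<Sum>j\<in>J. w j a) \<in> polys X" for a
    using w by (intro polys_sum) (simp add: free_mod_def)
  ultimately show ?thesis unfolding free_mod_def by blast
qed

lemma exact_at_imp_exact_full:
  assumes up: "upset U" and s0: "s 0 = [0]" and gr: "graded s D" and ex: "exact_at U s D q"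
  shows "exact_full U s D q"
  unfolding exact_full_def
proof (intro conjI ballI impI)
  fix W assume W: "W \<in> free_mod (s (Suc q))"
  then obtain J where J: "\<And>a. W a = (\<Sum>j\<in>J. homog_part (s (Suc q)) 0 j W a)" using free_mod_decompose by blast
  have "syz U s D q (dmap s D q (homog_part (s (Suc q)) 0 j W))" for j
    using ex homog_part_free_deg[of "s (Suc q)" 0 j W] unfolding exact_at_def by meson
  then have "syz U s D q (\<lambda>a. \<Sum>j\<in>J. dmap s D q (homog_part (s (Suc q)) 0 j W) a)"
    by (intro syz_sum[OF up])
  moreover have "dmap s D q W = (\<lambda>a. \<Sum>j\<in>J. dmap s D q (homog_part (s (Suc q)) 0 j W) a)"
    unfolding dmap_sum[symmetric] by (rule ext, rule arg_cong[where f = "\<lambda>w. dmap s D q w _"], rule ext, rule J)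
  ultimately show "syz U s D q (dmap s D q W)" by simp
next
  fix v assume v: "v \<in> free_mod (s q)" "syz U s D q v"
  then obtain J where J: "\<And>a. v a = (\<Sum>j\<in>J. homog_part (s q) 0 j v a)" using free_mod_decompose by blast
  have "syz U s D q (homog_part (s q) 0 j v)" for j
  proof (cases q)
    case 0
    then show ?thesis using v(2) s0 by (simp add: syz_0 homog_part_def mon_ideal_def keys_terms_in)
  next
    case (Suc i)
    have "dmap s D i v = (\<lambda>_. 0)" using v(2) Suc by (auto simp: syz_Suc)
    then have "dmap s D i (homog_part (s q) 0 j v) = homog_part (s i) 0 j (\<lambda>_. 0)"
      using homog_part_dmap[OF gr, of i 0 j v] Suc by simp
    then show ?thesis using Suc by (simp add: syz_Suc homog_part_def)
  qed
  then have "\<exists>w. w \<in> free_deg (s (Suc q)) 0 j \<and> (\<forall>a. homog_part (s q) 0 j v a = dmap s D q w a)" for j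
    using ex homog_part_free_deg[of "s q" 0 j v] unfolding exact_at_def by meson
  then obtain w where w: "\<And>j. w j \<in> free_deg (s (Suc q)) 0 j" "\<And>j a. homog_part (s q) 0 j v a = dmap s D q (w j) a"
    by metis
  have "(\<lambda>b. \<Sum>j\<in>J. w j b) \<in> free_mod (s (Suc q))" using w(1) free_deg_free_mod by (intro free_mod_sum) blast
  moreover have "v a = dmap s D q (\<lambda>b. \<Sum>j\<in>J. w j b) a" for a
    unfolding dmap_sum by (subst J) (simp add: w(2))
  ultimately show "\<exists>W\<in>free_mod (s (Suc q)). \<forall>a. v a = dmap s D q W a" by blast
qed

lemma exact_full_imp_exact_at:
  assumes gr: "graded s D" and ex: "exact_full U s D q"
  shows "exact_at U s D q"
  unfolding exact_at_def
proof (intro conjI allI ballI impI)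
  show "D q a b \<in> homog (s q ! a) (s (Suc q) ! b)" if "a < length (s q)" "b < length (s (Suc q))" for a b
    using gr that by (simp add: graded_def)
  show "syz U s D q (dmap s D q w)" if "w \<in> free_deg (s (Suc q)) e j" for e j w
    using ex that free_deg_free_mod unfolding exact_full_def by blast
  fix e j v assume v: "v \<in> free_deg (s q) e j" "syz U s D q v"
  have "v \<in> free_mod (s q)" using v free_deg_free_mod by blast
  then obtain W where W: "\<And>a. v a = dmap s D q W a" using ex v(2) unfolding exact_full_def by meson
  have "v = homog_part (s q) e j v" using homog_part_self[OF v(1)] by simp
  also have "v = dmap s D q W" using W by blast
  also have "homog_part (s q) e j \<dots> = dmap s D q (homog_part (s (Suc q)) e j W)" by (rule homog_part_dmap[OF gr])
  finally have "v = dmap s D q (homog_part (s (Suc q)) e j W)" using \<open>v = dmap s D q W\<close> by simp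
  then show "\<exists>w\<in>free_deg (s (Suc q)) e j. \<forall>a. v a = dmap s D q w a"
    using homog_part_free_deg by metis
qed

lemma free_module_eq: "free_module X (length s) = vec (length s) ` free_mod s"
proof (intro subset_antisym subsetI)
  fix v :: "('v,'k) mpoly vec" assume v: "v \<in> free_module X (length s)"
  define f where "f a = (if a < length s then v $ a else 0)" for a
  have "f \<in> free_mod s" using v by (auto simp: f_def free_mod_def free_module_def)
  moreover have "v = vec (length s) f" using v by (intro eq_vecI) (auto simp: f_def free_module_def)
  ultimately show "v \<in> vec (length s) ` free_mod s" by blast
next
  fix v :: "('v,'k) mpoly vec" assume "v \<in> vec (length s) ` free_mod s"
  then show "v \<in> free_module X (length s)" by (auto simp: free_module_def free_mod_def)
qed

text \<open>
  Reading a resolution of \<open>I\<close> as a complex that starts with \<open>R\<close> shifts its indices by one.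
\<close>

definition represents :: "('v, 'k) resolution \<Rightarrow> (nat \<Rightarrow> nat list) \<Rightarrow> ('v, 'k) differentials \<Rightarrow> bool" where
  "represents F s D \<longleftrightarrow> s 0 = [0] \<and> (\<forall>i. s (Suc i) = res_shifts F i) \<and>
     res_aug F = vec (res_rank F 0) (D 0 0) \<and>
     (\<forall>i. res_map F i = mat (res_rank F i) (res_rank F (Suc i)) (\<lambda>(a, b). D (Suc i) a b))"

lemma represents_aug:
  assumes "represents F s D"
  shows "res_aug F \<bullet> vec (res_rank F 0) w = dmap s D 0 w 0"
  using assms by (simp add: represents_def scalar_prod_def dmap_def mat_app_def atLeast0LessThan)

lemma represents_map:
  assumes "represents F s D"
  shows "res_map F i *\<^sub>v vec (res_rank F (Suc i)) w = vec (res_rank F i) (dmap s D (Suc i) w)"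
  using assms by (intro eq_vecI) (auto simp: represents_def scalar_prod_def dmap_def mat_app_def atLeast0LessThan)

lemma vec_eq_free_mod:
  assumes "v \<in> free_mod s" "w \<in> free_mod s" "vec (length s) v = vec (length s) w"
  shows "v a = w a"
proof (cases "a < length s")
  case True then show ?thesis using assms(3) by (metis index_vec)
next
  case False
  then have "v a = 0" "w a = 0" using assms unfolding free_mod_def by blast+
  then show ?thesis by simp
qed

lemma dmap_free_mod: "graded s D \<Longrightarrow> W \<in> free_mod (s (Suc q)) \<Longrightarrow> dmap s D q W \<in> free_mod (s q)"
proof -
  assume gr: "graded s D" and W: "W \<in> free_mod (s (Suc q))"
  have "D q a b * W b \<in> polys X" if "a < length (s q)" "b < length (s (Suc q))" for a b
    using gr W that homog_polys unfolding graded_def free_mod_def by (blast intro: polys_mult)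
  then show ?thesis by (auto simp: free_mod_def dmap_def mat_app_def intro: polys_sum)
qed

lemma image_eq_iff:
  assumes "\<And>x. x \<in> A \<Longrightarrow> f x \<in> C"
  shows "f ` A = {c \<in> C. P c} \<longleftrightarrow> (\<forall>x\<in>A. P (f x)) \<and> (\<forall>c\<in>C. P c \<longrightarrow> (\<exists>x\<in>A. c = f x))"
  using assms by blast

text \<open>
  After identifying vectors with zero-padded functions, the three image equations that define exactness of
  a resolution are exactness at \<open>M\<^sub>0\<close>, at \<open>M\<^sub>1\<close> and at all later places of the complex.
\<close>

lemma exact_resolution_iff:
  assumes rep: "represents F s D" and gr: "graded s D"
  shows "exact_resolution X (polys X \<inter> mon_ideal U) F \<longleftrightarrow> (\<forall>q. exact_full U s D q)"
proof -
  have s: "s 0 = [0]" "\<And>i. s (Suc i) = res_shifts F i" using rep by (simp_all add: represents_def)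
  have fr: "free_module X (res_rank F i) = vec (res_rank F i) ` free_mod (s (Suc i))" for i
    using free_module_eq[of "s (Suc i)"] by (simp add: s)
  have pf0: "free_mod [0] = (\<lambda>p a. if a = 0 then p else 0) ` (polys X :: ('v,'k) mpoly set)"
  proof (intro subset_antisym subsetI)
    fix v assume v: "v \<in> free_mod [0]"
    then have "v = (\<lambda>a. if a = 0 then v 0 else 0)" by (intro ext) (auto simp: free_mod_def)
    moreover have "v 0 \<in> polys X" using v by (simp add: free_mod_def)
    ultimately show "v \<in> (\<lambda>p a. if a = 0 then p else 0) ` polys X" by (rule image_eqI)
  qed (auto simp: free_mod_def split: if_splits)
  have ap0: "dmap s D 0 w a = (if a = 0 then dmap s D 0 w 0 else 0)" for w a
    by (simp add: dmap_def mat_app_def s(1))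
  have E0: "(\<lambda>v. res_aug F \<bullet> v) ` free_module X (res_rank F 0) = polys X \<inter> mon_ideal U \<longleftrightarrow> exact_full U s D 0"
  proof -
    have img: "(\<lambda>v. res_aug F \<bullet> v) ` free_module X (res_rank F 0) = (\<lambda>w. dmap s D 0 w 0) ` free_mod (s (Suc 0))"
      unfolding fr image_image represents_aug[OF rep] ..
    have "(\<lambda>w. dmap s D 0 w 0) ` free_mod (s (Suc 0)) = {c \<in> polys X. c \<in> mon_ideal U} \<longleftrightarrow> (\<forall>w\<in>free_mod (s (Suc 0)). dmap s D 0 w 0 \<in> mon_ideal U) \<and>
        (\<forall>c\<in>polys X. c \<in> mon_ideal U \<longrightarrow> (\<exists>w\<in>free_mod (s (Suc 0)). c = dmap s D 0 w 0))"
      by (rule image_eq_iff) (use dmap_free_mod[OF gr, of _ 0] in \<open>auto simp: free_mod_def\<close>)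
    also have "\<dots> \<longleftrightarrow> exact_full U s D 0"
      unfolding exact_full_def s(1) pf0 by (simp add: syz_0) (subst ap0, auto)
    finally show ?thesis unfolding img Int_def .
  qed
  have pexSuc: "(\<lambda>w. vec (res_rank F i) (dmap s D (Suc i) w)) ` free_mod (s (Suc (Suc i)))
      = {v \<in> vec (res_rank F i) ` free_mod (s (Suc i)). P v} \<longleftrightarrow> exact_full U s D (Suc i)"
    if P: "\<And>v. v \<in> free_mod (s (Suc i)) \<Longrightarrow> P (vec (res_rank F i) v) \<longleftrightarrow> syz U s D (Suc i) v" for i P
  proof -
    have iff: "(\<lambda>w. vec (res_rank F i) (dmap s D (Suc i) w)) ` free_mod (s (Suc (Suc i)))
        = {v \<in> vec (res_rank F i) ` free_mod (s (Suc i)). P v} \<longleftrightarrow>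
      (\<forall>W\<in>free_mod (s (Suc (Suc i))). P (vec (res_rank F i) (dmap s D (Suc i) W))) \<and>
      (\<forall>c\<in>vec (res_rank F i) ` free_mod (s (Suc i)). P c \<longrightarrow>
        (\<exists>W\<in>free_mod (s (Suc (Suc i))). c = vec (res_rank F i) (dmap s D (Suc i) W)))"
      by (rule image_eq_iff) (use dmap_free_mod[OF gr] in blast)
    have PZ: "P (vec (res_rank F i) (dmap s D (Suc i) W)) \<longleftrightarrow> syz U s D (Suc i) (dmap s D (Suc i) W)"
      if "W \<in> free_mod (s (Suc (Suc i)))" for W
      by (rule P[OF dmap_free_mod[OF gr that]])
    have eqv: "vec (res_rank F i) v = vec (res_rank F i) (dmap s D (Suc i) W) \<longleftrightarrow> (\<forall>a. v a = dmap s D (Suc i) W a)"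
      if "v \<in> free_mod (s (Suc i))" "W \<in> free_mod (s (Suc (Suc i)))" for v W
    proof
      assume "vec (res_rank F i) v = vec (res_rank F i) (dmap s D (Suc i) W)"
      then show "\<forall>a. v a = dmap s D (Suc i) W a"
        using vec_eq_free_mod[OF that(1) dmap_free_mod[OF gr that(2)]] s(2) by simp
    next
      assume "\<forall>a. v a = dmap s D (Suc i) W a"
      then have "v = dmap s D (Suc i) W" by (intro ext) (erule spec)
      then show "vec (res_rank F i) v = vec (res_rank F i) (dmap s D (Suc i) W)" by simp
    qed
    show ?thesis
      unfolding iff exact_full_def ball_simps
      by (intro conj_cong ball_cong imp_cong bex_cong refl PZ P eqv)
  qed
  have E1: "(\<lambda>w. res_map F 0 *\<^sub>v w) ` free_module X (res_rank F 1) =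
       {v \<in> free_module X (res_rank F 0). res_aug F \<bullet> v = 0} \<longleftrightarrow> exact_full U s D (Suc 0)"
  proof -
    have "res_aug F \<bullet> vec (res_rank F 0) v = 0 \<longleftrightarrow> syz U s D (Suc 0) v" for v
    proof
      assume "res_aug F \<bullet> vec (res_rank F 0) v = 0"
      then have "dmap s D 0 v 0 = 0" unfolding represents_aug[OF rep] .
      then have "dmap s D 0 v a = 0" for a by (subst ap0) simp
      then show "syz U s D (Suc 0) v" by (simp add: syz_Suc)
    qed (simp add: syz_Suc represents_aug[OF rep])
    from pexSuc[of 0, OF this] show ?thesis
      unfolding One_nat_def fr image_image represents_map[OF rep] .
  qed
  have ES: "(\<lambda>w. res_map F (Suc i) *\<^sub>v w) ` free_module X (res_rank F (Suc (Suc i))) =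
        {v \<in> free_module X (res_rank F (Suc i)). res_map F i *\<^sub>v v = 0\<^sub>v (res_rank F i)} \<longleftrightarrow> exact_full U s D (Suc (Suc i))" for i
  proof -
    have "vec (res_rank F i) (dmap s D (Suc i) v) = 0\<^sub>v (res_rank F i) \<longleftrightarrow> syz U s D (Suc (Suc i)) v" for v
    proof -
      have "dmap s D (Suc i) v a = 0" if "\<not> a < res_rank F i" for a
        using that by (simp add: dmap_def mat_app_def s)
      then show ?thesis unfolding syz_Suc vec_eq_iff by auto
    qed
    then have "res_map F i *\<^sub>v vec (res_rank F (Suc i)) v = 0\<^sub>v (res_rank F i) \<longleftrightarrow> syz U s D (Suc (Suc i)) v" for v
      unfolding represents_map[OF rep] .
    from pexSuc[of "Suc i", OF this] show ?thesis
      unfolding fr image_image represents_map[OF rep] .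
  qed
  have "(\<forall>q. exact_full U s D q) \<longleftrightarrow> exact_full U s D 0 \<and> exact_full U s D (Suc 0) \<and> (\<forall>i. exact_full U s D (Suc (Suc i)))"
    by (metis not0_implies_Suc)
  then show ?thesis unfolding exact_resolution_def E0 E1 ES by simp
qed

lemma represents_graded:
  assumes "represents F s D"
  shows "graded_maps X F \<longleftrightarrow> graded s D"
proof -
  have s: "s 0 = [0]" "\<And>i. s (Suc i) = res_shifts F i" using assms by (simp_all add: represents_def)
  have aug: "res_aug F $ b = D 0 0 b" if "b < res_rank F 0" for b using assms that by (simp add: represents_def)
  have mp: "res_map F i $$ (a, b) = D (Suc i) a b" if "a < res_rank F i" "b < res_rank F (Suc i)" for i a b
    using assms that by (simp add: represents_def)
  have car: "res_aug F \<in> carrier_vec (res_rank F 0)" "\<And>i. res_map F i \<in> carrier_mat (res_rank F i) (res_rank F (Suc i))"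
    using assms by (simp_all add: represents_def)
  have "graded s D \<longleftrightarrow> (\<forall>b<res_rank F 0. D 0 0 b \<in> homog 0 (res_shifts F 0 ! b)) \<and>
     (\<forall>i. \<forall>a<res_rank F i. \<forall>b<res_rank F (Suc i). D (Suc i) a b \<in> homog (res_shifts F i ! a) (res_shifts F (Suc i) ! b))"
  proof -
    have "graded s D \<longleftrightarrow> (\<forall>a<length (s 0). \<forall>b<length (s (Suc 0)). D 0 a b \<in> homog (s 0 ! a) (s (Suc 0) ! b)) \<and>
      (\<forall>i. \<forall>a<length (s (Suc i)). \<forall>b<length (s (Suc (Suc i))). D (Suc i) a b \<in> homog (s (Suc i) ! a) (s (Suc (Suc i)) ! b))"
      unfolding graded_def by (metis (no_types, lifting) not0_implies_Suc)
    then show ?thesis by (simp add: s)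
  qed
  also have "\<dots> \<longleftrightarrow> graded_maps X F"
    unfolding graded_maps_def free_module_def homog_def polys_def by (simp add: aug mp car) blast
  finally show ?thesis ..
qed

lemma represents_of_resolution:
  assumes "graded_maps X F"
  obtains s D where "represents F s D"
proof
  define s where "s q = (case q of 0 \<Rightarrow> [0] | Suc i \<Rightarrow> res_shifts F i)" for q
  define D where "D q a b = (case q of 0 \<Rightarrow> res_aug F $ b | Suc i \<Rightarrow> res_map F i $$ (a, b))" for q a b
  have "res_aug F \<in> free_module X (res_rank F 0)"
    using assms unfolding graded_maps_def by (rule conjunct1)
  then have "dim_vec (res_aug F) = res_rank F 0" by (simp add: free_module_def)
  moreover have "res_map F i \<in> carrier_mat (res_rank F i) (res_rank F (Suc i))" for i
  proof -
    from assms have "\<forall>i. res_map F i \<in> carrier_mat (res_rank F i) (res_rank F (Suc i)) \<and>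
        (\<forall>a<res_rank F i. \<forall>b<res_rank F (Suc i). res_map F i $$ (a, b) \<in> polys X \<and>
           (\<forall>m\<in>keys (res_map F i $$ (a, b)). mon_degree m + res_shifts F i ! a = res_shifts F (Suc i) ! b))"
      unfolding graded_maps_def by (elim conjE)
    from this[rule_format, of i] show ?thesis by (rule conjunct1)
  qed
  then have "dim_row (res_map F i) = res_rank F i" "dim_col (res_map F i) = res_rank F (Suc i)" for i
    by (rule carrier_matD)+
  ultimately show "represents F s D"
    unfolding represents_def s_def D_def by (auto intro!: eq_vecI eq_matI)
qed

lemma minimal_at_of_entries:
  assumes s0: "s 0 = [0]" and U0: "(\<lambda>_. 0) \<notin> U" and ex: "\<And>q. exact_at U s D q"
    and ent: "\<And>i a b. a < length (s (Suc i)) \<Longrightarrow> b < length (s (Suc (Suc i))) \<Longrightarrow> lookup (D (Suc i) a b) 0 = 0"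
  shows "minimal_at U s D q"
  unfolding minimal_at_def
proof (intro allI ballI impI)
  fix j z a assume z: "z \<in> free_deg (s q) 0 j" "syz U s D q z"
  show "lookup (z a) 0 = 0"
  proof (cases q)
    case 0
    show ?thesis
    proof (cases "a = 0")
      case True
      have "lookup (0 :: 'v \<Rightarrow>\<^sub>0 nat) = (\<lambda>_. 0)" by (simp add: fun_eq_iff)
      then have "lookup (0 :: 'v \<Rightarrow>\<^sub>0 nat) \<notin> U" using U0 by simp
      then show ?thesis using z(2) 0 True by (auto simp: syz_0 mon_ideal_def in_keys_iff)
    next
      case False
      then have "z a = 0" using z(1) unfolding 0 s0 free_deg_def by auto
      then show ?thesis by simp
    qed
  next
    case (Suc i)
    obtain w where "\<forall>a. z a = dmap s D q w a" using ex[of q] z unfolding exact_at_def by meson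
    then have "z a = (if a < length (s q) then \<Sum>b<length (s (Suc q)). D q a b * w b else 0)"
      by (simp add: dmap_def mat_app_def)
    then show ?thesis using ent[of a i] Suc by (simp add: lookup_sum lookup_mult_0)
  qed
qed

lemma minimal_graded_free_resolution_exists:
  assumes up: "upset U" and reg_le: "reg_le U B" and U0: "(\<lambda>_. 0) \<notin> U"
  shows "\<exists>F. minimal_graded_free_resolution X (polys X \<inter> mon_ideal U :: ('v, 'k) mpoly set) F"
proof -
  obtain s and D :: "nat \<Rightarrow> nat \<Rightarrow> nat \<Rightarrow> ('v, 'k) mpoly" where s0: "s 0 = [0]"
    and ex: "\<And>q. exact_at U s D q" and mi: "\<And>q. minimal_at U s D q"
    using minimal_resolution_exists[OF assms] by blast
  define F where "F = \<lparr>res_shifts = (\<lambda>i. s (Suc i)), res_aug = vec (length (s (Suc 0))) (D 0 0),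
    res_map = (\<lambda>i. mat (length (s (Suc i))) (length (s (Suc (Suc i)))) (\<lambda>(a, b). D (Suc i) a b))\<rparr>"
  have rep: "represents F s D" by (simp add: represents_def F_def s0)
  have gr: "graded s D" using ex by (simp add: graded_def exact_at_def)
  have "lookup (res_map F i $$ (a, b)) 0 = 0" if a: "a < res_rank F i" and b: "b < res_rank F (Suc i)" for i a b
  proof -
    have ab: "a < length (s (Suc i))" "b < length (s (Suc (Suc i)))" using a b by (simp_all add: F_def)
    define e where "e b' = (if b' = b then 1 else (0 :: ('v,'k) mpoly))" for b'
    have e: "e \<in> free_deg (s (Suc (Suc i))) 0 (s (Suc (Suc i)) ! b)"
      using ab by (auto simp: e_def free_deg_def homog_def)
    let ?z = "dmap s D (Suc i) e"
    have "?z \<in> free_deg (s (Suc i)) 0 (s (Suc (Suc i)) ! b)"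
      unfolding dmap_def using gr e by (intro mat_app_free_deg) (simp_all add: graded_def)
    moreover have "syz U s D (Suc i) ?z" using ex[of "Suc i"] e unfolding exact_at_def by blast
    ultimately have "lookup (?z a) 0 = 0" using mi unfolding minimal_at_def by blast
    moreover have "?z a = D (Suc i) a b"
      using ab by (simp add: dmap_def mat_app_def e_def if_distrib[of "(*) _"] cong: if_cong)
    ultimately show ?thesis using ab by (simp add: F_def)
  qed
  moreover have "graded_maps X F" using represents_graded[OF rep] gr by simp
  moreover have "exact_resolution X (polys X \<inter> mon_ideal U) F"
    using exact_resolution_iff[OF rep gr] exact_at_imp_exact_full[OF up s0 gr ex] by simp
  ultimately show ?thesis unfolding minimal_graded_free_resolution_def by blast
qed

text \<open>
  If \<open>H\<^sub>i\<^sub>+\<^sub>1(R/I)\<^sub>j\<close> vanishes, the column of a basis element \<open>e\<close> of degree \<open>j\<close> is a combination of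
  syzygies with coefficients in \<open>\<mm>\<close>. Lifting this combination gives a relation in which \<open>e\<close> has the
  constant coefficient 1, contrary to minimality. The converse is \<open>zigzag_downward\<close>, started with a Koszul cycle of \<open>R/I\<close>.
\<close>

lemma shift_iff_koszul:
  assumes up: "upset U" and U0: "(\<lambda>_. 0) \<notin> U"
    and F: "minimal_graded_free_resolution X (polys X \<inter> mon_ideal U :: ('v, 'k) mpoly set) F"
  shows "j \<in> set (res_shifts F i) \<longleftrightarrow> \<not> koszul_zero U (Suc i) j"
proof -
  have gm: "graded_maps X F" and er: "exact_resolution X (polys X \<inter> mon_ideal U) F"
    and sqfree_mon: "\<And>i a b. a < res_rank F i \<Longrightarrow> b < res_rank F (Suc i) \<Longrightarrow> lookup (res_map F i $$ (a, b)) 0 = 0"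
    using F by (auto simp: minimal_graded_free_resolution_def)
  obtain s D where rep: "represents F s D" using represents_of_resolution[OF gm] .
  have s: "s 0 = [0]" "\<And>i. s (Suc i) = res_shifts F i" using rep by (simp_all add: represents_def)
  have gr: "graded s D" using represents_graded[OF rep] gm by simp
  have ex: "exact_at U s D q" for q
    using exact_resolution_iff[OF rep gr, of U] er exact_full_imp_exact_at[OF gr] by simp
  have mi: "minimal_at U s D q" for q
  proof (rule minimal_at_of_entries[OF s(1) U0 ex])
    fix i a b assume "a < length (s (Suc i))" "b < length (s (Suc (Suc i)))"
    then show "lookup (D (Suc i) a b) 0 = 0" using sqfree_mon[of a i b] rep by (simp add: represents_def)
  qed
  show ?thesis
  proof
    assume "j \<in> set (res_shifts F i)"
    then obtain b where b: "b < length (s (Suc i))" "s (Suc i) ! b = j" by (auto simp: s in_set_conv_nth)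
    show "\<not> koszul_zero U (Suc i) j"
    proof
      assume HK: "koszul_zero U (Suc i) j"
      define e where "e b' = (if b' = b then 1 else (0 :: ('v,'k) mpoly))" for b'
      have e: "e \<in> free_deg (s (Suc i)) 0 j" using b by (auto simp: e_def free_deg_def homog_def)
      let ?z = "dmap s D i e"
      have z: "?z \<in> free_deg (s i) 0 j" unfolding dmap_def using gr e by (intro mat_app_free_deg) (simp_all add: graded_def)
      have Zz: "syz U s D i ?z" using ex[of i] e unfolding exact_at_def by blast
      have "lookup (?z a) 0 = 0" for a using mi[of i] z Zz unfolding minimal_at_def by blast
      then obtain y where y: "\<And>x. x \<in> X \<Longrightarrow> y x \<in> free_deg (s i) 1 j" "\<And>x. x \<in> X \<Longrightarrow> syz U s D i (y x)"
        and zy: "?z = (\<Sum>x\<in>X. pscale (variable x) (y x))"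
        using syz_in_max_ideal_times_syz[OF s(1) HK ex z Zz] by blast
      have "\<forall>x\<in>X. \<exists>w. w \<in> free_deg (s (Suc i)) 1 j \<and> (\<forall>a. y x a = dmap s D i w a)"
        using ex[of i] y unfolding exact_at_def by meson
      from bchoice[OF this] obtain w where
        w: "\<And>x. x \<in> X \<Longrightarrow> w x \<in> free_deg (s (Suc i)) 1 j" "\<And>x a. x \<in> X \<Longrightarrow> y x a = dmap s D i (w x) a" by blast
      \<comment> \<open>The offending relation, with constant coefficient 1 at \<open>b\<close>.\<close>
      define r where "r b' = e b' - (\<Sum>x\<in>X. variable x * w x b')" for b'
      have "dmap s D i r a = 0" for a
      proof -
        have "dmap s D i r a = ?z a - dmap s D i (\<lambda>b'. \<Sum>x\<in>X. variable x * w x b') a"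
          unfolding r_def by (rule dmap_diff)
        also have "dmap s D i (\<lambda>b'. \<Sum>x\<in>X. variable x * w x b') a = (\<Sum>x\<in>X. dmap s D i (\<lambda>b'. variable x * w x b') a)"
          by (rule dmap_sum)
        also have "\<dots> = (\<Sum>x\<in>X. variable x * dmap s D i (w x) a)"
          by (rule sum.cong) (simp_all add: dmap_def mat_app_def sum_distrib_left mult_ac)
        also have "\<dots> = ?z a" unfolding zy sum_fun_apply pscale_def by (rule sum.cong) (simp_all add: w(2))
        finally show ?thesis by simp
      qed
      then have "syz U s D (Suc i) r" by (simp add: syz_Suc)
      moreover have "r \<in> free_deg (s (Suc i)) 0 j"
        unfolding r_def
      proof (rule free_deg_diff[OF e])
        have "variable x * w x b' \<in> homog (s (Suc i) ! b') j" if "x \<in> X" "b' < length (s (Suc i))" for x b'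
        proof -
          have "w x b' \<in> homog (Suc (s (Suc i) ! b')) j" using w(1)[OF that(1)] that(2) by (simp add: free_deg_def)
          then show ?thesis using homog_mult[OF _ homog_variable[OF that(1)]] by (metis mult.commute)
        qed
        moreover have "(\<Sum>x\<in>X. variable x * w x b') = 0" if "\<not> b' < length (s (Suc i))" for b'
        proof (rule sum.neutral, rule ballI)
          fix x assume "x \<in> X"
          then have "w x b' = 0" using w(1) that unfolding free_deg_def by blast
          then show "variable x * w x b' = 0" by simp
        qed
        ultimately show "(\<lambda>b'. \<Sum>x\<in>X. variable x * w x b') \<in> free_deg (s (Suc i)) 0 j"
          unfolding free_deg_def by (auto intro: homog_sum)
      qed
      ultimately have "lookup (r b) 0 = 0" using mi[of "Suc i"] unfolding minimal_at_def by blast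
      moreover have "lookup (variable x * w x b) 0 = 0" for x by (simp add: lookup_variable_mult)
      ultimately show False by (simp add: r_def e_def lookup_minus lookup_sum)
    qed
  next
    assume nHK: "\<not> koszul_zero U (Suc i) j"
    show "j \<in> set (res_shifts F i)"
    proof (rule ccontr)
      assume "j \<notin> set (res_shifts F i)"
      then have nj: "j \<notin> set (s (Suc i))" by (simp add: s)
      have "koszul_zero U (Suc i) j" unfolding koszul_zero_def
      proof (intro ballI impI)
        fix f assume f: "f \<in> koszul_ch (Suc i) [0] j" "\<forall>T. bdrym f T 0 \<in> mon_ideal U"
        have "\<exists>g\<in>koszul_ch (Suc (Suc i)) (s 0) j. \<forall>S. syz U s D 0 (\<lambda>a. f S a - bdrym g S a)"
          by (rule zigzag_downward[OF ex nj]) (use f in \<open>simp_all add: s syz_0\<close>)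
        then show "\<exists>g\<in>koszul_ch (Suc (Suc i)) [0] j. \<forall>S. f S 0 - bdrym g S 0 \<in> mon_ideal U"
          by (simp add: s syz_0)
      qed
      with nHK show False ..
    qed
  qed
qed

lemma graded_betti_nonzero_iff:
  assumes up: "upset U" and reg_le: "reg_le U B" and U0: "(\<lambda>_. 0) \<notin> U"
  shows "graded_betti X (polys X \<inter> mon_ideal U :: ('v, 'k) mpoly set) i j \<noteq> 0 \<longleftrightarrow> \<not> koszul_zero U (Suc i) j"
proof -
  let ?I = "polys X \<inter> mon_ideal U :: ('v, 'k) mpoly set"
  have "minimal_graded_free_resolution X ?I (SOME F. minimal_graded_free_resolution X ?I F)"
    using minimal_graded_free_resolution_exists[OF assms] by (rule someI_ex)
  from shift_iff_koszul[OF up U0 this] show ?thesis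
    unfolding graded_betti_def by (simp add: count_list_0_iff)
qed

lemma finite_betti_degrees:
  assumes up: "upset U" and reg_le: "reg_le U B" and U0: "(\<lambda>_. 0) \<notin> U"
  shows "finite {int j - int i | i j. graded_betti X (polys X \<inter> mon_ideal U :: ('v, 'k) mpoly set) i j \<noteq> 0}"
proof -
  let ?I = "polys X \<inter> mon_ideal U :: ('v, 'k) mpoly set"
  have "j \<le> B + Suc i \<and> Suc i \<le> card X" if "graded_betti X ?I i j \<noteq> 0" for i j
    using that koszul_zero_of_reg_le[OF up reg_le, of "Suc i" j] koszul_zero_above_card[of "Suc i" U j]
    unfolding graded_betti_nonzero_iff[OF assms] by (meson not_le)
  then have "{int j - int i | i j. graded_betti X ?I i j \<noteq> 0}
      \<subseteq> (\<lambda>(i, j). int j - int i) ` (SIGMA i:{..card X}. {..B + Suc i})"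
    by fastforce
  then show ?thesis by (rule finite_subset) auto
qed

end

section \<open>Distances and the exchange property\<close>

lemma edge_dist_le_imp_proper_chain:
  assumes "edge_dist d H E F \<le> enat m"
  obtains Es xs where "proper_chain d H E F Es xs" "length xs \<le> m"
proof -
  let ?A = "{enat (length xs) | Es xs. proper_irredundant_chain d H E F Es xs}"
  have "?A \<noteq> {}"
  proof
    assume e: "?A = {}"
    have "edge_dist d H E F = \<infinity>" unfolding edge_dist_def e by (simp add: Inf_enat_def)
    then show False using assms by simp
  qed
  then obtain k where "k \<in> ?A" by blast
  then have "Inf ?A \<in> ?A" by (rule wellorder_InfI)
  then obtain Es xs where "edge_dist d H E F = enat (length xs)" "proper_irredundant_chain d H E F Es xs"
    unfolding edge_dist_def by blast
  then show ?thesis using that[of Es xs] assms by (simp add: proper_irredundant_chain_def)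
qed

text \<open>
  A proper chain of least length is irredundant, because a proper subsequence is shorter.
\<close>

lemma edge_dist_le_proper_chain:
  assumes "proper_chain d H E F Es xs"
  shows "edge_dist d H E F \<le> enat (length xs)"
proof -
  define P where "P n \<longleftrightarrow> (\<exists>Es xs. proper_chain d H E F Es xs \<and> length xs = n)" for n
  have "P (length xs)" unfolding P_def using assms by blast
  define n where "n = (LEAST n. P n)"
  have n: "P n" unfolding n_def using \<open>P (length xs)\<close> by (rule LeastI)
  have n_least: "n \<le> m" if "P m" for m unfolding n_def using that by (rule Least_le)
  obtain Es' xs' where c: "proper_chain d H E F Es' xs'" "length xs' = n" using n unfolding P_def by blast
  have "proper_irredundant_chain d H E F Es' xs'"
    unfolding proper_irredundant_chain_def
  proof (intro conjI notI)
    assume "\<exists>Es'' xs''. proper_chain d H E F Es'' xs'' \<and> strict_subseq (chain_seq Es'' xs'') (chain_seq Es' xs')"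
    then obtain Es'' xs'' where c'': "proper_chain d H E F Es'' xs''"
      and ss: "strict_subseq (chain_seq Es'' xs'') (chain_seq Es' xs')" by blast
    have "length (chain_seq Es'' xs'') < length (chain_seq Es' xs')"
    proof -
      have sub: "subseq (chain_seq Es'' xs'') (chain_seq Es' xs')" "chain_seq Es'' xs'' \<noteq> chain_seq Es' xs'"
        using ss by simp_all
      have "length (chain_seq Es'' xs'') \<le> length (chain_seq Es' xs')"
        using sub(1) by (rule list_emb_length)
      moreover have "length (chain_seq Es'' xs'') \<noteq> length (chain_seq Es' xs')"
        using subseq_same_length[OF sub(1)] sub(2) by blast
      ultimately show ?thesis by simp
    qed
    moreover have "length Es' = Suc (length xs')" "length Es'' = Suc (length xs'')"
      using c c'' by (auto simp: proper_chain_def chain_def)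
    ultimately have "length xs'' < n" using c by (simp add: chain_seq_def)
    moreover have "n \<le> length xs''" by (rule n_least) (use c'' P_def in blast)
    ultimately show False by simp
  qed (rule c)
  then have "edge_dist d H E F \<le> enat (length xs')"
    unfolding edge_dist_def by (intro Inf_lower) blast
  also have "\<dots> \<le> enat (length xs)" using c(2) n_least[OF \<open>P (length xs)\<close>] by simp
  finally show ?thesis .
qed

text \<open>
  A proper step changes the number of vertices in \<open>F\<close> by at most one. Under the length bound the chain from
  \<open>E\<close> to \<open>F\<close> can afford no detour: already its first step gains a vertex of \<open>F\<close> and loses one outside \<open>F\<close>.
\<close>

lemma short_chain_imp_exchange:
  assumes uni: "uniform_hypergraph d H" and fin: "\<And>E. E \<in> edges H \<Longrightarrow> finite E" and d: "d \<ge> 1"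
    and ch: "proper_chain d H E F Es xs" and EF: "E \<noteq> F"
    and len: "length xs + card (E \<inter> F) \<le> d"
  shows "\<exists>e\<in>E - F. \<exists>f\<in>F - E. insert f (E - {e}) \<in> edges H"
proof -
  define n where "n = length xs"
  have Es: "length Es = Suc n" "set Es \<subseteq> edges H" "hd Es = E" "last Es = F"
    and step: "\<And>i. i < n \<Longrightarrow> card (Es ! i \<inter> Es ! Suc i) = d - 1"
    using ch by (auto simp: proper_chain_def chain_def n_def)
  have "Es \<noteq> []" using Es(1) by auto
  have E0: "Es ! 0 = E" and En: "Es ! n = F"
    using Es \<open>Es \<noteq> []\<close> by (auto simp: hd_conv_nth last_conv_nth)
  have ed: "Es ! i \<in> edges H" if "i \<le> n" for i using Es(1,2) that nth_mem[of i Es] by auto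
  have cd: "card A = d" if "A \<in> edges H" for A using uni that by (simp add: uniform_hypergraph_def)
  have n0: "n > 0" using E0 En EF by (cases n) auto
  have close: "card (Es ! i \<inter> F) + (n - i) \<ge> d" if "i \<le> n" for i
    using that
  proof (induction "n - i" arbitrary: i)
    case 0
    then show ?case using En cd ed by auto
  next
    case (Suc k)
    let ?A = "Es ! i" and ?B = "Es ! Suc i"
    have AB: "?A \<in> edges H" "?B \<in> edges H" "card (?A \<inter> ?B) = d - 1" using ed step Suc by auto
    have "card (?B - ?A) = card ?B - card (?A \<inter> ?B)"
      using fin[OF AB(2)] by (simp add: card_Diff_subset_Int Int_commute)
    then have 1: "card (?B - ?A) = 1" using AB cd d by simp
    have "?B \<inter> F \<subseteq> (?A \<inter> F) \<union> (?B - ?A)" by blast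
    then have "card (?B \<inter> F) \<le> card ((?A \<inter> F) \<union> (?B - ?A))"
      using fin AB by (intro card_mono) auto
    also have "\<dots> \<le> card (?A \<inter> F) + 1" using card_Un_le[of "?A \<inter> F" "?B - ?A"] 1 by simp
    finally have "card (?B \<inter> F) \<le> card (?A \<inter> F) + 1" .
    moreover have "card (?B \<inter> F) + (n - Suc i) \<ge> d" using Suc by (intro Suc.hyps) auto
    ultimately show ?case using Suc by linarith
  qed
  define M where "M = Es ! 1"
  have M: "M \<in> edges H" "card (E \<inter> M) = d - 1" using ed[of 1] step[of 0] n0 E0 by (auto simp: M_def)
  have EH: "E \<in> edges H" using ed[of 0] E0 by simp
  have "card (M \<inter> F) + (n - 1) \<ge> d" using close[of 1] n0 by (simp add: M_def)
  then have more: "card (M \<inter> F) > card (E \<inter> F)" using len n0 unfolding n_def by arith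
  have "card (E - M) = 1" using fin[OF EH] M EH cd d by (simp add: card_Diff_subset_Int)
  moreover have "card (M - E) = 1" using fin[OF M(1)] M cd d by (simp add: card_Diff_subset_Int Int_commute)
  ultimately obtain e f where e: "E - M = {e}" and f: "M - E = {f}" by (auto simp: card_1_singleton_iff)
  have Mef: "M = insert f (E - {e})" using e f by blast
  have fF: "f \<in> F"
  proof (rule ccontr)
    assume "f \<notin> F"
    then have "card (M \<inter> F) \<le> card (E \<inter> F)" using fin[OF EH] Mef by (intro card_mono) auto
    then show False using more by simp
  qed
  have "e \<notin> F"
  proof
    assume "e \<in> F"
    have "M \<inter> F = insert f ((E \<inter> F) - {e})" using Mef fF by blast
    then have "card (M \<inter> F) \<le> Suc (card ((E \<inter> F) - {e}))" using fin[OF EH] by (simp add: card_insert_if)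
    also have "\<dots> = card (E \<inter> F)"
      using \<open>e \<in> F\<close> e fin[OF EH] by (intro card.remove[symmetric, THEN trans]) (auto simp: card_Suc_Diff1)
    finally show False using more by simp
  qed
  then show ?thesis using e f fF M(1) Mef by blast
qed

lemma properly_connected_exchange:
  assumes pc: "properly_connected d H" and fin: "\<And>E. E \<in> edges H \<Longrightarrow> finite E" and d: "d \<ge> 1"
  shows "exchange (edges H)"
  unfolding exchange_def
proof (intro ballI impI)
  fix E F assume EF: "E \<in> edges H" "F \<in> edges H" "E \<noteq> F" "E \<inter> F \<noteq> {}"
  have uni: "uniform_hypergraph d H" using pc by (simp add: properly_connected_def)
  have "edge_dist d H E F = enat (d - card (E \<inter> F))" using pc EF by (simp add: properly_connected_def)
  then obtain Es xs where "proper_chain d H E F Es xs" "length xs \<le> d - card (E \<inter> F)"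
    using edge_dist_le_imp_proper_chain[of d H E F] by (metis order_refl)
  moreover have "card (E \<inter> F) \<le> d"
    using uni EF card_mono[OF fin[OF EF(1)], of "E \<inter> F"] by (auto simp: uniform_hypergraph_def)
  ultimately show "\<exists>e\<in>E - F. \<exists>f\<in>F - E. insert f (E - {e}) \<in> edges H"
    using short_chain_imp_exchange[OF uni fin d _ EF(3)] by simp
qed

lemma far_imp_t_disjoint:
  assumes pc: "properly_connected d H" and fin: "\<And>E. E \<in> edges H \<Longrightarrow> finite E" and d: "d \<ge> 1"
    and far: "far (edges H) E F" and E: "E \<noteq> F"
  shows "t_disjoint d H (d + 1) E F"
proof (rule ccontr)
  assume "\<not> ?thesis"
  then have "edge_dist d H E F < enat (Suc d)" by (simp add: t_disjoint_def)
  then have "edge_dist d H E F \<le> enat d" by (cases "edge_dist d H E F") auto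
  then obtain Es xs where ch: "proper_chain d H E F Es xs" "length xs \<le> d"
    by (rule edge_dist_le_imp_proper_chain)
  have uni: "uniform_hypergraph d H" using pc by (simp add: properly_connected_def)
  have "E \<inter> F = {}" using far by (simp add: far_def)
  then have "length xs + card (E \<inter> F) \<le> d" using ch by simp
  from short_chain_imp_exchange[OF uni fin d ch(1) E this] far show False
    unfolding far_def by blast
qed

text \<open>
  Repeated exchange leads from \<open>M\<close> to \<open>F\<close>. The vertices that a chain has to list, which must be distinct, are found
  for free: every step after the first uses the vertex of \<open>F\<close> that the previous step has gained, and the
  first step uses the given \<open>x\<close>.
\<close>

lemma exchange_path:
  assumes uni: "uniform_hypergraph d H" and fin: "\<forall>E\<in>edges H. finite E"
    and ex: "exchange (edges H)" and F: "F \<in> edges H"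
  shows "\<lbrakk>M \<in> edges H; x \<in> M \<inter> F; card (F - M) = k\<rbrakk> \<Longrightarrow>
    \<exists>Es ys. length Es = Suc k \<and> length ys = k \<and> Es ! 0 = M \<and> last Es = F \<and> set Es \<subseteq> edges H \<and>
      distinct Es \<and> distinct ys \<and> set ys \<subseteq> insert x (F - M) \<and> (\<forall>N\<in>set Es. M \<inter> F \<subseteq> N) \<and>
      (\<forall>i<k. ys ! i \<in> Es ! i \<and> ys ! i \<in> Es ! Suc i \<and> card (Es ! i \<inter> Es ! Suc i) = d - 1)"
proof (induction k arbitrary: M x)
  case 0
  have "F \<subseteq> M" using 0 bspec[OF fin F] by simp
  moreover have "card F = card M" using uni F 0 by (simp add: uniform_hypergraph_def)
  ultimately have "M = F" using bspec[OF fin 0(1)] by (metis card_subset_eq)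
  then show ?case using F by (intro exI[of _ "[F]"] exI[of _ "[]"]) simp
next
  case (Suc k)
  have "M \<noteq> F" "M \<inter> F \<noteq> {}" using Suc.prems by auto
  then obtain e f where ef: "e \<in> M - F" "f \<in> F - M" "insert f (M - {e}) \<in> edges H"
    using ex[unfolded exchange_def, rule_format, OF Suc.prems(1) F] by meson
  define M' where "M' = insert f (M - {e})"
  have "F - M' = (F - M) - {f}" using ef by (auto simp: M'_def)
  then have ck: "card (F - M') = k" using Suc.prems(3) ef by simp
  have M'H: "M' \<in> edges H" using ef by (simp add: M'_def)
  have fM: "f \<in> M' \<inter> F" using ef by (simp add: M'_def)
  obtain Es ys where IH: "length Es = Suc k" "length ys = k" "Es ! 0 = M'" "last Es = F" "set Es \<subseteq> edges H"
      "distinct Es" "distinct ys" "set ys \<subseteq> insert f (F - M')" "\<forall>N\<in>set Es. M' \<inter> F \<subseteq> N"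
      "\<forall>i<k. ys ! i \<in> Es ! i \<and> ys ! i \<in> Es ! Suc i \<and> card (Es ! i \<inter> Es ! Suc i) = d - 1"
    using Suc.IH[OF M'H fM ck] by (elim exE conjE) 
  have ysF: "set ys \<subseteq> F - M" using IH(8) ef by (auto simp: M'_def)
  have MM': "M \<inter> F \<subseteq> M' \<inter> F" using ef by (auto simp: M'_def)
  have "M \<notin> set Es" using IH(9) fM ef by blast
  then have 1: "distinct (M # Es)" using IH(6) by simp
  have "x \<notin> set ys" using ysF Suc.prems by blast
  then have 2: "distinct (x # ys)" using IH(7) by simp
  have 3: "\<forall>N\<in>set (M # Es). M \<inter> F \<subseteq> N"
  proof
    fix N assume "N \<in> set (M # Es)"
    then have "N = M \<or> M' \<inter> F \<subseteq> N" using IH(9) by auto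
    then show "M \<inter> F \<subseteq> N" using MM' by blast
  qed
  have "M \<inter> M' = M - {e}" using ef by (auto simp: M'_def)
  then have "card (M \<inter> M') = d - 1"
    using uni Suc.prems(1) ef bspec[OF fin Suc.prems(1)] by (simp add: uniform_hypergraph_def)
  moreover have "x \<in> M'" using Suc.prems ef by (auto simp: M'_def)
  ultimately have 4: "\<forall>i<Suc k. (x # ys) ! i \<in> (M # Es) ! i \<and> (x # ys) ! i \<in> (M # Es) ! Suc i \<and>
      card ((M # Es) ! i \<inter> (M # Es) ! Suc i) = d - 1"
    using IH(3,10) Suc.prems(2) by (simp add: All_less_Suc2)
  have 5: "set (x # ys) \<subseteq> insert x (F - M)" using ysF by auto
  have 6: "set (M # Es) \<subseteq> edges H" using IH(5) Suc.prems(1) by simp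
  have 7: "last (M # Es) = F" using IH(1,4) by auto
  show ?case
    by (rule exI[of _ "M # Es"], rule exI[of _ "x # ys"], intro conjI 1 2 3 4 5 6 7) (use IH(1,2) in simp_all)
qed

text \<open>
  If one exchange leads from \<open>E\<close> to an edge \<open>M\<close> that meets \<open>F\<close> in one vertex, then \<open>exchange_path\<close> continues to \<open>F\<close>
  with \<open>d - 1\<close> further steps, so the distance is at most \<open>d\<close>.
\<close>

lemma t_disjoint_imp_far:
  assumes pc: "properly_connected d H" and fin: "\<And>E. E \<in> edges H \<Longrightarrow> finite E" and d: "d \<ge> 2"
    and sub: "\<And>E. E \<in> edges H \<Longrightarrow> E \<subseteq> verts H"
    and EF: "E \<in> edges H" "F \<in> edges H" and t: "t_disjoint d H (d + 1) E F"
  shows "far (edges H) E F"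
proof -
  have uni: "uniform_hypergraph d H" using pc by (simp add: properly_connected_def)
  have fin': "\<forall>E\<in>edges H. finite E" using fin by blast
  have ex: "exchange (edges H)" using pc fin d by (intro properly_connected_exchange) auto
  have disj: "E \<inter> F = {}"
  proof (rule ccontr)
    assume "E \<inter> F \<noteq> {}"
    then have "edge_dist d H E F = enat (d - card (E \<inter> F))" using pc EF by (simp add: properly_connected_def)
    then show False using t by (simp add: t_disjoint_def)
  qed
  have "insert f (E - {e}) \<notin> edges H" if e: "e \<in> E" and f: "f \<in> F" for e f
  proof
    define M where "M = insert f (E - {e})"
    assume "insert f (E - {e}) \<in> edges H"
    then have MH: "M \<in> edges H" by (simp add: M_def)
    have MF: "M \<inter> F = {f}" using f disj by (auto simp: M_def)
    have cE: "card E = d" "card F = d" using uni EF by (simp_all add: uniform_hypergraph_def)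
    have "F - M = F - {f}" using MF by blast
    then have "card (F - M) = d - 1" using f cE fin[OF EF(2)] by simp
    moreover have "f \<in> M \<inter> F" using MF by blast
    ultimately obtain Es ys where
      IH: "length Es = Suc (d - 1)" "length ys = d - 1" "Es ! 0 = M" "last Es = F" "set Es \<subseteq> edges H"
      "distinct Es" "distinct ys" "set ys \<subseteq> insert f (F - M)" "\<forall>N\<in>set Es. M \<inter> F \<subseteq> N"
      "\<forall>i<d - 1. ys ! i \<in> Es ! i \<and> ys ! i \<in> Es ! Suc i \<and> card (Es ! i \<inter> Es ! Suc i) = d - 1"
      using exchange_path[OF uni fin' ex EF(2) MH, of f "d - 1"] by (elim meta_impE exE conjE)
    have EM: "E \<inter> M = E - {e}" using f disj by (auto simp: M_def)
    then have cEM: "card (E \<inter> M) = d - 1" using e cE fin[OF EF(1)] by simp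
    then obtain x where x: "x \<in> E \<inter> M" using d by (metis card.empty diff_is_0_eq ex_in_conv not_less_eq_eq numeral_2_eq_2 One_nat_def)
    have "set ys \<subseteq> F" using IH(8) f by auto
    then have ysV: "set ys \<subseteq> verts H" using sub[OF EF(2)] by (rule subset_trans)
    have "x \<notin> set ys" using x IH(8) disj f by blast
    moreover have "E \<notin> set Es" using IH(9) MF disj f by blast
    ultimately have "proper_chain d H E F (E # Es) (x # ys)"
      unfolding proper_chain_def chain_def
      using IH x cEM EF sub[OF EF(1)] ysV by (auto simp: All_less_Suc2)
    then have "edge_dist d H E F \<le> enat (length (x # ys))" by (rule edge_dist_le_proper_chain)
    then have "edge_dist d H E F \<le> enat d" using IH(2) d by simp
    moreover have "enat (d + 1) \<le> edge_dist d H E F" using t by (simp add: t_disjoint_def)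
    ultimately have "enat (d + 1) \<le> enat d" by (rule order_trans[rotated])
    then show False by simp
  qed
  then show ?thesis using disj by (simp add: far_def)
qed

section \<open>Edge ideals as monomial ideals\<close>

context koszul
begin

lemma prod_variable: "finite E \<Longrightarrow> (\<Prod>x\<in>E. variable x) = (single (sqfree_mon E) 1 :: ('v,'k) mpoly)"
  by (induction E rule: finite_induct) (simp_all add: sqfree_mon_def variable_def mult_single)

lemma edge_ideal_eq:
  assumes X: "X = verts H" and sub: "\<And>E. E \<in> edges H \<Longrightarrow> E \<subseteq> X"
  shows "edge_ideal H = (polys X \<inter> mon_ideal (multiples (sqfree ` edges H)) :: ('v, 'k) mpoly set)"
proof -
  have finE: "finite E" if "E \<in> edges H" for E using sub[OF that] finX finite_subset by blast
  have finH: "finite (edges H)" by (rule finite_subset[of _ "Pow X"]) (use sub finX in auto)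
  have tm: "single (sqfree_mon E) 1 \<in> mon_ideal (multiples (sqfree ` edges H)) \<inter> (polys X :: ('v,'k) mpoly set)" if "E \<in> edges H" for E
    using that sub[OF that] by (auto simp: mon_ideal_def multiples_def polys_def keys_sqfree_mon lookup_sqfree_mon le_fun_def intro!: bexI[of _ E])
  show ?thesis
  proof (intro subset_antisym subsetI)
    fix p :: "('v,'k) mpoly" assume "p \<in> edge_ideal H"
    then obtain f where f: "\<forall>E\<in>edges H. f E \<in> polys X" and p: "p = (\<Sum>E\<in>edges H. f E * (\<Prod>x\<in>E. variable x))"
      unfolding edge_ideal_def X by blast
    have p': "p = (\<Sum>E\<in>edges H. f E * single (sqfree_mon E) 1)"
      unfolding p by (rule sum.cong) (simp_all add: prod_variable finE)
    have "p \<in> mon_ideal (multiples (sqfree ` edges H))" unfolding p' using tm by (intro mon_ideal_sum mon_ideal_mult upset_multiples) blast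
    moreover have "p \<in> polys X" unfolding p' using tm f by (intro polys_sum polys_mult) blast+
    ultimately show "p \<in> polys X \<inter> mon_ideal (multiples (sqfree ` edges H))" by blast
  next
    fix p :: "('v,'k) mpoly" assume p: "p \<in> polys X \<inter> mon_ideal (multiples (sqfree ` edges H))"
    have "\<forall>m\<in>keys p. \<exists>E\<in>edges H. sqfree E \<le> lookup m" using p by (auto simp: mon_ideal_def multiples_def)
    then obtain \<phi> where \<phi>: "\<And>m. m \<in> keys p \<Longrightarrow> \<phi> m \<in> edges H" "\<And>m. m \<in> keys p \<Longrightarrow> sqfree (\<phi> m) \<le> lookup m"
      by metis
    define f where "f E = (\<Sum>m\<in>{m\<in>keys p. \<phi> m = E}. single (m - sqfree_mon E) (lookup p m))" for E
    have split: "(m - sqfree_mon (\<phi> m)) + sqfree_mon (\<phi> m) = m" if "m \<in> keys p" for m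
    proof (rule poly_mapping_eqI)
      fix x
      have "sqfree (\<phi> m) x \<le> lookup m x" using \<phi>(2)[OF that] by (simp add: le_fun_def)
      then show "lookup (m - sqfree_mon (\<phi> m) + sqfree_mon (\<phi> m)) x = lookup m x"
        using sub[OF \<phi>(1)[OF that]] by (simp add: lookup_add lookup_minus lookup_sqfree_mon)
    qed
    have "f E \<in> polys X" for E
    proof -
      have "single (m - sqfree_mon E) (lookup p m) \<in> polys X" if "m \<in> keys p" for m
      proof -
        have "keys m \<subseteq> X" using that p by (simp add: polys_def)
        moreover have "keys (m - sqfree_mon E) \<subseteq> keys m" by (auto simp: in_keys_iff lookup_minus)
        ultimately have "keys (m - sqfree_mon E) \<subseteq> X" by (rule subset_trans[rotated])
        then show ?thesis by (simp add: polys_def)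
      qed
      then show ?thesis unfolding f_def by (intro polys_sum) blast
    qed
    moreover have "p = (\<Sum>E\<in>edges H. f E * (\<Prod>x\<in>E. variable x))"
    proof -
      have "(\<Sum>E\<in>edges H. f E * (\<Prod>x\<in>E. variable x)) = (\<Sum>E\<in>edges H. \<Sum>m\<in>{m\<in>keys p. \<phi> m = E}. single m (lookup p m))"
      proof (rule sum.cong, simp)
        fix E assume E: "E \<in> edges H"
        have "f E * (\<Prod>x\<in>E. variable x) = (\<Sum>m\<in>{m\<in>keys p. \<phi> m = E}. single (m - sqfree_mon E + sqfree_mon E) (lookup p m))"
          by (simp add: prod_variable finE E f_def sum_distrib_right mult_single)
        also have "\<dots> = (\<Sum>m\<in>{m\<in>keys p. \<phi> m = E}. single m (lookup p m))"
          by (rule sum.cong) (use split in auto)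
        finally show "f E * (\<Prod>x\<in>E. variable x) = (\<Sum>m\<in>{m\<in>keys p. \<phi> m = E}. single m (lookup p m))" .
      qed
      also have "\<dots> = (\<Sum>m\<in>keys p. single m (lookup p m))"
        by (rule sum.group) (use \<phi>(1) finH in auto)
      finally show ?thesis by (simp add: sum_single_keys)
    qed
    ultimately show "p \<in> edge_ideal H" unfolding edge_ideal_def X by blast
  qed
qed

section \<open>The Koszul class of pairwise far edges\<close>

text \<open>
  Let \<open>\<gamma>\<close> be a chain on sets that contain two elements of one block and one of every other. Each such set
  \<open>insert x S\<close> has exactly two facets that are transversals, obtained by removing one of the two elements
  \<open>x\<close>, \<open>y\<close> of the same block. As blocks are intervals in the order, \<open>x\<close> and \<open>y\<close> are adjacent in that set, and the
  two facets have opposite signs.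
\<close>

lemma transversal_sum_zero:
  fixes \<gamma> :: "'v set \<Rightarrow> 'k"
  assumes fin: "finite SS" and disj: "\<And>E F. E \<in> SS \<Longrightarrow> F \<in> SS \<Longrightarrow> E \<noteq> F \<Longrightarrow> E \<inter> F = {}"
    and Y: "\<Union>SS = Y" "Y \<subseteq> X"
    and block: "\<And>E a b y. \<lbrakk>E \<in> SS; a \<in> E; b \<in> E; y \<in> Y; idx a < idx y; idx y < idx b\<rbrakk> \<Longrightarrow> y \<in> E"
    and Tr: "Tr = {S. S \<subseteq> Y \<and> (\<forall>E\<in>SS. \<exists>y. S \<inter> E = {y})}"
  shows "(\<Sum>S\<in>Tr. \<Sum>x\<in>Y - S. ksgn x S * \<gamma> (insert x S)) = 0"
proof -
  have finY: "finite Y" using Y(2) finX finite_subset by blast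
  \<comment> \<open>The third component is the element of \<open>S\<close> in the block of \<open>x\<close>.\<close>
  define A where "A = {(S, x, y). S \<in> Tr \<and> x \<in> Y - S \<and> y \<in> S \<and> (\<exists>E\<in>SS. x \<in> E \<and> y \<in> E)}"
  define h where "h = (\<lambda>(S, x, y :: 'v). ksgn x S * \<gamma> (insert x S) :: 'k)"
  define lt where "lt = (\<lambda>(S :: 'v set, x, y). idx x < idx y)"
  define gt where "gt = (\<lambda>(S :: 'v set, x, y). idx y < idx x)"
  have finTr: "finite Tr" by (rule finite_subset[of _ "Pow Y"]) (use Tr finY in auto)
  have mate: "\<exists>!y. y \<in> S \<and> (\<exists>E\<in>SS. x \<in> E \<and> y \<in> E)" if "S \<in> Tr" "x \<in> Y - S" for S x
  proof -
    obtain E where E: "E \<in> SS" "x \<in> E" using \<open>x \<in> Y - S\<close> Y(1) by blast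
    then obtain y where y: "S \<inter> E = {y}" using \<open>S \<in> Tr\<close> Tr by blast
    have "F = E" if F: "F \<in> SS" "x \<in> F" for F using disj[OF F(1) E(1)] F(2) E(2) by blast
    then show ?thesis using E y by (intro ex1I[of _ y]) blast+
  qed
  have key: "insert x (S - {y}) \<in> Tr \<and> ksgn y (insert x (S - {y})) = - (ksgn x S :: 'k) \<and> idx x \<noteq> idx y"
    if S: "S \<in> Tr" and x: "x \<in> Y - S" and y: "y \<in> S" and E: "E \<in> SS" "x \<in> E" "y \<in> E" for S x y E
  proof -
    have SY: "S \<subseteq> Y" using S Tr by blast
    define R where "R = S - {y}"
    have finR: "finite R" using SY finY finite_subset by (auto simp: R_def)
    obtain y' where y': "S \<inter> E = {y'}" using S Tr E(1) by blast
    have "y \<in> S \<inter> E" using y E(3) by simp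
    then have SE: "S \<inter> E = {y}" using y' by simp
    have neq: "idx x \<noteq> idx y" using x y SY Y(2) inj_idx by (metis Diff_iff inj_onD subsetD)
    have "insert x R \<inter> F = (if F = E then {x} else S \<inter> F)" if "F \<in> SS" for F
      using disj[OF that E(1)] E SE by (auto simp: R_def)
    then have "insert x R \<in> Tr" using S x SY unfolding Tr R_def by auto
    moreover have eqR: "{z \<in> R. idx z < idx x} = {z \<in> R. idx z < idx y}"
    proof -
      have "idx z < idx x \<longleftrightarrow> idx z < idx y" if z: "z \<in> R" for z
      proof -
        have zY: "z \<in> Y" "z \<in> X" using z SY Y(2) by (auto simp: R_def)
        have zE: "z \<notin> E" using z SE by (auto simp: R_def)
        have "idx z \<noteq> idx x" using zE E zY x Y(2) inj_idx by (metis Diff_iff inj_onD subsetD)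
        moreover have "idx z \<noteq> idx y" using zE E zY y SY Y(2) inj_idx by (metis inj_onD subsetD)
        moreover have "\<not> (idx x < idx z \<and> idx z < idx y)" using block[OF E(1,2,3) zY(1)] zE by blast
        moreover have "\<not> (idx y < idx z \<and> idx z < idx x)" using block[OF E(1,3,2) zY(1)] zE by blast
        ultimately show ?thesis by linarith
      qed
      then show ?thesis by blast
    qed
    then have "ksgn x R = (ksgn y R :: 'k)" by (simp add: ksgn_def)
    moreover have "S = insert y R" "y \<notin> R" "x \<notin> R" using y x by (auto simp: R_def)
    ultimately have "ksgn y (insert x R) = - (ksgn x S :: 'k)"
      using finR neq by (simp add: ksgn_insert)
    then show ?thesis using \<open>insert x R \<in> Tr\<close> neq by (simp add: R_def)
  qed
  have "(\<Sum>S\<in>Tr. \<Sum>x\<in>Y - S. ksgn x S * \<gamma> (insert x S)) = (\<Sum>(S, x)\<in>Sigma Tr (\<lambda>S. Y - S). ksgn x S * \<gamma> (insert x S))"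
    using finTr finY by (subst sum.Sigma) auto
  also have "\<dots> = (\<Sum>p\<in>A. h p)"
  proof (rule sum.reindex_bij_witness[where
      i = "\<lambda>(S, x, y). (S, x)" and j = "\<lambda>(S, x). (S, x, THE y. y \<in> S \<and> (\<exists>E\<in>SS. x \<in> E \<and> y \<in> E))"])
    fix p assume "p \<in> Sigma Tr (\<lambda>S. Y - S)"
    then obtain S x where p: "p = (S, x)" "S \<in> Tr" "x \<in> Y - S" by blast
    from theI'[OF mate[OF p(2,3)]] p
    show "(case p of (S, x) \<Rightarrow> (S, x, THE y. y \<in> S \<and> (\<exists>E\<in>SS. x \<in> E \<and> y \<in> E))) \<in> A"
      by (simp add: A_def)
  next
    fix q assume "q \<in> A"
    then obtain S x y where q: "q = (S, x, y)" "S \<in> Tr" "x \<in> Y - S" "y \<in> S \<and> (\<exists>E\<in>SS. x \<in> E \<and> y \<in> E)"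
      unfolding A_def by blast
    show "(case case q of (S, x, y) \<Rightarrow> (S, x) of (S, x) \<Rightarrow> (S, x, THE y. y \<in> S \<and> (\<exists>E\<in>SS. x \<in> E \<and> y \<in> E))) = q"
      using the1_equality[OF mate[OF q(2,3)] q(4)] q(1) by simp
  qed (auto simp: A_def h_def)
  also have "\<dots> = (\<Sum>p\<in>{p\<in>A. lt p}. h p) + (\<Sum>p\<in>{p\<in>A. gt p}. h p)"
  proof -
    have "finite A"
      by (rule finite_subset[of _ "Tr \<times> Y \<times> Y"]) (use Tr finTr finY in \<open>auto simp: A_def\<close>)
    moreover have "A = {p\<in>A. lt p} \<union> {p\<in>A. gt p}"
    proof -
      have "lt p \<or> gt p" if p: "p \<in> A" for p
      proof -
        obtain S x y where eq: "p = (S, x, y)" by (cases p)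
        then have A: "S \<in> Tr" "x \<in> Y - S" "y \<in> S" "\<exists>E\<in>SS. x \<in> E \<and> y \<in> E" using p by (simp_all add: A_def)
        then have "idx x \<noteq> idx y" using key[OF A(1-3)] by blast
        then show ?thesis by (simp add: eq lt_def gt_def nat_neq_iff)
      qed
      then show ?thesis by blast
    qed
    moreover have "{p\<in>A. lt p} \<inter> {p\<in>A. gt p} = {}" by (auto simp: lt_def gt_def)
    ultimately show ?thesis
      by (metis (no_types, lifting) finite_Un sum.union_disjoint)
  qed
  also have "(\<Sum>p\<in>{p\<in>A. gt p}. h p) = (\<Sum>p\<in>{p\<in>A. lt p}. - h p)"
  proof -
    have sw: "(insert x (S - {y}), y, x) \<in> A \<and> insert y (insert x (S - {y}) - {x}) = S \<and>
        h (S, x, y) = - h (insert x (S - {y}), y, x)" if "(S, x, y) \<in> A" for S x y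
    proof -
      have A: "S \<in> Tr" "x \<in> Y - S" "y \<in> S" using that by (auto simp: A_def)
      have "\<exists>E\<in>SS. x \<in> E \<and> y \<in> E" using that by (simp add: A_def)
      then obtain E where E: "E \<in> SS" "x \<in> E" "y \<in> E" by blast
      have "y \<in> Y" using A Tr by blast
      moreover have "insert y (insert x (S - {y})) = insert x S" using A by blast
      moreover have "x \<noteq> y" using A by blast
      ultimately show ?thesis using key[OF A E] A E by (auto simp: A_def h_def)
    qed
    define swp where "swp = (\<lambda>(S :: 'v set, x, y). (insert x (S - {y}), y, x))"
    have swp: "swp p \<in> A" "swp (swp p) = p" "- h (swp p) = h p" if "p \<in> A" for p
    proof -
      obtain S x y where p: "p = (S, x, y)" by (cases p)
      show "swp p \<in> A" "swp (swp p) = p" "- h (swp p) = h p"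
        using sw[OF that[unfolded p]] by (simp_all add: p swp_def)
    qed
    have flip: "lt (swp p) = gt p" "gt (swp p) = lt p" for p
      by (cases p; simp add: swp_def lt_def gt_def)+
    show ?thesis
      by (rule sum.reindex_bij_witness[where i = swp and j = swp]) (simp_all add: swp flip)
  qed
  finally show ?thesis by (simp add: sum_negf)
qed

text \<open>
  The class is that of \<open>x\<^sup>Y\<^sup>-\<^sup>S\<^sup>0 e\<^sub>S\<^sub>0\<close>, with \<open>Y\<close> the union of the edges in \<open>SS\<close> and \<open>S0\<close> a transversal. It is
  a cycle modulo \<open>I\<close>, since removing a vertex from \<open>S0\<close> completes an edge outside \<open>S0\<close>. For a transversal \<open>S\<close> the set
  \<open>Y - S\<close> contains no edge, so the coefficients at transversals survive modulo \<open>I\<close>, and their sum is 1 for the cycle but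
  0 for a boundary.
\<close>

lemma disjoint_edges_koszul_class:
  assumes EE: "\<And>E. E \<in> EE \<Longrightarrow> E \<subseteq> X \<and> card E = d" and d: "d \<ge> 1"
    and SS: "SS \<subseteq> EE" "\<And>E F. E \<in> SS \<Longrightarrow> F \<in> SS \<Longrightarrow> E \<noteq> F \<Longrightarrow> E \<inter> F = {}"
    and ind: "\<And>G. \<lbrakk>G \<in> EE; G \<subseteq> \<Union>SS\<rbrakk> \<Longrightarrow> G \<in> SS"
    and block: "\<And>E a b y. \<lbrakk>E \<in> SS; a \<in> E; b \<in> E; y \<in> \<Union>SS; idx a < idx y; idx y < idx b\<rbrakk> \<Longrightarrow> y \<in> E"
  shows "\<not> koszul_zero (multiples (sqfree ` EE)) (card SS) (card SS * d)"
proof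
  assume HK: "koszul_zero (multiples (sqfree ` EE)) (card SS) (card SS * d)"
  let ?U = "multiples (sqfree ` EE)"
  let ?c = "card SS"
  define Y where "Y = \<Union>SS"
  have YX: "Y \<subseteq> X" using SS(1) EE unfolding Y_def by blast
  have finY: "finite Y" using YX finX finite_subset by blast
  have finSS: "finite SS" using finY unfolding Y_def by (rule finite_UnionD)
  have finE: "finite E" if "E \<in> SS" for E using finY that unfolding Y_def by (meson Union_upper finite_subset)
  have "card Y = (\<Sum>E\<in>SS. card E)"
    unfolding Y_def using finE SS(2) by (intro card_Union_disjoint) (auto simp: pairwise_def disjnt_def)
  also have "\<dots> = ?c * d" using EE SS(1) by (simp add: subset_iff)
  finally have cardY: "card Y = ?c * d" .
  have "E \<noteq> {}" if "E \<in> SS" for E using EE SS(1) that d by fastforce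
  then have "\<forall>E\<in>SS. \<exists>x. x \<in> E" by blast
  from bchoice[OF this] obtain ch where ch: "\<And>E. E \<in> SS \<Longrightarrow> ch E \<in> E" by blast
  define S0 where "S0 = ch ` SS"
  define Tr where "Tr = {S. S \<subseteq> Y \<and> (\<forall>E\<in>SS. \<exists>y. S \<inter> E = {y})}"
  have S0Y: "S0 \<subseteq> Y" using ch by (auto simp: S0_def Y_def)
  have S0E: "S0 \<inter> E = {ch E}" if "E \<in> SS" for E
    using ch SS(2) that unfolding S0_def by blast
  have S0: "S0 \<in> Tr" using S0Y S0E by (auto simp: Tr_def)
  have "inj_on ch SS" using ch SS(2) by (metis disjoint_iff inj_onI)
  then have cardS0: "card S0 = ?c" unfolding S0_def by (rule card_image)
  define f where "f S a = (if S = S0 \<and> a = 0 then single (sqfree_mon (Y - S0)) 1 else 0 :: ('v,'k) mpoly)" for S and a :: nat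
  have YS: "Y - S \<subseteq> X" for S using YX by blast
  have f: "f \<in> koszul_ch ?c [0] (?c * d)"
  proof -
    have "card (Y - S0) + ?c = ?c * d"
      using card_Diff_subset[OF finite_subset[OF S0Y finY] S0Y] card_mono[OF finY S0Y] cardS0 cardY by simp
    then have "single (sqfree_mon (Y - S0)) 1 \<in> homog ?c (?c * d)"
      using keys_sqfree_mon[OF YS] mon_degree_sqfree_mon[OF YS] YS by (simp add: homog_def)
    moreover have "S0 \<subseteq> X" using S0Y YX by blast
    ultimately show ?thesis using cardS0 by (auto simp: koszul_ch_def free_deg_def f_def)
  qed
  have "bdrym f T 0 \<in> mon_ideal ?U" for T
  proof -
    have "ksgn x T * variable x * f (insert x T) 0 \<in> mon_ideal ?U" if x: "x \<in> X - T" for x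
    proof (cases "insert x T = S0")
      case True
      then obtain E where E: "E \<in> SS" "x = ch E" by (auto simp: S0_def)
      have "sqfree E \<le> lookup (single x 1 + sqfree_mon (Y - S0))"
      proof (rule le_funI)
        fix z
        have "z = x \<or> z \<in> Y - S0" if "z \<in> E" using that E S0E[OF E(1)] by (auto simp: Y_def)
        then show "sqfree E z \<le> lookup (single x 1 + sqfree_mon (Y - S0)) z"
          by (auto simp: lookup_add lookup_single lookup_sqfree_mon[OF YS] when_def)
      qed
      then have "variable x * single (sqfree_mon (Y - S0)) 1 \<in> mon_ideal ?U"
        using E SS(1) by (auto simp: variable_def mult_single mon_ideal_def multiples_def)
      then show ?thesis using True mon_ideal_mult[OF upset_multiples] by (simp add: f_def mult.assoc)
    qed (simp add: f_def)
    then show ?thesis unfolding bdrym_def bdry_def by (auto intro: mon_ideal_sum)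
  qed
  then obtain g where g: "g \<in> koszul_ch (Suc ?c) [0] (?c * d)" "\<And>S. f S 0 - bdrym g S 0 \<in> mon_ideal ?U"
    using HK f unfolding koszul_zero_def by blast
  \<comment> \<open>The coefficients of \<open>g\<close> in multidegree \<open>Y\<close>.\<close>
  define \<gamma> where "\<gamma> S = lookup (g S 0) (sqfree_mon (Y - S))" for S
  have eq: "(if S = S0 then 1 else 0) = (\<Sum>x\<in>Y - S. ksgn x S * \<gamma> (insert x S))" if S: "S \<in> Tr" for S
  proof -
    have SY: "S \<subseteq> Y" and SX: "S \<subseteq> X" using S YX by (auto simp: Tr_def)
    have "lookup (sqfree_mon (Y - S)) \<notin> ?U"
    proof
      assume "lookup (sqfree_mon (Y - S)) \<in> ?U"
      then obtain G where G: "G \<in> EE" "sqfree G \<le> lookup (sqfree_mon (Y - S))" by (auto simp: multiples_def)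
      have GY: "G \<subseteq> Y - S"
      proof
        fix z assume "z \<in> G"
        then show "z \<in> Y - S" using G(2)[unfolded le_fun_def, rule_format, of z] lookup_sqfree_mon[OF YS, of S z]
          by (auto simp del: Diff_iff split: if_splits simp: of_bool_def)
      qed
      then have "G \<in> SS" using ind[OF G(1)] by (auto simp: Y_def)
      then obtain y where "S \<inter> G = {y}" using S unfolding Tr_def by blast
      then have "y \<in> S \<inter> G" by simp
      then show False using GY by blast
    qed
    then have "lookup (f S 0 - bdrym g S 0) (sqfree_mon (Y - S)) = 0"
      using g(2)[of S] by (auto simp: mon_ideal_def in_keys_iff)
    then have "lookup (f S 0) (sqfree_mon (Y - S)) = lookup (bdrym g S 0) (sqfree_mon (Y - S))" by (simp add: lookup_minus)
    also have "\<dots> = (\<Sum>x\<in>X - S. ksgn x S * (if lookup (sqfree_mon (Y - S)) x > 0 then lookup (g (insert x S) 0) (sqfree_mon (Y - S) - single x 1) else 0))"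
      unfolding bdrym_def by (rule lookup_bdry_variable[OF SX])
    also have "\<dots> = (\<Sum>x\<in>Y - S. ksgn x S * \<gamma> (insert x S))"
    proof (rule sum.mono_neutral_cong_right)
      show "finite (X - S)" using finX by simp
      show "Y - S \<subseteq> X - S" using YX by blast
      show "\<forall>x\<in>X - S - (Y - S). ksgn x S * (if lookup (sqfree_mon (Y - S)) x > 0 then lookup (g (insert x S) 0) (sqfree_mon (Y - S) - single x 1) else 0) = 0"
      proof
        fix x assume "x \<in> X - S - (Y - S)"
        then have "lookup (sqfree_mon (Y - S)) x = 0" by (auto simp: lookup_sqfree_mon[OF YS])
        then show "ksgn x S * (if lookup (sqfree_mon (Y - S)) x > 0 then lookup (g (insert x S) 0) (sqfree_mon (Y - S) - single x 1) else 0) = 0"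
          by simp
      qed
      fix x assume x: "x \<in> Y - S"
      have "sqfree_mon (Y - S) - single x 1 = sqfree_mon (Y - insert x S)"
        using x by (intro poly_mapping_eqI) (auto simp: lookup_minus lookup_sqfree_mon[OF YS] lookup_single when_def)
      then show "ksgn x S * (if lookup (sqfree_mon (Y - S)) x > 0 then lookup (g (insert x S) 0) (sqfree_mon (Y - S) - single x 1) else 0)
          = ksgn x S * \<gamma> (insert x S)"
        using x by (simp add: \<gamma>_def lookup_sqfree_mon[OF YS])
    qed
    finally show ?thesis unfolding f_def by (cases "S = S0") simp_all
  qed
  have finTr: "finite Tr" by (rule finite_subset[of _ "Pow Y"]) (use finY in \<open>auto simp: Tr_def\<close>)
  have "(1 :: 'k) = (\<Sum>S\<in>Tr. if S = S0 then 1 else 0)" using finTr S0 by simp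
  also have "\<dots> = (\<Sum>S\<in>Tr. \<Sum>x\<in>Y - S. ksgn x S * \<gamma> (insert x S))"
    by (rule sum.cong) (simp_all add: eq)
  also have "\<dots> = 0"
    by (rule transversal_sum_zero[OF finSS SS(2) Y_def[symmetric] YX block[folded Y_def] Tr_def])
  finally show False by simp
qed

end

text \<open>
  Numbering the blocks and then the vertices lexicographically makes every block an interval.
\<close>

lemma block_enumeration:
  assumes "finite X" "finite SS" "\<And>E F. E \<in> SS \<Longrightarrow> F \<in> SS \<Longrightarrow> E \<noteq> F \<Longrightarrow> E \<inter> F = {}"
  shows "\<exists>idx :: 'v \<Rightarrow> nat. inj_on idx X \<and>
    (\<forall>E\<in>SS. \<forall>a\<in>E \<inter> X. \<forall>b\<in>E \<inter> X. \<forall>y\<in>\<Union>SS \<inter> X. idx a < idx y \<longrightarrow> idx y < idx b \<longrightarrow> y \<in> E)"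
proof -
  obtain h :: "'v \<Rightarrow> nat" and n where h: "h ` X = {i. i < n}" "inj_on h X"
    using finite_imp_inj_to_nat_seg[OF assms(1)] by blast
  obtain k :: "'v set \<Rightarrow> nat" where k: "inj_on k SS"
    using finite_imp_inj_to_nat_seg[OF assms(2)] by blast
  define bl where "bl x = k (SOME E. E \<in> SS \<and> x \<in> E)" for x
  define idx where "idx x = bl x * n + h x" for x
  have hn: "h x < n" if "x \<in> X" for x using h(1) that by blast
  have bl: "bl x = k E" if "E \<in> SS" "x \<in> E" for x E
  proof -
    have "(SOME E. E \<in> SS \<and> x \<in> E) \<in> SS \<and> x \<in> (SOME E. E \<in> SS \<and> x \<in> E)"
      using that by (intro someI[of "\<lambda>E. E \<in> SS \<and> x \<in> E"]) blast
    then have "(SOME E. E \<in> SS \<and> x \<in> E) = E" using assms(3) that by blast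
    then show ?thesis by (simp add: bl_def)
  qed
  have div: "idx x div n = bl x" "idx x mod n = h x" if "x \<in> X" for x
    using hn[OF that] by (simp_all add: idx_def)
  have "inj_on idx X"
  proof (rule inj_onI)
    fix x y assume "x \<in> X" "y \<in> X" "idx x = idx y"
    then have "h x = h y" using div by metis
    then show "x = y" using h(2) \<open>x \<in> X\<close> \<open>y \<in> X\<close> by (meson inj_onD)
  qed
  moreover have "y \<in> E" if E: "E \<in> SS" and a: "a \<in> E \<inter> X" and b: "b \<in> E \<inter> X" and y: "y \<in> \<Union>SS \<inter> X"
    and less: "idx a < idx y" "idx y < idx b" for E a b y
  proof -
    obtain F where F: "F \<in> SS" "y \<in> F" using y by blast
    have "bl a \<le> bl y" "bl y \<le> bl b"
      using div_le_mono[of "idx a" "idx y" n] div_le_mono[of "idx y" "idx b" n] less div a b y by auto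
    then have "k F = k E" using bl[OF E] bl[OF F] a b by auto
    then have "F = E" using k E F by (meson inj_onD)
    then show ?thesis using F by simp
  qed
  ultimately show ?thesis by blast
qed

section \<open>Regularity of the edge ideal\<close>

theorem theorem1p4:
  fixes H :: "'v hypergraph" and d c :: nat
    and I :: "('v, 'k::field) mpoly set"
  assumes "simple_hypergraph H"
    and "uniform_hypergraph d H"
    and "properly_connected d H"
    and "c = max_disjoint d H (d + 1)"
    and "I = edge_ideal H"
  shows "regularity (verts H) I \<ge> (int d - 1) * int c + 1 \<and>
    (triangulated d H \<longrightarrow> regularity (verts H) I = (int d - 1) * int c + 1)"
proof (cases "edges H = {}")
  case True
  have "I = {0}" using assms(5) True by (auto simp: edge_ideal_def)
  moreover have "{card S | S. S \<subseteq> edges H \<and> pairwise (t_disjoint d H (d + 1)) S} = {0}"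
    using True by auto
  then have "c = 0" using assms(4) by (simp add: max_disjoint_def)
  ultimately show ?thesis by (simp add: regularity_def)
next
  case False
  let ?X = "verts H"
  let ?EE = "edges H"
  have finX: "finite ?X" and EX: "\<And>E. E \<in> ?EE \<Longrightarrow> E \<subseteq> ?X" and E2: "\<And>E. E \<in> ?EE \<Longrightarrow> card E \<ge> 2"
    using assms(1) by (auto simp: simple_hypergraph_def)
  have cE: "\<And>E. E \<in> ?EE \<Longrightarrow> card E = d" using assms(2) by (simp add: uniform_hypergraph_def)
  obtain E0 where E0: "E0 \<in> ?EE" using False by blast
  have d: "d \<ge> 2" using E2[OF E0] cE[OF E0] by simp
  have fE: "\<And>E. E \<in> ?EE \<Longrightarrow> finite E" using EX finX finite_subset by blast
  have finEE: "finite ?EE" by (rule finite_subset[of _ "Pow ?X"]) (use EX finX in auto)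
  have ex: "exchange ?EE" using properly_connected_exchange[OF assms(3) fE] d by simp
  let ?C = "{card S | S. S \<subseteq> ?EE \<and> pairwise (t_disjoint d H (d + 1)) S}"
  have finC: "finite ?C"
    by (rule finite_subset[of _ "card ` Pow ?EE"]) (use finEE in auto)
  have c_max: "card S \<le> c" if "S \<subseteq> ?EE" "pairwise (t_disjoint d H (d + 1)) S" for S
  proof -
    have "card S \<in> ?C" using that by blast
    then show ?thesis unfolding assms(4) max_disjoint_def by (rule Max_ge[OF finC])
  qed
  have "card {} \<in> ?C" by (rule CollectI, rule exI[of _ "{}"]) simp
  then have "?C \<noteq> {}" by (metis empty_iff)
  from Max_in[OF finC this] have "c \<in> ?C" unfolding assms(4) max_disjoint_def .
  then obtain SS where SS: "SS \<subseteq> ?EE" "pairwise (t_disjoint d H (d + 1)) SS" "card SS = c"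
    by (elim CollectE exE conjE) simp
  have finSS: "finite SS" using SS(1) finEE finite_subset by blast
  have farSS: "far ?EE E F" if "E \<in> SS" "F \<in> SS" "E \<noteq> F" for E F
    using t_disjoint_imp_far[OF assms(3) fE d EX, of E F] SS that by (auto simp: pairwise_def)
  have disjSS: "E \<inter> F = {}" if "E \<in> SS" "F \<in> SS" "E \<noteq> F" for E F
    using farSS[OF that] by (simp add: far_def)
  have c1: "c \<ge> 1" using c_max[of "{E0}"] E0 by simp
  obtain idx :: "'v \<Rightarrow> nat" where idx: "inj_on idx ?X"
    and blk: "\<forall>E\<in>SS. \<forall>a\<in>E \<inter> ?X. \<forall>b\<in>E \<inter> ?X. \<forall>y\<in>\<Union>SS \<inter> ?X. idx a < idx y \<longrightarrow> idx y < idx b \<longrightarrow> y \<in> E"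
    using block_enumeration[OF finX finSS disjSS] by blast
  interpret K: koszul ?X idx "TYPE('k)" by unfold_locales (fact finX idx)+
  let ?U = "multiples (sqfree ` ?EE)"
  have I: "I = polys ?X \<inter> mon_ideal ?U" using K.edge_ideal_eq[OF refl EX] assms(5) by simp
  have U0: "(\<lambda>_. 0) \<notin> ?U"
  proof
    assume "(\<lambda>_. 0) \<in> ?U"
    then obtain E where E: "E \<in> ?EE" "sqfree E \<le> (\<lambda>_. 0)" by (auto simp: multiples_def)
    then have "E = {}" by (auto simp: le_fun_def)
    then show False using E2[OF E(1)] by simp
  qed
  have "\<exists>B. K.reg_le ?U B"
  proof (rule K.reg_le_finitely_generated)
    show "t x = 0" if "t \<in> sqfree ` ?EE" "x \<notin> ?X" for t x using EX that by (auto simp: subset_iff)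
  qed (use finEE in simp)
  then obtain B where B: "K.reg_le ?U B" ..
  note betti = K.graded_betti_nonzero_iff[OF upset_multiples B U0, folded I]
  let ?R = "{int j - int i | i j. graded_betti ?X I i j \<noteq> 0}"
  have finR: "finite ?R" using K.finite_betti_degrees[OF upset_multiples B U0] unfolding I .
  have "\<not> K.koszul_zero ?U (card SS) (card SS * d)"
  proof (rule K.disjoint_edges_koszul_class[OF _ _ SS(1) disjSS])
    show "E \<subseteq> ?X \<and> card E = d" if "E \<in> ?EE" for E using EX cE that by blast
    show "1 \<le> d" using d by simp
    \<comment> \<open>An edge \<open>G\<close> inside the union that differs from an edge \<open>E\<close> it meets would permit an exchange
      between \<open>E\<close> and another edge of \<open>SS\<close>.\<close>
    show "G \<in> SS" if G: "G \<in> ?EE" "G \<subseteq> \<Union>SS" for G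
    proof -
      have "G \<noteq> {}" using E2[OF G(1)] by auto
      then obtain E where E: "E \<in> SS" "G \<inter> E \<noteq> {}" using G by blast
      have "E = G"
      proof (rule ccontr)
        assume "E \<noteq> G"
        moreover have "E \<in> ?EE" "E \<inter> G \<noteq> {}" using E SS by auto
        ultimately obtain e f where ef: "e \<in> E - G" "f \<in> G - E" "insert f (E - {e}) \<in> ?EE"
          using ex[unfolded exchange_def, rule_format, of E G] G by meson
        then obtain F where F: "F \<in> SS" "f \<in> F" using G by blast
        then have "F \<noteq> E" using ef by blast
        then show False using farSS[OF E(1) F(1)] ef F by (auto simp: far_def)
      qed
      then show ?thesis using E by simp
    qed
    show "y \<in> E" if "E \<in> SS" "a \<in> E" "b \<in> E" "y \<in> \<Union>SS" "idx a < idx y" "idx y < idx b" for E a b y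
      using blk that SS(1) EX by blast
  qed
  moreover have "card SS = Suc (c - 1)" using c1 SS(3) by simp
  ultimately have "graded_betti ?X I (c - 1) (c * d) \<noteq> 0" using SS(3) unfolding betti by metis
  then have inR: "int (c * d) - int (c - 1) \<in> ?R" by blast
  have val: "int (c * d) - int (c - 1) = (int d - 1) * int c + 1"
    using c1 by (simp add: algebra_simps of_nat_diff)
  have "I \<noteq> {0}"
  proof -
    have "single (K.sqfree_mon E0) 1 \<in> I"
      unfolding I using E0 EX[OF E0]
      by (auto simp: mon_ideal_def multiples_def polys_def K.keys_sqfree_mon K.lookup_sqfree_mon le_fun_def intro!: bexI[of _ E0])
    moreover have "single (K.sqfree_mon E0) (1 :: 'k) \<noteq> 0" by (metis lookup_single_eq lookup_zero zero_neq_one)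
    ultimately show ?thesis by blast
  qed
  then have reg: "regularity ?X I = Max ?R" by (simp add: regularity_def)
  have lower: "regularity ?X I \<ge> (int d - 1) * int c + 1"
    unfolding reg val[symmetric] by (rule Max_ge[OF finR inR])
  moreover have "regularity ?X I \<le> (int d - 1) * int c + 1" if tri: "triangulated d H"
  proof -
    have "K.reg_le (multiples (sqfree ` {E\<in>?EE. E \<subseteq> ?X})) ((d - 1) * c)"
    proof (rule K.reg_le_triangulated[OF _ _ ex])
      show "E \<subseteq> ?X \<and> card E = Suc (d - 1)" if "E \<in> ?EE" for E using EX cE d that by simp
      show "1 \<le> d - 1" using d by simp
      fix Y assume Y: "Y \<subseteq> ?X" "Y \<noteq> {}"
      then obtain x where x: "x \<in> Y" and compl: "complete_hypergraph d
          (card (neighbors (induced_hypergraph H Y) x) + 1)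
          (induced_hypergraph (induced_hypergraph H Y) (neighbors (induced_hypergraph H Y) x \<union> {x}))"
        using tri unfolding triangulated_def Let_def by blast
      have nb: "neighbors (induced_hypergraph H Y) x = K.nbr ?EE Y x"
        by (auto simp: neighbors_def induced_hypergraph_def K.nbr_def)
      have "G \<in> ?EE" if "G \<subseteq> insert x (K.nbr ?EE Y x)" "card G = Suc (d - 1)" for G
      proof -
        have "G \<in> {E. E \<subseteq> insert x (K.nbr ?EE Y x) \<and> card E = d}" using that d by simp
        then show ?thesis using compl unfolding nb complete_hypergraph_def
          by (auto simp: induced_hypergraph_def)
      qed
      then show "\<exists>x\<in>Y. \<forall>G. G \<subseteq> insert x (K.nbr ?EE Y x) \<longrightarrow> card G = Suc (d - 1) \<longrightarrow> G \<in> ?EE"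
        using x by blast
    next
      fix S assume S: "S \<subseteq> {E\<in>?EE. E \<subseteq> ?X}" "pairwise (far ?EE) S"
      have "pairwise (t_disjoint d H (d + 1)) S"
        using S(2) far_imp_t_disjoint[OF assms(3) fE] d by (auto simp: pairwise_def)
      then show "card S \<le> c" using S(1) by (intro c_max) auto
    qed simp
    moreover have "{E\<in>?EE. E \<subseteq> ?X} = ?EE" using EX by blast
    ultimately have V: "K.reg_le ?U ((d - 1) * c)" by simp
    have "int j - int i \<le> (int d - 1) * int c + 1" if "graded_betti ?X I i j \<noteq> 0" for i j
    proof -
      have "\<not> K.koszul_zero ?U (Suc i) j" using that betti by simp
      then have "j \<le> (d - 1) * c + Suc i" using K.koszul_zero_of_reg_le[OF upset_multiples V, of "Suc i" j] by (meson not_le)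
      then have "int j \<le> int ((d - 1) * c + Suc i)" by linarith
      then show ?thesis using d by (simp add: of_nat_diff)
    qed
    then have "\<forall>r\<in>?R. r \<le> (int d - 1) * int c + 1" by blast
    moreover have "?R \<noteq> {}" using inR by blast
    ultimately show ?thesis unfolding reg using finR by (simp add: Max_le_iff)
  qed
  ultimately show ?thesis by (meson order_antisym)
qed

end
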